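(* Let $K$ be a subfield of $\mathbb{C}$ and let $A$ be a finite-dimensional commutative nonassociative algebra over $K$. (a) If $A$ is generic, then $\frac12\notin\sigma(A)$. (b) In the converse direction: if $\frac12\notin\sigma(A)$ and $A$ does not contain nonzero $2$-nilpotents, then $A$ is generic.
   Context: "Nonassociative" means not necessarily associative. An element $c$ of an algebra is an idempotent if $c^2=c$, and a $2$-nilpotent if $c^2=0$. An algebra $A$ over $K\subset\mathbb{C}$ with $n=\dim_K A$ is called generic if its complexification $A_{\mathbb{C}}=A\otimes_K\mathbb{C}$ contains exactly $2^n$ distinct idempotents (the zero element included). For $x\in A$ let $L_x y=xy$. The Peirce spectrum $\sigma(c)$ of an idempotent $c\in A$ is the collection of complex roots, counted with multiplicity, of the characteristic polynomial $\chi_c(t)=\det(L_c-tI)$. The Peirce spectrum $\sigma(A)$ of the algebra $A$ is the set of all distinct values occurring in $\sigma(c)$ when $c$ runs over all idempotents of $A$.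
   Formalization: In (b), the spectrum and the absence of nonzero 2-nilpotents are taken in the complexification A_C rather than in A, since (b) read in A fails for K = R, e.g. A = R^2 with (x,y)^2 = (x^2+y^2, 0); for K = C nothing changes. *)

theory Defs
  imports "HOL.Vector_Spaces" "Jordan_Normal_Form.Char_Poly"
begin

text \<open>
  A subfield of the complex numbers is given as a field type \<open>'k\<close> together with a
  field homomorphism \<open>\<iota> :: 'k \<Rightarrow> complex\<close>, the inclusion (it is automatically injective).
  The product of an algebra is an explicit function \<open>mul\<close>; it is only required to be bilinear,
  so it need be neither associative nor unital.
\<close>

locale nonassoc_algebra = vector_space scale
  for scale :: "'k::field \<Rightarrow> 'a::ab_group_add \<Rightarrow> 'a" +
  fixes mul :: "'a \<Rightarrow> 'a \<Rightarrow> 'a"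
  assumes linear_left: "Vector_Spaces.linear scale scale (\<lambda>x. mul x y)"
    and linear_right: "Vector_Spaces.linear scale scale (\<lambda>y. mul x y)"

locale fd_comm_nonassoc_algebra = nonassoc_algebra scale mul
  for scale :: "'k::field \<Rightarrow> 'a::ab_group_add \<Rightarrow> 'a" and mul :: "'a \<Rightarrow> 'a \<Rightarrow> 'a" +
  assumes finite_dim: "\<exists>B. finite B \<and> span B = UNIV"
    and commute: "mul x y = mul y x"

definition idempotents :: "('a \<Rightarrow> 'a \<Rightarrow> 'a) \<Rightarrow> 'a set" where
  "idempotents mul = {c. mul c c = c}"

definition two_nilpotents :: "('a::zero \<Rightarrow> 'a \<Rightarrow> 'a) \<Rightarrow> 'a set" where
  "two_nilpotents mul = {c. mul c c = 0}"

definition is_basis_list :: "('k::field \<Rightarrow> 'a::ab_group_add \<Rightarrow> 'a) \<Rightarrow> 'a list \<Rightarrow> bool" where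
  "is_basis_list scale bs \<longleftrightarrow>
     distinct bs \<and> \<not> module.dependent scale (set bs) \<and> module.span scale (set bs) = UNIV"

definition matrix_of :: "('k::field \<Rightarrow> 'a::ab_group_add \<Rightarrow> 'a) \<Rightarrow> 'a list \<Rightarrow> ('a \<Rightarrow> 'a) \<Rightarrow> 'k mat" where
  "matrix_of scale bs f =
     mat (length bs) (length bs)
       (\<lambda>(i, j). module.representation scale (set bs) (f (bs ! j)) (bs ! i))"

text \<open>
  The polynomial \<open>det (f - t I)\<close> of an endomorphism of a finite-dimensional space. The
  determinant does not depend on the basis, so an arbitrary one is chosen.
\<close>

definition endo_char_poly :: "('k::field \<Rightarrow> 'a::ab_group_add \<Rightarrow> 'a) \<Rightarrow> ('a \<Rightarrow> 'a) \<Rightarrow> 'k poly" where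
  "endo_char_poly scale f =
     (let bs = (SOME bs. is_basis_list scale bs); n = length bs
      in det (map_mat (\<lambda>a. [:a:]) (matrix_of scale bs f) - [:0, 1:] \<cdot>\<^sub>m 1\<^sub>m n))"

definition peirce_spectrum ::
  "('k::field \<Rightarrow> complex) \<Rightarrow> ('k \<Rightarrow> 'a::ab_group_add \<Rightarrow> 'a) \<Rightarrow> ('a \<Rightarrow> 'a \<Rightarrow> 'a) \<Rightarrow> 'a \<Rightarrow> complex multiset"
  where "peirce_spectrum \<iota> scale mul c = proots (map_poly \<iota> (endo_char_poly scale (mul c)))"

definition algebra_spectrum ::
  "('k::field \<Rightarrow> complex) \<Rightarrow> ('k \<Rightarrow> 'a::ab_group_add \<Rightarrow> 'a) \<Rightarrow> ('a \<Rightarrow> 'a \<Rightarrow> 'a) \<Rightarrow> complex set"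
  where "algebra_spectrum \<iota> scale mul =
    (\<Union>c\<in>idempotents mul. set_mset (peirce_spectrum \<iota> scale mul c))"

text \<open>
  The complex algebra \<open>(scaleC, mulC)\<close> is the complexification of \<open>(scale, mul)\<close>, with
  \<open>j a\<close> in the role of \<open>a \<otimes> 1\<close>. The scalar extension is only determined up to isomorphism;
  the last three conditions say that the map from the tensor product to \<open>'v\<close> sending
  \<open>a \<otimes> z\<close> to \<open>scaleC z (j a)\<close> is bijective, the first three that it is a
  well-defined homomorphism of algebras.
\<close>

locale complexification =
  A: nonassoc_algebra scale mul + AC: nonassoc_algebra scaleC mulC
  for \<iota> :: "'k::field \<Rightarrow> complex"
    and scale :: "'k \<Rightarrow> 'a::ab_group_add \<Rightarrow> 'a" and mul :: "'a \<Rightarrow> 'a \<Rightarrow> 'a"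
    and scaleC :: "complex \<Rightarrow> 'v::ab_group_add \<Rightarrow> 'v" and mulC :: "'v \<Rightarrow> 'v \<Rightarrow> 'v" +
  fixes j :: "'a \<Rightarrow> 'v"
  assumes j_add: "j (x + y) = j x + j y"
    and j_scale: "j (scale k x) = scaleC (\<iota> k) (j x)"
    and j_mult: "j (mul x y) = mulC (j x) (j y)"
    and j_inj: "inj j"
    and j_independent: "\<not> A.dependent B \<Longrightarrow> \<not> AC.dependent (j ` B)"
    and j_spans: "AC.span (range j) = UNIV"

text \<open>A complex algebra is its own complexification.\<close>

lemma complexification_self:
  assumes "nonassoc_algebra scale mul"
  shows "complexification (\<lambda>z. z) scale mul scale mul (\<lambda>x. x)"
proof -
  interpret nonassoc_algebra scale mul by fact
  show ?thesis
    by unfold_locales (simp_all add: span_UNIV)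
qed

text \<open>
  Genericity of \<open>(scale, mul)\<close>, where \<open>mulC\<close> is the product of its complexification. As
  \<open>card\<close> is 0 on infinite sets, the equation includes finiteness.
\<close>

definition generic_algebra ::
  "('k::field \<Rightarrow> 'a::ab_group_add \<Rightarrow> 'a) \<Rightarrow> ('v \<Rightarrow> 'v \<Rightarrow> 'v) \<Rightarrow> bool" where
  "generic_algebra scale mulC \<longleftrightarrow>
     card (idempotents mulC) = 2 ^ vector_space.dim scale (UNIV :: 'a set)"

end

theory Submission
  imports Defs "HOL-Analysis.Analysis"
begin

text \<open>
  In coordinates, idempotents of the complexification are the zeros of the quadratic map
  \<open>F x = x\<^sup>2 - x\<close> on complex \<open>n\<close>-space, and \<open>1/2\<close> is in the spectrum of an idempotent
  iff the Jacobian determinant of \<open>F\<close> vanishes there. This is a form of Bezout's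
  theorem for \<open>n\<close> quadrics.

  Zeros are counted by continuation along complex lines of polynomial maps. The number of zeros
  in a region is locally constant as long as all zeros are nondegenerate and none of them
  leaves the region, and the complex line minus finitely many bad parameters is connected.
  Degenerate parameters are finite in number for lines ending at \<open>F - y\<close> with \<open>y\<close> generic, since
  \<open>n + 2\<close> polynomials in \<open>n + 1\<close> variables are algebraically dependent; parameters with zeros at
  infinity are controlled by eigenvalues of a fixed matrix. Continuation to \<open>x\<^sub>i\<^sup>2 - x\<^sub>i\<close>, which has
  \<open>2\<^sup>n\<close> zeros, gives (b), and shows that \<open>F - y\<close> never has more than \<open>2\<^sup>n\<close> zeros for generic \<open>y\<close>.
  For (a), if \<open>F\<close> has \<open>2\<^sup>n\<close> zeros and one is degenerate, then for small generic \<open>y\<close> the map \<open>F - y\<close>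
  has at least one zero near each zero of \<open>F\<close> and two near the degenerate one: too many.
\<close>

text \<open>(a) does not exclude nilpotents, so zeros may run off to infinity as the line reaches
  \<open>F - y\<close>. There the global count gives only an upper bound: nondegenerate zeros at the
  end point persist at nearby parameters, where there are exactly \<open>2^n\<close> zeros. The
  contradicting lower bound has to be local. Since the persistence argument covers only
  nondegenerate zeros, each zero of \<open>F\<close> gets its own auxiliary map: close to
  \<open>F\<close> on a small ball, with one regular zero (two at the degenerate point) prescribed
  in it. These are continued to \<open>F - y\<close>; none leaves the ball because \<open>F\<close>
  is bounded away from 0 on its boundary. Derivatives and the implicit function theorem are replaced
  by matrices \<open>M x y\<close> with \<open>G x - G y = M x y (x - y)\<close>: on the diagonal
  they are Jacobians, off it they show injectivity, and a Newton step shows existence. The shift by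
  \<open>y\<close> is there because elimination makes the degenerate parameters finite only for
  \<open>y\<close> outside a hypersurface.\<close>

unbundle no vec_syntax

section \<open>Determinants\<close>

text \<open>Entries are a bare function, so that they may depend on points and parameters without
  carrier conditions.\<close>

definition cdet :: "nat \<Rightarrow> (nat \<Rightarrow> nat \<Rightarrow> complex) \<Rightarrow> complex" where
  "cdet n f = Determinant.det (Matrix.mat n n (\<lambda>(i, k). f i k))"

lemma permutes_lessThan_less:
  fixes p :: "nat \<Rightarrow> nat"
  assumes "p permutes {0..<n}" "i < n" shows "p i < n"
  using permutes_in_image[OF assms(1), of i] assms(2) by simp

lemma cdet_expand:
  "cdet n f = (\<Sum>p | p permutes {0..<n}. signof p * (\<Prod>i = 0..<n. f i (p i)))"
proof -
  have "cdet n f = (\<Sum>p | p permutes {0..<n}. signof p *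
      (\<Prod>i = 0..<n. Matrix.mat n n (\<lambda>(i, k). f i k) $$ (i, p i)))"
    unfolding cdet_def by (rule det_def') auto
  also have "\<dots> = (\<Sum>p | p permutes {0..<n}. signof p * (\<Prod>i = 0..<n. f i (p i)))"
    by (intro sum.cong refl arg_cong2[where f = "(*)"] prod.cong) (auto dest: permutes_lessThan_less)
  finally show ?thesis .
qed

lemma cdet_cong:
  assumes "\<And>i k. i < n \<Longrightarrow> k < n \<Longrightarrow> f i k = g i k"
  shows "cdet n f = cdet n g"
  unfolding cdet_def using assms by (intro arg_cong[where f = Determinant.det] eq_matI) auto

lemma cdet_0_iff:
  "cdet n f = 0 \<longleftrightarrow> (\<exists>u. (\<exists>k<n. u k \<noteq> 0) \<and> (\<forall>i<n. (\<Sum>k<n. f i k * u k) = 0))"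
proof -
  let ?A = "Matrix.mat n n (\<lambda>(i, k). f i k)"
  have mv: "(?A *\<^sub>v v) $ i = (\<Sum>k<n. f i k * v $ k)" if "v \<in> carrier_vec n" "i < n" for v i
    using that by (auto simp: scalar_prod_def lessThan_atLeast0 intro!: sum.cong)
  have "cdet n f = 0 \<longleftrightarrow> (\<exists>v. v \<in> carrier_vec n \<and> v \<noteq> 0\<^sub>v n \<and> ?A *\<^sub>v v = 0\<^sub>v n)"
    unfolding cdet_def by (rule det_0_iff_vec_prod_zero_field) auto
  also have "\<dots> \<longleftrightarrow> (\<exists>u. (\<exists>k<n. u k \<noteq> 0) \<and> (\<forall>i<n. (\<Sum>k<n. f i k * u k) = 0))"
  proof safe
    fix v assume v: "v \<in> carrier_vec n" "v \<noteq> 0\<^sub>v n" "?A *\<^sub>v v = 0\<^sub>v n"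
    have "\<exists>k<n. v $ k \<noteq> 0"
      using v(1,2) by (metis eq_vecI carrier_vecD index_zero_vec)
    moreover have "(\<Sum>k<n. f i k * v $ k) = 0" if "i < n" for i
      using mv[OF v(1) that] v(3) that by simp
    ultimately show "\<exists>u. (\<exists>k<n. u k \<noteq> 0) \<and> (\<forall>i<n. (\<Sum>k<n. f i k * u k) = 0)"
      by (intro exI[of _ "\<lambda>k. v $ k"]) auto
  next
    fix u k assume u: "\<forall>i<n. (\<Sum>k<n. f i k * u k) = 0" "k < n" "u k \<noteq> 0"
    have c: "Matrix.vec n u \<in> carrier_vec n" by simp
    have "Matrix.vec n u \<noteq> 0\<^sub>v n"
      using u by (metis index_vec index_zero_vec(1))
    moreover have "?A *\<^sub>v Matrix.vec n u = 0\<^sub>v n"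
      using mv[OF c] u by (intro eq_vecI) auto
    ultimately show "\<exists>v. v \<in> carrier_vec n \<and> v \<noteq> 0\<^sub>v n \<and> ?A *\<^sub>v v = 0\<^sub>v n"
      using c by blast
  qed
  finally show ?thesis .
qed

lemma cdet_solve:
  assumes "cdet n f \<noteq> 0"
  shows "\<exists>u. \<forall>i<n. (\<Sum>k<n. f i k * u k) = b i"
proof -
  let ?A = "Matrix.mat n n (\<lambda>(i, k). f i k)"
  have "?A \<in> Units (ring_mat TYPE(complex) n ())"
    using assms unfolding cdet_def by (intro det_non_zero_imp_unit) auto
  then obtain B where B: "B \<in> carrier_mat n n" "?A * B = 1\<^sub>m n"
    unfolding Units_def by (auto simp: ring_mat_simps)
  define v where "v = B *\<^sub>v Matrix.vec n b"
  have v: "v \<in> carrier_vec n" unfolding v_def using B by auto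
  have "?A *\<^sub>v v = (?A * B) *\<^sub>v Matrix.vec n b"
    unfolding v_def using B by (intro assoc_mult_mat_vec[symmetric]) auto
  then have Av: "?A *\<^sub>v v = Matrix.vec n b" using B by simp
  have "(\<Sum>k<n. f i k * v $ k) = b i" if "i < n" for i
  proof -
    have "(?A *\<^sub>v v) $ i = (\<Sum>k<n. f i k * v $ k)"
      using that v by (auto simp: scalar_prod_def lessThan_atLeast0 intro!: sum.cong)
    then show ?thesis using Av that by simp
  qed
  then show ?thesis by blast
qed

lemma cdet_scale:
  assumes "c \<noteq> 0" shows "cdet n (\<lambda>i k. c * f i k) = 0 \<longleftrightarrow> cdet n f = 0"
  unfolding cdet_0_iff using assms
  by (simp add: mult.assoc flip: sum_distrib_left)

text \<open>Eigenvalues are roots of a characteristic polynomial. The index set is arbitrary because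
  it will consist of words in the analysis of zeros at infinity.\<close>

lemma finite_eigenvalues:
  fixes B :: "'w \<Rightarrow> 'w \<Rightarrow> complex"
  assumes "finite I"
  shows "finite {t. \<exists>X. (\<exists>w\<in>I. X w \<noteq> 0) \<and> (\<forall>w\<in>I. (\<Sum>w'\<in>I. B w w' * X w') = t * X w)}"
proof -
  define r where "r = card I"
  obtain h where h: "bij_betw h {..<r} I"
    using ex_bij_betw_nat_finite[OF assms] unfolding r_def lessThan_atLeast0 by blast
  define A where "A = Matrix.mat r r (\<lambda>(i, k). B (h i) (h k))"
  have A: "A \<in> carrier_mat r r" unfolding A_def by auto
  have "eigenvalue A t" if X: "\<exists>w\<in>I. X w \<noteq> 0" "\<forall>w\<in>I. (\<Sum>w'\<in>I. B w w' * X w') = t * X w" for t X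
  proof -
    let ?v = "Matrix.vec r (\<lambda>i. X (h i))"
    obtain i where i: "i < r" "X (h i) \<noteq> 0"
      using X(1) h unfolding bij_betw_def by auto
    then have nz: "?v \<noteq> 0\<^sub>v r" by (metis index_vec index_zero_vec(1))
    have "(A *\<^sub>v ?v) $ i = t * X (h i)" if "i < r" for i
    proof -
      have "h i \<in> I" using h that by (auto simp: bij_betw_def)
      have "(A *\<^sub>v ?v) $ i = (\<Sum>k<r. B (h i) (h k) * X (h k))"
        using that by (auto simp: A_def scalar_prod_def lessThan_atLeast0 intro!: sum.cong)
      also have "\<dots> = (\<Sum>w'\<in>I. B (h i) w' * X w')"
        by (rule sum.reindex_bij_betw[OF h])
      finally show ?thesis using X(2) \<open>h i \<in> I\<close> by simp
    qed
    then have "A *\<^sub>v ?v = t \<cdot>\<^sub>v ?v"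
      using A by (intro eq_vecI) auto
    then show ?thesis
      using A nz unfolding eigenvalue_def eigenvector_def by (intro exI[of _ ?v]) auto
  qed
  then have sub: "{t. \<exists>X. (\<exists>w\<in>I. X w \<noteq> 0) \<and> (\<forall>w\<in>I. (\<Sum>w'\<in>I. B w w' * X w') = t * X w)}
      \<subseteq> {t. poly (char_poly A) t = 0}"
    using eigenvalue_root_char_poly[OF A] by blast
  have "char_poly A \<noteq> 0" using degree_monic_char_poly[OF A] by auto
  then show ?thesis using finite_subset[OF sub] poly_roots_finite by blast
qed

section \<open>Polynomial functions and elimination\<close>

text \<open>Polynomials are represented by their functions on sequences; over an infinite field
  nothing is lost, and being a nonzero polynomial becomes being nonzero at some point. Only
  coordinates below \<open>n\<close> are read, so one type serves all dimensions.\<close>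

inductive polyfun :: "nat \<Rightarrow> ((nat \<Rightarrow> complex) \<Rightarrow> complex) \<Rightarrow> bool" for n where
  polyfun_const: "polyfun n (\<lambda>_. c)"
| polyfun_coord: "i < n \<Longrightarrow> polyfun n (\<lambda>x. x i)"
| polyfun_add: "polyfun n f \<Longrightarrow> polyfun n g \<Longrightarrow> polyfun n (\<lambda>x. f x + g x)"
| polyfun_mult: "polyfun n f \<Longrightarrow> polyfun n g \<Longrightarrow> polyfun n (\<lambda>x. f x * g x)"

lemma polyfun_uminus: "polyfun n f \<Longrightarrow> polyfun n (\<lambda>x. - f x)"
  using polyfun_mult[OF polyfun_const[of n "-1"]] by simp

lemma polyfun_diff: "polyfun n f \<Longrightarrow> polyfun n g \<Longrightarrow> polyfun n (\<lambda>x. f x - g x)"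
  using polyfun_add[OF _ polyfun_uminus] by fastforce

lemma polyfun_power: "polyfun n f \<Longrightarrow> polyfun n (\<lambda>x. f x ^ k)"
  by (induction k) (auto intro: polyfun_const polyfun_mult)

lemma polyfun_sum: "(\<And>a. a \<in> A \<Longrightarrow> polyfun n (f a)) \<Longrightarrow> polyfun n (\<lambda>x. \<Sum>a\<in>A. f a x)"
  by (induction A rule: infinite_finite_induct) (auto intro: polyfun_const polyfun_add)

lemma polyfun_prod: "(\<And>a. a \<in> A \<Longrightarrow> polyfun n (f a)) \<Longrightarrow> polyfun n (\<lambda>x. \<Prod>a\<in>A. f a x)"
  by (induction A rule: infinite_finite_induct) (auto intro: polyfun_const polyfun_mult)

lemmas polyfun_intros = polyfun_const polyfun_coord polyfun_add polyfun_mult polyfun_uminus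
  polyfun_diff polyfun_power polyfun_sum polyfun_prod

lemma polyfun_cdet:
  "(\<And>i k. i < n \<Longrightarrow> k < n \<Longrightarrow> polyfun m (\<lambda>x. f x i k)) \<Longrightarrow> polyfun m (\<lambda>x. cdet n (f x))"
  unfolding cdet_expand by (intro polyfun_intros) (auto dest: permutes_lessThan_less)

lemma polyfun_compose:
  assumes "polyfun m f" "\<And>i. i < m \<Longrightarrow> polyfun n (g i)"
  shows "polyfun n (\<lambda>x. f (\<lambda>i. g i x))"
  using assms by induction (auto intro: polyfun_intros)

lemma polyfun_mono: "polyfun n f \<Longrightarrow> n \<le> m \<Longrightarrow> polyfun m f"
  using polyfun_compose[of n f m "\<lambda>i x. x i"] polyfun_coord by auto

lemma polyfun_agree:
  assumes "polyfun n f" "\<And>i. i < n \<Longrightarrow> x i = y i" shows "f x = f y"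
  using assms by induction auto

lemma polyfun_continuous: "polyfun n f \<Longrightarrow> continuous_on S f"
  by (induction rule: polyfun.induct)
    (auto intro!: continuous_intros intro: continuous_on_subset[OF continuous_on_product_coordinates])

lemma polyfun_curve:
  assumes "polyfun n f" "\<And>i. i < n \<Longrightarrow> \<exists>p. \<forall>s. g s i = poly p s"
  shows "\<exists>p. \<forall>s. f (g s) = poly p s"
  using assms
proof induction
  case (polyfun_const c)
  show ?case by (intro exI[of _ "[:c:]"]) simp
next
  case (polyfun_add f g)
  then show ?case by (metis poly_add)
next
  case (polyfun_mult f g)
  then show ?case by (metis poly_mult)
qed blast

lemma polyfun_line: 
  assumes "polyfun n f" shows "\<exists>p. \<forall>s. f (\<lambda>i. a i + s * b i) = poly p s"
proof (rule polyfun_curve[OF assms])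
  show "\<exists>p. \<forall>s. a i + s * b i = poly p s" for i
    by (intro exI[of _ "[:a i, b i:]"]) (simp add: algebra_simps)
qed

lemma polyfun_line_finite_roots:
  assumes "polyfun n f" "f (\<lambda>i. a i + s0 * b i) \<noteq> 0"
  shows "finite {s. f (\<lambda>i. a i + s * b i) = 0}"
proof -
  obtain p where p: "\<And>s. f (\<lambda>i. a i + s * b i) = poly p s"
    using polyfun_line[OF assms(1)] by blast
  with assms(2) have "p \<noteq> 0" by auto
  with p show ?thesis by (simp add: poly_roots_finite)
qed

text \<open>On the line through \<open>x\<close> and \<open>y\<close> both functions restrict to
  nonzero polynomials in one variable, which have finitely many roots.\<close>

lemma polyfun_no_zero_divisors:
  assumes "polyfun n f" "polyfun n g" "f x \<noteq> 0" "g y \<noteq> 0"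
  shows "\<exists>z. f z * g z \<noteq> 0"
proof -
  let ?l = "\<lambda>s i. x i + s * (y i - x i)"
  have "finite ({s. f (?l s) = 0} \<union> {s. g (?l s) = 0})"
    using polyfun_line_finite_roots[OF assms(1), of x 0 "\<lambda>i. y i - x i"]
      polyfun_line_finite_roots[OF assms(2), of x 1 "\<lambda>i. y i - x i"] assms(3,4) by simp
  then obtain s where "s \<notin> {s. f (?l s) = 0} \<union> {s. g (?l s) = 0}"
    using ex_new_if_finite[OF infinite_UNIV_char_0] by blast
  then show ?thesis by auto
qed

lemma polyfun_finite_family_nonzero:
  assumes "finite A" "\<And>a. a \<in> A \<Longrightarrow> polyfun n (q a)" "\<And>a. a \<in> A \<Longrightarrow> \<exists>x. q a x \<noteq> 0"
  shows "\<exists>x. \<forall>a\<in>A. q a x \<noteq> 0"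
proof -
  have "\<exists>x. (\<Prod>a\<in>A. q a x) \<noteq> 0"
    using assms
  proof (induction A)
    case (insert b A)
    obtain x where x: "q b x \<noteq> 0" using insert.prems(2) by blast
    obtain y where y: "(\<Prod>a\<in>A. q a y) \<noteq> 0" using insert.IH insert.prems by blast
    have "polyfun n (\<lambda>x. \<Prod>a\<in>A. q a x)" using insert.prems(1) by (intro polyfun_prod) simp
    then obtain z where "q b z * (\<Prod>a\<in>A. q a z) \<noteq> 0"
      using polyfun_no_zero_divisors[where f = "q b" and g = "\<lambda>x. \<Prod>a\<in>A. q a x", OF _ _ x y]
        insert.prems(1)[of b] by blast
    then show ?case using insert.hyps by auto
  qed auto
  then show ?thesis using assms(1) by (metis prod_zero_iff)
qed

section \<open>Algebraic dependence by counting monomials\<close>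

text \<open>Bounding each exponent separately, not the total degree, makes the number of monomials
  \<open>(K + 1) ^ m\<close>, which the later dimension count needs.\<close>

definition monospan :: "nat \<Rightarrow> nat \<Rightarrow> ((nat \<Rightarrow> complex) \<Rightarrow> complex) \<Rightarrow> bool" where
  "monospan m K f \<longleftrightarrow>
    (\<exists>c. \<forall>x. f x = (\<Sum>e\<in>PiE {..<m} (\<lambda>_. {..K}). c e * (\<Prod>i<m. x i ^ e i)))"

lemma monospan_monomial:
  assumes "\<And>i. i < m \<Longrightarrow> e i \<le> K"
  shows "monospan m K (\<lambda>x. a * (\<Prod>i<m. x i ^ e i))"
proof -
  let ?e = "restrict e {..<m}"
  have e: "?e \<in> PiE {..<m} (\<lambda>_. {..K})" using assms by auto
  have fin: "finite (PiE {..<m} (\<lambda>_. {..K}))" by (intro finite_PiE) auto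
  have "(\<Sum>e'\<in>PiE {..<m} (\<lambda>_. {..K}). (if e' = ?e then a else 0) * (\<Prod>i<m. x i ^ e' i))
      = a * (\<Prod>i<m. x i ^ e i)" for x :: "nat \<Rightarrow> complex"
  proof -
    have "(\<Sum>e'\<in>PiE {..<m} (\<lambda>_. {..K}). (if e' = ?e then a else 0) * (\<Prod>i<m. x i ^ e' i))
        = (\<Sum>e'\<in>PiE {..<m} (\<lambda>_. {..K}). if e' = ?e then a * (\<Prod>i<m. x i ^ e' i) else 0)"
      by (intro sum.cong refl) simp
    also have "\<dots> = a * (\<Prod>i<m. x i ^ ?e i)" unfolding sum.delta[OF fin] using e by (simp only: if_True)
    finally show ?thesis by simp
  qed
  note eq = this
  show ?thesis unfolding monospan_def
    by (intro exI[of _ "\<lambda>e'. if e' = ?e then a else 0"] allI eq[symmetric])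
qed

lemma monospan_add:
  assumes "monospan m K f" "monospan m K g" shows "monospan m K (\<lambda>x. f x + g x)"
proof -
  obtain c d where "\<And>x. f x = (\<Sum>e\<in>PiE {..<m} (\<lambda>_. {..K}). c e * (\<Prod>i<m. x i ^ e i))"
    "\<And>x. g x = (\<Sum>e\<in>PiE {..<m} (\<lambda>_. {..K}). d e * (\<Prod>i<m. x i ^ e i))"
    using assms unfolding monospan_def by blast
  then show ?thesis unfolding monospan_def
    by (intro exI[of _ "\<lambda>e. c e + d e"]) (simp add: sum.distrib algebra_simps)
qed

lemma monospan_sum:
  assumes "finite A" "\<And>a. a \<in> A \<Longrightarrow> monospan m K (f a)"
  shows "monospan m K (\<lambda>x. \<Sum>a\<in>A. f a x)"
  using assms
proof (induction A)
  case empty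
  show ?case using monospan_monomial[of m "\<lambda>_. 0" K 0] by simp
qed (auto intro: monospan_add)

lemma monospan_mono:
  assumes "monospan m K f" "K \<le> K'" shows "monospan m K' f"
proof -
  obtain c where c: "\<And>x. f x = (\<Sum>e\<in>PiE {..<m} (\<lambda>_. {..K}). c e * (\<Prod>i<m. x i ^ e i))"
    using assms unfolding monospan_def by blast
  have "monospan m K' (\<lambda>x. \<Sum>e\<in>PiE {..<m} (\<lambda>_. {..K}). c e * (\<Prod>i<m. x i ^ e i))"
  proof (intro monospan_sum monospan_monomial finite_PiE)
    fix e i assume "e \<in> PiE {..<m} (\<lambda>_. {..K})" "i < m"
    then have "e i \<le> K" by auto
    then show "e i \<le> K'" using assms(2) by simp
  qed auto
  moreover have "f = (\<lambda>x. \<Sum>e\<in>PiE {..<m} (\<lambda>_. {..K}). c e * (\<Prod>i<m. x i ^ e i))" using c by blast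
  ultimately show ?thesis by simp
qed

lemma monospan_mult:
  assumes "monospan m K f" "monospan m L g" shows "monospan m (K + L) (\<lambda>x. f x * g x)"
proof -
  obtain c d where c: "\<And>x. f x = (\<Sum>e\<in>PiE {..<m} (\<lambda>_. {..K}). c e * (\<Prod>i<m. x i ^ e i))"
    and d: "\<And>x. g x = (\<Sum>e\<in>PiE {..<m} (\<lambda>_. {..L}). d e * (\<Prod>i<m. x i ^ e i))"
    using assms unfolding monospan_def by blast
  have "(\<lambda>x. f x * g x) = (\<lambda>x. \<Sum>e\<in>PiE {..<m} (\<lambda>_. {..K}). \<Sum>e'\<in>PiE {..<m} (\<lambda>_. {..L}).
      (c e * d e') * (\<Prod>i<m. x i ^ (e i + e' i)))"
    unfolding c d sum_product
    by (intro ext sum.cong refl) (simp add: power_add prod.distrib)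
  moreover have "monospan m (K + L) \<dots>"
  proof (intro monospan_sum monospan_monomial finite_PiE add_mono)
    fix e e' i assume "e \<in> PiE {..<m} (\<lambda>_. {..K})" "e' \<in> PiE {..<m} (\<lambda>_. {..L})" "i < m"
    then show "e i \<le> K" "e' i \<le> L" by auto
  qed auto
  ultimately show ?thesis by simp
qed

lemma monospan_power: "monospan m K f \<Longrightarrow> monospan m (k * K) (\<lambda>x. f x ^ k)"
proof (induction k)
  case 0
  show ?case using monospan_monomial[of m "\<lambda>_. 0" 0 1] by simp
next
  case (Suc k)
  then show ?case using monospan_mult[OF Suc.prems Suc.IH[OF Suc.prems]] by simp
qed

lemma monospan_prod:
  assumes "finite A" "\<And>a. a \<in> A \<Longrightarrow> monospan m K (f a)"
  shows "monospan m (card A * K) (\<lambda>x. \<Prod>a\<in>A. f a x)"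
  using assms
proof (induction A)
  case empty
  show ?case using monospan_monomial[of m "\<lambda>_. 0" 0 1] by simp
next
  case (insert a A)
  then show ?case using monospan_mult[of m K "f a" "card A * K" "\<lambda>x. \<Prod>a\<in>A. f a x"] by simp
qed

lemma polyfun_monospan: "polyfun m f \<Longrightarrow> \<exists>K. monospan m K f"
proof (induction rule: polyfun.induct)
  case (polyfun_const c)
  show ?case using monospan_monomial[of m "\<lambda>_. 0" 0 c] by auto
next
  case (polyfun_coord i)
  have "(\<lambda>x::nat \<Rightarrow> complex. 1 * (\<Prod>k<m. x k ^ (if k = i then 1 else 0))) = (\<lambda>x. x i)"
    using polyfun_coord by (intro ext) (simp add: if_distrib prod.delta cong: if_cong)
  moreover have "monospan m 1 (\<lambda>x. 1 * (\<Prod>k<m. x k ^ (if k = i then 1 else 0)))"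
    by (intro monospan_monomial) simp
  ultimately show ?case by metis
next
  case (polyfun_add f g)
  then obtain K L where "monospan m K f" "monospan m L g" by blast
  then have "monospan m (max K L) f" "monospan m (max K L) g" by (auto intro: monospan_mono)
  then show ?case using monospan_add by blast
next
  case (polyfun_mult f g)
  then show ?case using monospan_mult by blast
qed

text \<open>Zero rows pad the system to a square one. Were its determinant nonzero, the right-hand
  side 1 would be attained, which a zero row forbids.\<close>

lemma underdetermined_system:
  fixes c :: "nat \<Rightarrow> nat \<Rightarrow> complex"
  assumes "r < p"
  shows "\<exists>u. (\<exists>N<p. u N \<noteq> 0) \<and> (\<forall>j<r. (\<Sum>N<p. c j N * u N) = 0)"
proof -
  let ?f = "\<lambda>j N. if j < r then c j N else 0"
  have "cdet p ?f = 0"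
  proof (rule ccontr)
    assume "cdet p ?f \<noteq> 0"
    then obtain u where "\<forall>i<p. (\<Sum>k<p. ?f i k * u k) = 1"
      using cdet_solve[of p ?f "\<lambda>_. 1"] by blast
    then show False using assms by auto
  qed
  then obtain u where u: "\<exists>N<p. u N \<noteq> 0" "\<And>i. i < p \<Longrightarrow> (\<Sum>k<p. ?f i k * u k) = 0"
    unfolding cdet_0_iff by blast
  have "(\<Sum>N<p. c j N * u N) = 0" if "j < r" for j
    using u(2)[of j] that assms by simp
  then show ?thesis using u(1) by blast
qed

text \<open>Dimension count: the \<open>D ^ Suc m\<close> products with exponents below
  \<open>D\<close> lie in the span of \<open>(L + 1) ^ m\<close> monomials, where \<open>L\<close>
  grows only linearly in \<open>D\<close>. The number \<open>N\<close> encodes a tuple of exponents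
  by its base \<open>D\<close> digits.\<close>

lemma polyfun_algebraic_relation:
  assumes f: "\<And>i. i \<le> m \<Longrightarrow> polyfun m (f i)"
  shows "\<exists>D \<alpha>. D > 0 \<and> (\<exists>N<D ^ Suc m. \<alpha> N \<noteq> 0) \<and>
    (\<forall>x. (\<Sum>N<D ^ Suc m. \<alpha> N * (\<Prod>i\<le>m. f i x ^ (N div D ^ i mod D))) = 0)"
proof -
  have "\<forall>i\<in>{..m}. \<exists>K. monospan m K (f i)" using f polyfun_monospan by blast
  then obtain k where k: "\<And>i. i \<le> m \<Longrightarrow> monospan m (k i) (f i)"
    unfolding bchoice_iff by auto
  \<comment> \<open>\<open>Suc\<close> makes the common bound positive, as
    \<open>L + 1 \<le> c * D\<close> requires.\<close>
  define K where "K = Suc (\<Sum>i\<le>m. k i)"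
  have K: "monospan m K (f i)" if "i \<le> m" for i
  proof -
    have "k i \<le> (\<Sum>i\<le>m. k i)" using that by (intro member_le_sum) auto
    then show ?thesis using monospan_mono[OF k[OF that]] unfolding K_def by simp
  qed
  define c where "c = Suc m * K"
  \<comment> \<open>Large enough for
    \<open>(L + 1) ^ m \<le> c ^ m * D ^ m < D ^ Suc m\<close>.\<close>
  define D where "D = Suc (c ^ m)"
  define L where "L = Suc m * ((D - 1) * K)"
  define E where "E = PiE {..<m} (\<lambda>_. {..L})"
  have "L + 1 \<le> c * D"
  proof -
    have "c * D = L + Suc m * K" unfolding L_def c_def D_def by (simp add: algebra_simps)
    moreover have "1 \<le> Suc m * K" unfolding K_def by simp
    ultimately show ?thesis by simp
  qed
  then have "(L + 1) ^ m \<le> (c * D) ^ m" by (intro power_mono) auto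
  also have "\<dots> = c ^ m * D ^ m" by (rule power_mult_distrib)
  also have "\<dots> < D * D ^ m" unfolding D_def by simp
  finally have small: "card E < D ^ Suc m"
    unfolding E_def by (simp add: card_PiE)
  have "monospan m L (\<lambda>x. \<Prod>i\<le>m. f i x ^ (N div D ^ i mod D))" for N
  proof -
    have "monospan m ((D - 1) * K) (\<lambda>x. f i x ^ (N div D ^ i mod D))" if "i \<le> m" for i
    proof -
      have "N div D ^ i mod D < D" unfolding D_def by (intro mod_less_divisor) simp
      then have "(N div D ^ i mod D) * K \<le> (D - 1) * K" by (intro mult_right_mono) auto
      then show ?thesis using monospan_mono[OF monospan_power[OF K[OF that]]] by blast
    qed
    then show ?thesis
      using monospan_prod[of "{..m}" m "(D - 1) * K" "\<lambda>i x. f i x ^ (N div D ^ i mod D)"]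
      unfolding L_def by simp
  qed
  then have "\<forall>N. \<exists>c. \<forall>x. (\<Prod>i\<le>m. f i x ^ (N div D ^ i mod D))
      = (\<Sum>e\<in>E. c e * (\<Prod>i<m. x i ^ e i))"
    unfolding monospan_def E_def by blast
  from choice[OF this] obtain \<gamma> where \<gamma>: "\<And>N x. (\<Prod>i\<le>m. f i x ^ (N div D ^ i mod D))
      = (\<Sum>e\<in>E. \<gamma> N e * (\<Prod>i<m. x i ^ e i))"
    by blast
  have finE: "finite E" unfolding E_def by (intro finite_PiE) auto
  obtain h where h: "bij_betw h {..<card E} E"
    using ex_bij_betw_nat_finite[OF finE] unfolding lessThan_atLeast0 by blast
  obtain \<alpha> where \<alpha>: "\<exists>N<D ^ Suc m. \<alpha> N \<noteq> 0"
    "\<And>j. j < card E \<Longrightarrow> (\<Sum>N<D ^ Suc m. \<gamma> N (h j) * \<alpha> N) = 0"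
    using underdetermined_system[OF small, of "\<lambda>j N. \<gamma> N (h j)"] by blast
  have \<alpha>0: "(\<Sum>N<D ^ Suc m. \<gamma> N e * \<alpha> N) = 0" if "e \<in> E" for e
  proof -
    have "e \<in> h ` {..<card E}" using h that by (simp only: bij_betw_def)
    then obtain j where j: "j < card E" "e = h j" by (elim imageE) simp
    show ?thesis unfolding j(2) by (rule \<alpha>(2)[OF j(1)])
  qed
  have "(\<Sum>N<D ^ Suc m. \<alpha> N * (\<Prod>i\<le>m. f i x ^ (N div D ^ i mod D))) = 0" for x
  proof -
    have "(\<Sum>N<D ^ Suc m. \<alpha> N * (\<Prod>i\<le>m. f i x ^ (N div D ^ i mod D)))
        = (\<Sum>N<D ^ Suc m. \<Sum>e\<in>E. (\<gamma> N e * \<alpha> N) * (\<Prod>i<m. x i ^ e i))"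
      unfolding \<gamma> sum_distrib_left by (simp add: mult_ac)
    also have "\<dots> = (\<Sum>e\<in>E. (\<Sum>N<D ^ Suc m. \<gamma> N e * \<alpha> N) * (\<Prod>i<m. x i ^ e i))"
      by (subst sum.swap) (simp only: sum_distrib_right)
    also have "\<dots> = 0" using \<alpha>0 by simp
    finally show ?thesis .
  qed
  then show ?thesis using \<alpha>(1) unfolding D_def by blast
qed

lemma sum_digits: "(\<Sum>i<m. (N div D ^ i mod D) * D ^ i) = N mod (D ^ m)" for N D :: nat
proof (induction m)
  case (Suc m)
  then show ?case using mod_mult2_eq[of N "D ^ m" D] by (simp add: mult_ac)
qed simp

lemma digit_polynomial_nonzero:
  fixes \<alpha> :: "nat \<Rightarrow> complex"
  assumes "N0 < D ^ m" "\<alpha> N0 \<noteq> 0"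
  shows "\<exists>y. (\<Sum>N<D ^ m. \<alpha> N * (\<Prod>i<m. y i ^ (N div D ^ i mod D))) \<noteq> 0"
proof (rule ccontr)
  assume "\<not> ?thesis"
  then have z: "(\<Sum>N<D ^ m. \<alpha> N * (\<Prod>i<m. y i ^ (N div D ^ i mod D))) = 0" for y by blast
  define p where "p = (\<Sum>N<D ^ m. monom (\<alpha> N) N)"
  \<comment> \<open>Kronecker substitution \<open>y\<^sub>i = w ^ (D ^ i)\<close> turns distinct monomials into distinct powers of \<open>w\<close>.\<close>
  have "poly p w = 0" for w
  proof -
    have "(\<Prod>i<m. (w ^ (D ^ i)) ^ (N div D ^ i mod D)) = w ^ N" if "N < D ^ m" for N
    proof -
      have "(\<Prod>i<m. (w ^ (D ^ i)) ^ (N div D ^ i mod D)) = (\<Prod>i<m. w ^ ((N div D ^ i mod D) * D ^ i))"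
        by (simp add: mult.commute flip: power_mult)
      also have "\<dots> = w ^ (\<Sum>i<m. (N div D ^ i mod D) * D ^ i)" by (simp add: power_sum)
      finally show ?thesis using that by (simp add: sum_digits)
    qed
    then have "poly p w = (\<Sum>N<D ^ m. \<alpha> N * (\<Prod>i<m. (w ^ (D ^ i)) ^ (N div D ^ i mod D)))"
      unfolding p_def by (simp add: poly_sum poly_monom)
    then show ?thesis using z[of "\<lambda>i. w ^ (D ^ i)"] by simp
  qed
  then have "p = 0" using poly_all_0_iff_0 by blast
  moreover have "coeff p N0 = \<alpha> N0"
    unfolding p_def using assms(1) by (simp add: coeff_sum sum.delta)
  ultimately show False using assms(2) by simp
qed

text \<open>For \<open>J\<close> the Jacobian determinant this puts the critical values into a
  proper hypersurface. The \<open>m + 1\<close> polynomials \<open>f i\<close> and \<open>J\<close>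
  satisfy a relation; sorted by powers of \<open>J\<close> and divided by the lowest one that
  occurs, its constant term is a polynomial in the \<open>f i\<close> that vanishes wherever
  \<open>J\<close> does.\<close>

lemma polyfun_elimination:
  assumes f: "\<And>i. i < m \<Longrightarrow> polyfun m (f i)" and J: "polyfun m J" "J x0 \<noteq> 0"
  shows "\<exists>q. polyfun m q \<and> (\<exists>z. q z \<noteq> 0) \<and> (\<forall>x. J x = 0 \<longrightarrow> q (\<lambda>i. f i x) = 0)"
proof -
  \<comment> \<open>With \<open>J\<close> in last place its exponent is the leading base
    \<open>D\<close> digit, so splitting off this digit sorts the relation by powers of
    \<open>J\<close>.\<close>
  define F where "F i = (if i = m then J else f i)" for i
  have F: "polyfun m (F i)" if "i \<le> m" for i using f J that unfolding F_def by simp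
  obtain D \<alpha> where D\<alpha>: "D > 0 \<and> (\<exists>N<D ^ Suc m. \<alpha> N \<noteq> 0) \<and>
      (\<forall>x. (\<Sum>N<D ^ Suc m. \<alpha> N * (\<Prod>i\<le>m. F i x ^ (N div D ^ i mod D))) = 0)"
    using polyfun_algebraic_relation[of m F, OF F] by blast
  then have D: "D > 0" and \<alpha>: "\<exists>N<D ^ Suc m. \<alpha> N \<noteq> 0"
    and rel: "\<And>x. (\<Sum>N<D ^ Suc m. \<alpha> N * (\<Prod>i\<le>m. F i x ^ (N div D ^ i mod D))) = 0"
    by auto
  define P where "P k y = (\<Sum>N<D ^ m. \<alpha> (k * D ^ m + N) * (\<Prod>i<m. y i ^ (N div D ^ i mod D)))" for k y
  have P_poly: "polyfun m (P k)" for k unfolding P_def by (intro polyfun_intros) auto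
  have digit: "(k * D ^ m + N) div D ^ i mod D = N div D ^ i mod D" if "i < m" for k N i
  proof -
    have "m = (m - Suc i) + Suc 0 + i" using that by simp
    then have "D ^ m = D ^ (m - Suc i) * D * D ^ i" by (metis power_add power_one_right One_nat_def)
    then have "k * D ^ m = (k * D ^ (m - Suc i) * D) * D ^ i" by simp
    then have "(k * D ^ m + N) div D ^ i = k * D ^ (m - Suc i) * D + N div D ^ i"
      using D div_mult_self3[of "D ^ i" "k * D ^ (m - Suc i) * D" N] by (simp only:) simp
    then show ?thesis by simp
  qed
  have expand: "(\<Sum>k<D. J x ^ k * P k (\<lambda>i. f i x)) = 0" for x
  proof -
    let ?t = "\<lambda>N. \<alpha> N * (\<Prod>i\<le>m. F i x ^ (N div D ^ i mod D))"
    have t: "?t (k * D ^ m + N) = J x ^ k *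
        (\<alpha> (k * D ^ m + N) * (\<Prod>i<m. f i x ^ (N div D ^ i mod D)))"
      if "k < D" "N < D ^ m" for k N
    proof -
      have "(k * D ^ m + N) div D ^ m mod D = k" using that by simp
      moreover have "(\<Prod>i<m. F i x ^ ((k * D ^ m + N) div D ^ i mod D))
          = (\<Prod>i<m. f i x ^ (N div D ^ i mod D))"
        by (intro prod.cong) (auto simp: digit F_def)
      ultimately show ?thesis by (simp add: lessThan_Suc_atMost[symmetric] F_def[of m])
    qed
    have "0 = (\<Sum>N<D * D ^ m. ?t N)" using rel[of x] by simp
    also have "\<dots> = (\<Sum>k<D. \<Sum>N = k * D ^ m..<k * D ^ m + D ^ m. ?t N)"
      using sum.nat_group[of ?t "D ^ m" D] by simp
    also have "\<dots> = (\<Sum>k<D. \<Sum>N<D ^ m. ?t (k * D ^ m + N))"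
    proof (rule sum.cong[OF refl])
      fix k
      show "(\<Sum>N = k * D ^ m..<k * D ^ m + D ^ m. ?t N) = (\<Sum>N<D ^ m. ?t (k * D ^ m + N))"
        using sum.shift_bounds_nat_ivl[of ?t 0 "k * D ^ m" "D ^ m"]
        by (simp add: lessThan_atLeast0 add.commute)
    qed
    also have "\<dots> = (\<Sum>k<D. J x ^ k * P k (\<lambda>i. f i x))"
      unfolding P_def sum_distrib_left by (intro sum.cong refl) (simp add: t)
    finally show ?thesis by simp
  qed
  have ex: "\<exists>k<D. \<exists>z. P k z \<noteq> 0"
  proof -
    obtain N where N: "N < D * D ^ m" "\<alpha> N \<noteq> 0" using \<alpha> by auto
    have "N div D ^ m < D" using N(1) by (simp add: less_mult_imp_div_less)
    moreover have "\<alpha> (N div D ^ m * D ^ m + N mod D ^ m) \<noteq> 0"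
      using N(2) by (simp only: div_mult_mod_eq not_False_eq_True)
    moreover have "N mod D ^ m < D ^ m" using D by simp
    ultimately have "\<exists>z. P (N div D ^ m) z \<noteq> 0"
      unfolding P_def using digit_polynomial_nonzero[where \<alpha> = "\<lambda>M. \<alpha> (N div D ^ m * D ^ m + M)"] by blast
    then show ?thesis using \<open>N div D ^ m < D\<close> by blast
  qed
  \<comment> \<open>Lowest power of \<open>J\<close> with a nonzero coefficient polynomial;
    \<open>R\<close> below is the relation divided by it.\<close>
  define k0 where "k0 = (LEAST k. \<exists>z. P k z \<noteq> 0)"
  have k0: "\<exists>z. P k0 z \<noteq> 0" unfolding k0_def by (rule LeastI_ex) (use ex in blast)
  have k0_D: "k0 < D"
  proof -
    obtain k where "k < D" "\<exists>z. P k z \<noteq> 0" using ex by blast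
    then have "k0 \<le> k" unfolding k0_def by (intro Least_le)
    then show ?thesis using \<open>k < D\<close> by simp
  qed
  have below: "P k z = 0" if "k < k0" for k z using that not_less_Least unfolding k0_def by blast
  define R where "R x = (\<Sum>k\<in>{k0..<D}. J x ^ (k - k0) * P k (\<lambda>i. f i x))" for x
  have R_poly: "polyfun m R"
    unfolding R_def by (intro polyfun_intros polyfun_compose[OF P_poly] f J)
  have "J x ^ k0 * R x = 0" for x
  proof -
    have "(\<Sum>k<D. J x ^ k * P k (\<lambda>i. f i x)) = (\<Sum>k\<in>{k0..<D}. J x ^ k * P k (\<lambda>i. f i x))"
      by (rule sum.mono_neutral_right) (auto simp: below not_le)
    also have "\<dots> = J x ^ k0 * R x"
      unfolding R_def sum_distrib_left
      by (intro sum.cong refl) (simp add: mult.assoc[symmetric] flip: power_add)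
    finally show ?thesis using expand by simp
  qed
  \<comment> \<open>Pointwise division by \<open>J x ^ k0\<close> would fail exactly where
    \<open>R\<close> is needed, at the zeros of \<open>J\<close>. Cancelling it among polynomial
    functions works, since \<open>J x0 \<noteq> 0\<close>.\<close>
  then have R0: "R x = 0" for x
    using polyfun_no_zero_divisors[OF polyfun_power[OF J(1)] R_poly, of x0 k0 x] J(2) by auto
  have "P k0 (\<lambda>i. f i x) = 0" if "J x = 0" for x
  proof -
    have "R x = (\<Sum>k\<in>{k0..<D}. if k = k0 then P k0 (\<lambda>i. f i x) else 0)"
      unfolding R_def using that by (intro sum.cong refl) (auto simp: power_0_left)
    also have "\<dots> = P k0 (\<lambda>i. f i x)" using k0_D by (simp add: sum.delta)
    finally show ?thesis using R0 by simp
  qed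
  then show ?thesis using P_poly k0 by blast
qed

section \<open>Continuation of nondegenerate zeros\<close>

text \<open>Complex \<open>n\<close>-space inside one type, so that the dimension stays a variable.
  The topology is the product topology on sequences, and the vanishing tail makes points equal once
  their first \<open>n\<close> coordinates agree.\<close>

definition cspace :: "nat \<Rightarrow> (nat \<Rightarrow> complex) set" where
  "cspace n = {x. \<forall>i\<ge>n. x i = 0}"

definition cnorm :: "nat \<Rightarrow> (nat \<Rightarrow> complex) \<Rightarrow> real" where
  "cnorm n x = (\<Sum>i<n. cmod (x i))"

definition pball :: "nat \<Rightarrow> (nat \<Rightarrow> complex) \<Rightarrow> real \<Rightarrow> (nat \<Rightarrow> complex) set" where
  "pball n c r = {x \<in> cspace n. cnorm n (\<lambda>i. x i - c i) \<le> r}"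

lemma continuous_on_cnorm [continuous_intros]:
  fixes f :: "'a::topological_space \<Rightarrow> nat \<Rightarrow> complex"
  assumes "\<And>i. i < n \<Longrightarrow> continuous_on S (\<lambda>x. f x i)"
  shows "continuous_on S (\<lambda>x. cnorm n (f x))"
  unfolding cnorm_def using assms by (auto intro!: continuous_intros)

lemma continuous_on_cdet [continuous_intros]:
  fixes f :: "'a::topological_space \<Rightarrow> nat \<Rightarrow> nat \<Rightarrow> complex"
  assumes "\<And>i k. i < n \<Longrightarrow> k < n \<Longrightarrow> continuous_on S (\<lambda>x. f x i k)"
  shows "continuous_on S (\<lambda>x. cdet n (f x))"
  unfolding cdet_expand using assms
  by (intro continuous_intros) (auto dest: permutes_lessThan_less)

lemma cnorm_nonneg [simp]: "cnorm n x \<ge> 0" unfolding cnorm_def by (simp add: sum_nonneg)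

lemma cnorm_eq_0_iff: "cnorm n x = 0 \<longleftrightarrow> (\<forall>i<n. x i = 0)"
  unfolding cnorm_def by (subst sum_nonneg_eq_0_iff) auto

lemma cnorm_triangle: "cnorm n (\<lambda>i. x i + y i) \<le> cnorm n x + cnorm n y"
  unfolding cnorm_def by (simp add: sum.distrib[symmetric] sum_mono norm_triangle_ineq)

lemma cnorm_scale: "cnorm n (\<lambda>i. a * x i) = cmod a * cnorm n x"
  unfolding cnorm_def by (simp add: norm_mult sum_distrib_left)

lemma cmod_le_cnorm: "i < n \<Longrightarrow> cmod (x i) \<le> cnorm n x"
  unfolding cnorm_def by (rule member_le_sum) auto

lemma cspace_eqI:
  assumes "x \<in> cspace n" "y \<in> cspace n" "\<And>i. i < n \<Longrightarrow> x i = y i" shows "x = y"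
  using assms unfolding cspace_def by (intro ext) (metis (mono_tags) mem_Collect_eq not_le)

lemma closed_cspace: "closed (cspace n)"
proof -
  have "cspace n = (\<Inter>i\<in>{n..}. {x. x i = 0})" unfolding cspace_def by auto
  moreover have "closed {x::nat \<Rightarrow> complex. x i = 0}" for i
    by (intro closed_Collect_eq continuous_on_product_coordinates continuous_on_const)
  ultimately show ?thesis by auto
qed

text \<open>A closed subset of a product of discs and one-point sets, compact by Tychonoff's
  theorem.\<close>

lemma compact_pball: "compact (pball n c r)"
proof -
  let ?B = "PiE UNIV (\<lambda>i. if i < n then cball (c i) r else {0})"
  have "compactin (product_topology (\<lambda>i. euclidean) UNIV) ?B"
    unfolding compactin_PiE by auto
  then have B: "compact ?B" by (simp add: euclidean_product_topology)
  have "closed {x. cnorm n (\<lambda>i. x i - c i) \<le> r}"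
    by (intro closed_Collect_le continuous_intros continuous_on_product_coordinates)
  then have cl: "closed (pball n c r)"
    unfolding pball_def using closed_Int[OF closed_cspace[of n]] by (simp add: Collect_conj_eq)
  have "pball n c r \<subseteq> ?B"
  proof
    fix x assume x: "x \<in> pball n c r"
    have "cmod (x i - c i) \<le> r" if "i < n" for i
      using cmod_le_cnorm[OF that, of "\<lambda>i. x i - c i"] x unfolding pball_def by simp
    then show "x \<in> ?B"
      using x unfolding pball_def cspace_def by (auto simp: dist_norm norm_minus_commute)
  qed
  then show ?thesis using compact_Int_closed[OF B cl] by (simp add: Int_absorb1)
qed

text \<open>Compares norm balls with the product topology: the distance from \<open>c\<close> has a
  positive minimum on the compact part of the unit ball outside \<open>D\<close>.\<close>

lemma pball_subset_open:
  assumes "open D" "c \<in> D" "c \<in> cspace n"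
  shows "\<exists>r>0. pball n c r \<subseteq> D"
proof (cases "pball n c 1 - D = {}")
  case True
  then show ?thesis by (intro exI[of _ 1]) auto
next
  case False
  let ?g = "\<lambda>x. cnorm n (\<lambda>i. x i - c i)"
  have "compact (pball n c 1 - D)" using compact_diff[OF compact_pball assms(1)] .
  moreover have "continuous_on (pball n c 1 - D) ?g"
    by (intro continuous_intros continuous_on_subset[OF continuous_on_product_coordinates]) auto
  ultimately obtain x where x: "x \<in> pball n c 1 - D" "\<And>y. y \<in> pball n c 1 - D \<Longrightarrow> ?g x \<le> ?g y"
    using continuous_attains_inf[OF _ False] by blast
  have "?g x \<noteq> 0"
  proof
    assume "?g x = 0"
    then have "x = c" using x(1) assms(3)
      by (intro cspace_eqI[of _ n]) (auto simp: cnorm_eq_0_iff pball_def)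
    then show False using x(1) assms(2) by blast
  qed
  then have pos: "?g x > 0" using cnorm_nonneg less_eq_real_def by metis
  have "pball n c (min 1 (?g x / 2)) \<subseteq> D"
  proof
    fix y assume y: "y \<in> pball n c (min 1 (?g x / 2))"
    show "y \<in> D"
    proof (rule ccontr)
      assume "y \<notin> D"
      then have "?g x \<le> ?g y" using x(2) y unfolding pball_def by auto
      then show False using y pos unfolding pball_def by auto
    qed
  qed
  then show ?thesis using pos by (intro exI[of _ "min 1 (?g x / 2)"]) auto
qed

text \<open>Tube lemma: the part of \<open>F\<close> over a closed ball around \<open>s0\<close> and
  inside \<open>K\<close> is compact, hence so is its projection, which misses
  \<open>s0\<close>.\<close>

lemma compact_avoid_closed:
  fixes s0 :: "'a::euclidean_space" and K :: "'b::topological_space set"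
  assumes "compact K" "closed F" "\<And>x. x \<in> K \<Longrightarrow> (s0, x) \<notin> F"
  shows "\<exists>d>0. \<forall>s\<in>ball s0 d. \<forall>x\<in>K. (s, x) \<notin> F"
proof -
  have "compact (cball s0 1 \<times> K)" using assms(1) by (intro compact_Times) auto
  then have "compact ((cball s0 1 \<times> K) \<inter> F)" using assms(2) by (rule compact_Int_closed)
  then have "compact (fst ` ((cball s0 1 \<times> K) \<inter> F))"
    by (intro compact_continuous_image continuous_intros)
  then have "open (- (fst ` ((cball s0 1 \<times> K) \<inter> F)))"
    by (intro open_Compl compact_imp_closed)
  moreover have "s0 \<in> - (fst ` ((cball s0 1 \<times> K) \<inter> F))" using assms(3) by auto
  ultimately obtain d where d: "d > 0" "ball s0 d \<subseteq> - (fst ` ((cball s0 1 \<times> K) \<inter> F))"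
    using open_contains_ball by blast
  show ?thesis
  proof (intro exI[of _ "min d 1"] conjI ballI notI)
    fix s x assume "s \<in> ball s0 (min d 1)" "x \<in> K" "(s, x) \<in> F"
    then have "s \<in> ball s0 d" "s \<in> fst ` ((cball s0 1 \<times> K) \<inter> F)" by force+
    then show False using d(2) by blast
  qed (use d in auto)
qed

lemma ball_avoid_finite:
  fixes a :: complex
  assumes "finite B" "r > 0"
  obtains s where "s \<in> ball a r" "s \<notin> B"
proof -
  have "infinite (ball a r)" using assms(2) by (intro uncountable_infinite uncountable_ball)
  then have "\<not> ball a r \<subseteq> B" using assms(1) finite_subset by blast
  then show thesis using that by blast
qed

lemma finite_separated:
  fixes S :: "'m::metric_space set"
  assumes "finite S"
  shows "\<exists>e>0. \<forall>x\<in>S. \<forall>y\<in>S. x \<noteq> y \<longrightarrow> ball x e \<inter> ball y e = {}"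
  using assms
proof (induction S)
  case (insert a S)
  then obtain e where e: "e > 0" "\<forall>x\<in>S. \<forall>y\<in>S. x \<noteq> y \<longrightarrow> ball x e \<inter> ball y e = {}" by blast
  obtain d where d: "d > 0" "\<forall>x\<in>S. x \<noteq> a \<longrightarrow> d \<le> dist a x"
    using finite_set_avoid[OF insert.hyps(1)] by blast
  let ?e = "min e (d / 2)"
  have a: "ball a ?e \<inter> ball x ?e = {}" if "x \<in> S" "x \<noteq> a" for x
  proof -
    have "d \<le> dist a x" using d that by blast
    then show ?thesis by (intro disjoint_ballI) simp
  qed
  have S: "ball x ?e \<inter> ball y ?e = {}" if "x \<in> S" "y \<in> S" "x \<noteq> y" for x y
  proof -
    have "ball x e \<inter> ball y e = {}" using e(2) that by blast
    then show ?thesis by auto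
  qed
  show ?case
    using e(1) d(1) a S by (intro exI[of _ ?e]) (auto simp: Int_commute)
qed (auto intro: exI[of _ 1])

section \<open>Zeros of continuous families of maps\<close>

definition zero_set :: "nat \<Rightarrow> ((nat \<Rightarrow> complex) \<Rightarrow> nat \<Rightarrow> complex) \<Rightarrow> (nat \<Rightarrow> complex) set" where
  "zero_set n G = {x \<in> cspace n. \<forall>i<n. G x i = 0}"

text \<open>In all uses \<open>M x y\<close> is a difference quotient matrix of a map, so
  \<open>M x x\<close> is the Jacobian matrix at \<open>x\<close>.\<close>

definition regular_at ::
  "nat \<Rightarrow> ((nat \<Rightarrow> complex) \<Rightarrow> (nat \<Rightarrow> complex) \<Rightarrow> nat \<Rightarrow> nat \<Rightarrow> complex) \<Rightarrow> (nat \<Rightarrow> complex) \<Rightarrow> bool" where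
  "regular_at n M x \<longleftrightarrow> cdet n (M x x) \<noteq> 0"

text \<open>For \<open>s\<close> near \<open>s0\<close> zeros neither cross the boundary of
  \<open>D\<close> nor escape to infinity. For \<open>D = UNIV\<close> it remains to confine the
  zeros to a common compact set.\<close>

definition trapped ::
  "nat \<Rightarrow> (complex \<Rightarrow> (nat \<Rightarrow> complex) \<Rightarrow> nat \<Rightarrow> complex) \<Rightarrow> (nat \<Rightarrow> complex) set \<Rightarrow> complex \<Rightarrow> bool" where
  "trapped n G D s0 \<longleftrightarrow> (\<exists>d>0. \<exists>K. compact K \<and>
    (\<forall>s\<in>ball s0 d. zero_set n (G s) \<inter> D \<subseteq> K \<inter> D \<and> zero_set n (G s) \<inter> K \<subseteq> D))"

text \<open>Hadamard's lemma as an axiom. The two-point matrix does the work of the derivative: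
  invertible at \<open>(x, x)\<close>, it stays invertible for pairs near the diagonal, and there no
  two distinct zeros can coexist.\<close>

locale hadamard_family =
  fixes n :: nat and G :: "complex \<Rightarrow> (nat \<Rightarrow> complex) \<Rightarrow> nat \<Rightarrow> complex"
    and M :: "complex \<Rightarrow> (nat \<Rightarrow> complex) \<Rightarrow> (nat \<Rightarrow> complex) \<Rightarrow> nat \<Rightarrow> nat \<Rightarrow> complex"
  assumes hadamard: "x \<in> cspace n \<Longrightarrow> y \<in> cspace n \<Longrightarrow> i < n \<Longrightarrow>
      G s x i - G s y i = (\<Sum>k<n. M s x y i k * (x k - y k))"
    and cont_G: "i < n \<Longrightarrow> continuous_on UNIV (\<lambda>(s, x). G s x i)"
    and cont_M: "i < n \<Longrightarrow> k < n \<Longrightarrow> continuous_on UNIV (\<lambda>(s, x, y). M s x y i k)"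
begin

abbreviation zeros :: "complex \<Rightarrow> (nat \<Rightarrow> complex) set" where
  "zeros s \<equiv> zero_set n (G s)"

abbreviation nondeg :: "complex \<Rightarrow> (nat \<Rightarrow> complex) \<Rightarrow> bool" where
  "nondeg s \<equiv> regular_at n (M s)"

lemma zeros_iff: "x \<in> zeros s \<longleftrightarrow> x \<in> cspace n \<and> cnorm n (G s x) = 0"
  unfolding zero_set_def cnorm_eq_0_iff by simp

lemma cont_G_comp [continuous_intros]:
  assumes "i < n" "continuous_on S f" "continuous_on S g"
  shows "continuous_on S (\<lambda>a. G (f a) (g a) i)"
  using continuous_on_compose2[OF cont_G[OF assms(1)], of S "\<lambda>a. (f a, g a)"]
    continuous_on_Pair[OF assms(2,3)] by simp

lemma cont_M_comp [continuous_intros]: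
  assumes "i < n" "k < n" "continuous_on S f" "continuous_on S g" "continuous_on S h"
  shows "continuous_on S (\<lambda>a. M (f a) (g a) (h a) i k)"
  using continuous_on_compose2[OF cont_M[OF assms(1,2)], of S "\<lambda>a. (f a, g a, h a)"]
    continuous_on_Pair[OF assms(3) continuous_on_Pair[OF assms(4,5)]] by simp

lemma closed_zeros: "closed {(s, x). x \<in> zeros s}"
proof -
  have "{(s, x). x \<in> zeros s} = (UNIV \<times> cspace n) \<inter> {p. cnorm n (G (fst p) (snd p)) = 0}"
    by (auto simp: zeros_iff)
  moreover have "closed {p. cnorm n (G (fst p) (snd p)) = 0}"
    by (intro closed_Collect_eq continuous_intros)
  ultimately show ?thesis by (simp add: closed_Int closed_Times closed_cspace)
qed

lemma nondeg_nbhd: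
  assumes "nondeg s0 c"
  shows "\<exists>d>0. \<exists>U. open U \<and> c \<in> U \<and> (\<forall>s\<in>ball s0 d. \<forall>x\<in>U. \<forall>y\<in>U. cdet n (M s x y) \<noteq> 0)"
proof -
  let ?O = "{p. cdet n (M (fst p) (fst (snd p)) (snd (snd p))) \<noteq> 0}"
  have "open ?O" by (intro open_Collect_neq continuous_intros)
  moreover have "(s0, c, c) \<in> ?O" using assms by (simp add: regular_at_def)
  ultimately obtain A V where AV: "open A" "open V" "(s0, c, c) \<in> A \<times> V" "A \<times> V \<subseteq> ?O"
    by (rule open_prod_elim)
  then have A: "open A" "open V" "s0 \<in> A" "(c, c) \<in> V" "A \<times> V \<subseteq> ?O" by auto
  from A(2,4) obtain U1 U2 where "open U1" "open U2" "(c, c) \<in> U1 \<times> U2" "U1 \<times> U2 \<subseteq> V"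
    by (rule open_prod_elim)
  then have U: "open U1" "open U2" "c \<in> U1" "c \<in> U2" "U1 \<times> U2 \<subseteq> V" by auto
  obtain d where d: "d > 0" "ball s0 d \<subseteq> A" using A(1,3) open_contains_ball by blast
  have "cdet n (M s x y) \<noteq> 0" if "s \<in> ball s0 d" "x \<in> U1 \<inter> U2" "y \<in> U1 \<inter> U2" for s x y
  proof -
    have "(s, x, y) \<in> A \<times> V" using that d U by auto
    then show ?thesis using A(5) by auto
  qed
  then show ?thesis using d(1) U by (intro exI[of _ d] conjI exI[of _ "U1 \<inter> U2"]) auto
qed

text \<open>A short Newton step: if \<open>u\<close> solves \<open>M s x x u = - G s x\<close>,
  moving by \<open>e u\<close> turns \<open>G\<close> into \<open>(1 - e) G\<close> up to an error
  \<open>e\<close> times a quantity that tends to 0 with \<open>e\<close>.\<close>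

lemma decrease:
  assumes x: "x \<in> cspace n" "nondeg s x" "cnorm n (G s x) \<noteq> 0" "open W" "x \<in> W"
  shows "\<exists>y\<in>cspace n \<inter> W. cnorm n (G s y) < cnorm n (G s x)"
proof -
  obtain u0 where u0: "\<And>i. i < n \<Longrightarrow> (\<Sum>k<n. M s x x i k * u0 k) = - G s x i"
    using cdet_solve[of n "M s x x" "\<lambda>i. - G s x i"] x(2) unfolding regular_at_def by blast
  define u where "u k = (if k < n then u0 k else 0)" for k
  have u: "(\<Sum>k<n. M s x x i k * u k) = - G s x i" if "i < n" for i
    using u0[OF that] unfolding u_def by (simp cong: sum.cong_simp)
  define y where "y e k = x k + complex_of_real e * u k" for e k
  have y_space: "y e \<in> cspace n" for e
    using x(1) unfolding y_def u_def cspace_def by auto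
  have y_cont: "continuous_on UNIV y"
    unfolding y_def by (intro continuous_on_coordinatewise_then_product continuous_intros)
  have y0: "y 0 = x" unfolding y_def by simp
  \<comment> \<open>Norm of the error from having the matrix at \<open>(y e, x)\<close> instead of
    \<open>(x, x)\<close>.\<close>
  define h where "h e = cnorm n (\<lambda>i. \<Sum>k<n. (M s (y e) x i k - M s x x i k) * u k)" for e
  have h_cont: "continuous_on UNIV h"
    unfolding h_def by (intro continuous_intros y_cont) auto
  have h0: "h 0 = 0" unfolding h_def by (simp add: y0 cnorm_eq_0_iff)
  have pos: "cnorm n (G s x) > 0" using x(3) cnorm_nonneg less_eq_real_def by metis
  have "open (y -` W)" using y_cont x(4) by (rule open_vimage[rotated])
  then have "open ({e. h e < cnorm n (G s x)} \<inter> y -` W)"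
    by (intro open_Int open_Collect_less h_cont continuous_on_const)
  moreover have "0 \<in> {e. h e < cnorm n (G s x)} \<inter> y -` W"
    using pos h0 y0 x(5) by simp
  ultimately obtain e0 where e0: "e0 > 0" "ball 0 e0 \<subseteq> {e. h e < cnorm n (G s x)} \<inter> y -` W"
    using open_contains_ball by blast
  define e where "e = min (e0 / 2) (1 / 2)"
  have e: "0 < e" "e < 1" "h e < cnorm n (G s x)" "y e \<in> W"
    using e0 unfolding e_def by (auto simp: subset_eq dist_norm)
  have G_y: "G s (y e) i = complex_of_real (1 - e) * G s x i
      + complex_of_real e * (\<Sum>k<n. (M s (y e) x i k - M s x x i k) * u k)" if "i < n" for i
  proof -
    have "G s (y e) i - G s x i = (\<Sum>k<n. M s (y e) x i k * (y e k - x k))"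
      using hadamard[OF y_space x(1) that] .
    also have "\<dots> = complex_of_real e * (\<Sum>k<n. M s (y e) x i k * u k)"
      unfolding y_def sum_distrib_left by (intro sum.cong) (auto simp: algebra_simps)
    also have "(\<Sum>k<n. M s (y e) x i k * u k)
        = (\<Sum>k<n. (M s (y e) x i k - M s x x i k) * u k) - G s x i"
      using u[OF that] by (simp add: algebra_simps sum_subtractf)
    finally show ?thesis by (simp add: algebra_simps)
  qed
  have "cnorm n (G s (y e)) = cnorm n (\<lambda>i. complex_of_real (1 - e) * G s x i
      + complex_of_real e * (\<Sum>k<n. (M s (y e) x i k - M s x x i k) * u k))"
    unfolding cnorm_def using G_y by (intro sum.cong) auto
  also have "\<dots> \<le> cnorm n (\<lambda>i. complex_of_real (1 - e) * G s x i)
      + cnorm n (\<lambda>i. complex_of_real e * (\<Sum>k<n. (M s (y e) x i k - M s x x i k) * u k))"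
    by (rule cnorm_triangle)
  also have "\<dots> = (1 - e) * cnorm n (G s x) + e * h e"
    using e unfolding cnorm_scale h_def norm_of_real by simp
  also have "\<dots> < (1 - e) * cnorm n (G s x) + e * cnorm n (G s x)"
    using e by simp
  finally have "cnorm n (G s (y e)) < cnorm n (G s x)" by (simp add: algebra_simps)
  then show ?thesis using y_space e(4) by blast
qed

text \<open>Implicit function theorem by minimization. For \<open>s\<close> near \<open>s0\<close>
  the norm of \<open>G s\<close> on a small ball is not minimal on the sphere, where it exceeds the
  value at \<open>c\<close>; a nonzero interior minimum would be lowered by \<open>decrease\<close>.
  Two zeros \<open>x\<close>, \<open>y\<close> would put \<open>x - y\<close> into the kernel of
  \<open>M s x y\<close>.\<close>

lemma nondeg_zero_persists:
  assumes c: "c \<in> zeros s0" "nondeg s0 c" and D: "open D" "c \<in> D"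
  shows "\<exists>U d. open U \<and> c \<in> U \<and> U \<inter> cspace n \<subseteq> D \<and> d > 0 \<and>
    (\<forall>s\<in>ball s0 d. \<exists>!x. x \<in> zeros s \<inter> U)"
proof -
  obtain d1 U1 where U1: "d1 > 0" "open U1" "c \<in> U1"
    "\<And>s x y. s \<in> ball s0 d1 \<Longrightarrow> x \<in> U1 \<Longrightarrow> y \<in> U1 \<Longrightarrow> cdet n (M s x y) \<noteq> 0"
    using nondeg_nbhd[OF c(2)] by blast
  have c_space: "c \<in> cspace n" using c(1) by (simp add: zero_set_def)
  have unique: "x = y" if "s \<in> ball s0 d1" "x \<in> zeros s" "y \<in> zeros s" "x \<in> U1" "y \<in> U1" for s x y
  proof (rule ccontr)
    assume "x \<noteq> y"
    moreover have "x \<in> cspace n" "y \<in> cspace n" using that unfolding zero_set_def by auto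
    ultimately obtain k where "k < n" "x k - y k \<noteq> 0"
      using cspace_eqI[of x n y] by (metis right_minus_eq)
    moreover have "(\<Sum>k<n. M s x y i k * (x k - y k)) = 0" if "i < n" for i
      using hadamard[of x y i s] that \<open>x \<in> zeros s\<close> \<open>y \<in> zeros s\<close> unfolding zero_set_def by auto
    ultimately have "cdet n (M s x y) = 0" unfolding cdet_0_iff by (intro exI[of _ "\<lambda>k. x k - y k"]) auto
    then show False using U1(4) that by blast
  qed
  obtain r where r: "r > 0" "pball n c r \<subseteq> U1 \<inter> D"
    using pball_subset_open[of "U1 \<inter> D" c n] U1 D c_space by auto
  \<comment> \<open>\<open>U\<close> does not restrict the coordinates from \<open>n\<close> on,
    which makes it open in the product topology; inclusions therefore hold only within
    \<open>cspace n\<close>.\<close>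
  define U where "U = {x. cnorm n (\<lambda>i. x i - c i) < r}"
  have U_open: "open U" unfolding U_def
    by (intro open_Collect_less continuous_intros continuous_on_product_coordinates)
  have cU: "c \<in> U" unfolding U_def using r(1) cnorm_eq_0_iff[of n "\<lambda>i. 0"] by simp
  have U_sub: "U \<inter> cspace n \<subseteq> pball n c r" unfolding U_def pball_def by auto
  \<comment> \<open>Points where the norm is not larger than at the centre; they have to be avoided
    on the sphere \<open>pball n c r - U\<close>.\<close>
  let ?F = "{p. cnorm n (G (fst p) (snd p)) \<le> cnorm n (G (fst p) c)}"
  have "closed ?F" by (intro closed_Collect_le continuous_intros)
  moreover have "compact (pball n c r - U)" using compact_diff[OF compact_pball U_open] .
  moreover have "(s0, x) \<notin> ?F" if x: "x \<in> pball n c r - U" for x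
  proof
    assume "(s0, x) \<in> ?F"
    then have "cnorm n (G s0 x) = 0" using c(1) zeros_iff cnorm_nonneg
      by (metis (mono_tags) antisym fst_conv snd_conv mem_Collect_eq)
    then have "x \<in> zeros s0" using x by (simp add: zeros_iff pball_def)
    then have "x = c" using unique[of s0 x c] c(1) U1 x r(2) by auto
    then show False using x cU by blast
  qed
  ultimately obtain d2 where d2: "d2 > 0" "\<And>s x. s \<in> ball s0 d2 \<Longrightarrow> x \<in> pball n c r - U \<Longrightarrow> (s, x) \<notin> ?F"
    using compact_avoid_closed[of "pball n c r - U" ?F s0] by blast
  have "\<exists>!x. x \<in> zeros s \<inter> U" if s: "s \<in> ball s0 (min d1 d2)" for s
  proof -
    have "continuous_on (pball n c r) (\<lambda>x. cnorm n (G s x))" by (intro continuous_intros)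
    moreover have c_in: "c \<in> pball n c r" using cU U_sub c_space by blast
    ultimately obtain x where x: "x \<in> pball n c r"
      "\<And>y. y \<in> pball n c r \<Longrightarrow> cnorm n (G s x) \<le> cnorm n (G s y)"
      using continuous_attains_inf[OF compact_pball] by (metis empty_iff)
    have "x \<in> U"
    proof (rule ccontr)
      assume "x \<notin> U"
      then have "(s, x) \<notin> ?F" using d2(2) s x(1) by auto
      then show False using x(2)[OF c_in] by simp
    qed
    have x_space: "x \<in> cspace n" using x(1) by (simp add: pball_def)
    have "nondeg s x" unfolding regular_at_def using U1(4)[of s x x] s x(1) r(2) by auto
    have "cnorm n (G s x) = 0"
    proof (rule ccontr)
      assume "cnorm n (G s x) \<noteq> 0"
      then obtain y where "y \<in> cspace n \<inter> U" "cnorm n (G s y) < cnorm n (G s x)"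
        using decrease[OF x_space \<open>nondeg s x\<close> _ U_open \<open>x \<in> U\<close>] by blast
      then show False using x(2)[of y] U_sub by fastforce
    qed
    then have "x \<in> zeros s \<inter> U" using \<open>x \<in> U\<close> x_space by (simp add: zeros_iff)
    moreover have "y = x" if "y \<in> zeros s \<inter> U" for y
    proof (rule unique[of s])
      show "y \<in> U1" "x \<in> U1" using that U_sub r(2) x(1) unfolding zero_set_def by auto
    qed (use that s \<open>x \<in> zeros s \<inter> U\<close> in auto)
    ultimately show ?thesis by blast
  qed
  then show ?thesis
    using U_open cU U_sub r(2) U1(1) d2(1)
    by (intro exI[of _ U] exI[of _ "min d1 d2"]) auto
qed

text \<open>Neighbourhoods inside disjoint balls keep the continued zeros distinct.\<close>

lemma nondeg_zeros_persist:
  assumes S: "finite S" "S \<subseteq> zeros s0 \<inter> D" "\<And>c. c \<in> S \<Longrightarrow> nondeg s0 c" and D: "open D"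
  shows "\<exists>U d. d > 0 \<and> (\<forall>c\<in>S. open (U c) \<and> c \<in> U c \<and> U c \<inter> cspace n \<subseteq> D) \<and>
    (\<forall>s\<in>ball s0 d. \<exists>f. inj_on f S \<and> (\<forall>c\<in>S. zeros s \<inter> U c = {f c}))"
proof -
  obtain e where e: "e > 0" "\<forall>x\<in>S. \<forall>y\<in>S. x \<noteq> y \<longrightarrow> ball x e \<inter> ball y e = {}"
    using finite_separated[OF S(1)] by blast
  have "\<forall>c\<in>S. \<exists>U d. open U \<and> c \<in> U \<and> U \<inter> cspace n \<subseteq> D \<inter> ball c e \<and> d > 0 \<and>
    (\<forall>s\<in>ball s0 d. \<exists>!x. x \<in> zeros s \<inter> U)"
  proof
    fix c assume c: "c \<in> S"
    then have "c \<in> zeros s0" "c \<in> D \<inter> ball c e" using S(2) e(1) by auto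
    then show "\<exists>U d. open U \<and> c \<in> U \<and> U \<inter> cspace n \<subseteq> D \<inter> ball c e \<and> d > 0 \<and>
        (\<forall>s\<in>ball s0 d. \<exists>!x. x \<in> zeros s \<inter> U)"
      by (intro nondeg_zero_persists S(3) c open_Int D open_ball)
  qed
  from bchoice[OF this] obtain U where "\<forall>c\<in>S. \<exists>d. open (U c) \<and> c \<in> U c \<and>
    U c \<inter> cspace n \<subseteq> D \<inter> ball c e \<and> d > 0 \<and> (\<forall>s\<in>ball s0 d. \<exists>!x. x \<in> zeros s \<inter> U c)"
    by (elim exE)
  from bchoice[OF this] obtain d where "\<forall>c\<in>S. open (U c) \<and> c \<in> U c \<and>
    U c \<inter> cspace n \<subseteq> D \<inter> ball c e \<and> d c > 0 \<and> (\<forall>s\<in>ball s0 (d c). \<exists>!x. x \<in> zeros s \<inter> U c)"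
    by (elim exE)
  note U = bspec[OF this]
  define d0 where "d0 = Min (insert 1 (d ` S))"
  have d0: "d0 > 0" "\<And>c. c \<in> S \<Longrightarrow> d0 \<le> d c"
    unfolding d0_def using S(1) U by auto
  have "\<exists>f. inj_on f S \<and> (\<forall>c\<in>S. zeros s \<inter> U c = {f c})" if s: "s \<in> ball s0 d0" for s
  proof -
    have ex1: "\<exists>!x. x \<in> zeros s \<inter> U c" if "c \<in> S" for c
      using U[OF that] d0(2)[OF that] s by auto
    define f where "f c = (THE x. x \<in> zeros s \<inter> U c)" for c
    have f: "zeros s \<inter> U c = {f c}" if "c \<in> S" for c
      using theI'[OF ex1[OF that]] ex1[OF that] unfolding f_def by blast
    have f_ball: "f c \<in> ball c e" if "c \<in> S" for c
      using f[OF that] U[OF that] unfolding zero_set_def by blast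
    have "inj_on f S"
    proof (rule inj_onI, rule ccontr)
      fix x y assume "x \<in> S" "y \<in> S" "f x = f y" "x \<noteq> y"
      then show False using f_ball[of x] f_ball[of y] e(2) by (metis IntI empty_iff)
    qed
    then show ?thesis using f by blast
  qed
  then show ?thesis using U d0(1) by (intro exI[of _ U] exI[of _ d0]) blast
qed

text \<open>Further zeros may come in from elsewhere, even from infinity, so the count is only
  bounded below.\<close>

lemma nondeg_zeros_lower_bound:
  assumes "finite S" "S \<subseteq> zeros s0 \<inter> D" "\<And>c. c \<in> S \<Longrightarrow> nondeg s0 c" "open D"
  shows "\<exists>d>0. \<forall>s\<in>ball s0 d. \<exists>S'. finite S' \<and> S' \<subseteq> zeros s \<inter> D \<and> card S' = card S"
proof -
  obtain U d where U: "d > 0" "\<forall>c\<in>S. open (U c) \<and> c \<in> U c \<and> U c \<inter> cspace n \<subseteq> D"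
    "\<forall>s\<in>ball s0 d. \<exists>f. inj_on f S \<and> (\<forall>c\<in>S. zeros s \<inter> U c = {f c})"
    using nondeg_zeros_persist[OF assms] by blast
  have "\<exists>S'. finite S' \<and> S' \<subseteq> zeros s \<inter> D \<and> card S' = card S" if s: "s \<in> ball s0 d" for s
  proof -
    obtain f where f: "inj_on f S" "\<forall>c\<in>S. zeros s \<inter> U c = {f c}"
      using bspec[OF U(3) s] by (elim exE conjE)
    have "f c \<in> zeros s \<inter> D" if "c \<in> S" for c
      using f(2) that U(2) unfolding zero_set_def by blast
    then show ?thesis using f(1) assms(1) by (intro exI[of _ "f ` S"]) (auto simp: card_image)
  qed
  then show ?thesis using U(1) by blast
qed

text \<open>The zeros in \<open>D\<close> form a compact set and are isolated, hence finite in
  number. Each continues uniquely, and a new one would have to appear in the compact remainder of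
  \<open>K\<close>, which is free of zeros at \<open>s0\<close> and so for nearby
  parameters.\<close>

lemma card_zeros_locally_constant:
  assumes D: "open D" and nd: "\<And>c. c \<in> zeros s0 \<inter> D \<Longrightarrow> nondeg s0 c" and tr: "trapped n G D s0"
  shows "finite (zeros s0 \<inter> D) \<and>
    (\<exists>d>0. \<forall>s\<in>ball s0 d. finite (zeros s \<inter> D) \<and> card (zeros s \<inter> D) = card (zeros s0 \<inter> D))"
proof -
  obtain d0 K where K: "d0 > 0" "compact K"
    "\<And>s. s \<in> ball s0 d0 \<Longrightarrow> zeros s \<inter> D \<subseteq> K \<inter> D \<and> zeros s \<inter> K \<subseteq> D"
    using tr unfolding trapped_def by blast
  let ?Z = "zeros s0 \<inter> D"
  have "zeros s0 = Pair s0 -` {(s, x). x \<in> zeros s}" by auto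
  moreover have "closed (Pair s0 -` {(s, x). x \<in> zeros s})"
    using closed_zeros by (intro closed_vimage) (auto intro!: continuous_intros)
  ultimately have "closed (zeros s0)" by simp
  moreover have ZK: "?Z = K \<inter> zeros s0" using K(3)[of s0] K(1) by auto
  ultimately have Zc: "compact ?Z" using compact_Int_closed[OF K(2)] by simp
  have fin: "finite ?Z"
  proof (rule ccontr)
    assume "infinite ?Z"
    then obtain c where c: "c \<in> ?Z" "c islimpt ?Z"
      using Heine_Borel_imp_Bolzano_Weierstrass[OF Zc _ subset_refl] by blast
    obtain U d where U: "open U" "c \<in> U" "d > 0" "\<forall>s\<in>ball s0 d. \<exists>!x. x \<in> zeros s \<inter> U"
      using nondeg_zero_persists[of c s0 D] c(1) nd D by blast
    have "\<exists>!x. x \<in> zeros s0 \<inter> U" using U(3,4) by auto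
    moreover obtain y where "y \<in> ?Z" "y \<in> U" "y \<noteq> c" using islimptE[OF c(2) U(2,1)] by blast
    ultimately show False using c(1) U(2) by blast
  qed
  obtain U d1 where U: "d1 > 0" "\<forall>c\<in>?Z. open (U c) \<and> c \<in> U c \<and> U c \<inter> cspace n \<subseteq> D"
    "\<forall>s\<in>ball s0 d1. \<exists>f. inj_on f ?Z \<and> (\<forall>c\<in>?Z. zeros s \<inter> U c = {f c})"
    using nondeg_zeros_persist[OF fin subset_refl nd D] by blast
  have "compact (K - (\<Union>c\<in>?Z. U c))" using U(2) by (intro compact_diff K(2)) auto
  moreover have "(s0, x) \<notin> {(s, x). x \<in> zeros s}" if "x \<in> K - (\<Union>c\<in>?Z. U c)" for x
    using that U(2) ZK by auto
  ultimately have "\<exists>d>0. \<forall>s\<in>ball s0 d. \<forall>x\<in>K - (\<Union>c\<in>?Z. U c). (s, x) \<notin> {(s, x). x \<in> zeros s}"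
    by (rule compact_avoid_closed[OF _ closed_zeros])
  then obtain d2 where d2_pos: "d2 > 0"
    and "\<forall>s\<in>ball s0 d2. \<forall>x\<in>K - (\<Union>c\<in>?Z. U c). (s, x) \<notin> {(s, x). x \<in> zeros s}"
    by (elim exE conjE)
  note d2 = d2_pos bspec[OF bspec[OF this(2)]]
  have "finite (zeros s \<inter> D) \<and> card (zeros s \<inter> D) = card ?Z"
    if s: "s \<in> ball s0 (min d0 (min d1 d2))" for s
  proof -
    obtain f where f: "inj_on f ?Z" "\<forall>c\<in>?Z. zeros s \<inter> U c = {f c}"
      using bspec[OF U(3), of s] s by auto
    have "zeros s \<inter> D = f ` ?Z"
    proof
      show "zeros s \<inter> D \<subseteq> f ` ?Z"
      proof
        fix x assume x: "x \<in> zeros s \<inter> D"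
        then have "x \<in> K" using K(3)[of s] s by auto
        then obtain c where "c \<in> ?Z" "x \<in> U c" using d2(2)[of s x] s x by force
        then have "x = f c" using f(2) x by blast
        then show "x \<in> f ` ?Z" using \<open>c \<in> ?Z\<close> by blast
      qed
      show "f ` ?Z \<subseteq> zeros s \<inter> D"
      proof
        fix x assume "x \<in> f ` ?Z"
        then obtain c where "c \<in> ?Z" "x = f c" by blast
        then show "x \<in> zeros s \<inter> D" using f(2) U(2) unfolding zero_set_def by blast
      qed
    qed
    then show ?thesis using fin f(1) by (simp add: card_image)
  qed
  note * = this
  show ?thesis
  proof (intro conjI fin exI[of _ "min d0 (min d1 d2)"] ballI)
    show "0 < min d0 (min d1 d2)" using K(1) U(1) d2_pos by simp
  qed (use * in blast)+
qed

lemma card_zeros_constant: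
  assumes "connected T" "s \<in> T" "s' \<in> T" and D: "open D"
    and "\<And>s c. s \<in> T \<Longrightarrow> c \<in> zeros s \<inter> D \<Longrightarrow> nondeg s c" and "\<And>s. s \<in> T \<Longrightarrow> trapped n G D s"
  shows "card (zeros s \<inter> D) = card (zeros s' \<inter> D)"
proof (rule connected_local_const[OF assms(1-3), of "\<lambda>s. card (zeros s \<inter> D)"], intro ballI)
  fix a assume a: "a \<in> T"
  obtain d where d: "d > 0" "\<forall>s\<in>ball a d. card (zeros s \<inter> D) = card (zeros a \<inter> D)"
    using card_zeros_locally_constant[OF D assms(5)[OF a] assms(6)[OF a]] by blast
  show "\<forall>\<^sub>F b in at a within T. card (zeros a \<inter> D) = card (zeros b \<inter> D)"
    unfolding eventually_at
  proof (intro exI[of _ d] conjI ballI impI d(1))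
    fix b assume "b \<noteq> a \<and> dist b a < d"
    then have "b \<in> ball a d" by (simp add: dist_commute)
    from bspec[OF d(2) this] show "card (zeros a \<inter> D) = card (zeros b \<inter> D)" by (rule sym)
  qed
qed

end

section \<open>Pencils of polynomial maps\<close>

type_synonym cmap = "(nat \<Rightarrow> complex) \<Rightarrow> nat \<Rightarrow> complex"
type_synonym hmap = "(nat \<Rightarrow> complex) \<Rightarrow> (nat \<Rightarrow> complex) \<Rightarrow> nat \<Rightarrow> nat \<Rightarrow> complex"

text \<open>The diagonal of \<open>M\<close> has to be polynomial because its determinant enters the
  elimination; off the diagonal continuity suffices.\<close>

definition polymap :: "nat \<Rightarrow> cmap \<Rightarrow> hmap \<Rightarrow> bool" where
  "polymap n G M \<longleftrightarrow>
    (\<forall>x\<in>cspace n. \<forall>y\<in>cspace n. \<forall>i<n. G x i - G y i = (\<Sum>k<n. M x y i k * (x k - y k))) \<and>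
    (\<forall>i<n. polyfun n (\<lambda>x. G x i)) \<and>
    (\<forall>i<n. \<forall>k<n. polyfun n (\<lambda>x. M x x i k) \<and> continuous_on UNIV (\<lambda>(x, y). M x y i k))"

definition pencil :: "cmap \<Rightarrow> cmap \<Rightarrow> complex \<Rightarrow> cmap" where
  "pencil A B s x i = (1 - s) * A x i + s * B x i"

definition pencilM :: "hmap \<Rightarrow> hmap \<Rightarrow> complex \<Rightarrow> hmap" where
  "pencilM A B s x y i k = (1 - s) * A x y i k + s * B x y i k"

lemma pencil_0_1 [simp]: "pencil A B 0 = A" "pencil A B 1 = B"
  "pencilM MA MB 0 = MA" "pencilM MA MB 1 = MB"
  by (intro ext; simp add: pencil_def pencilM_def)+

lemma polymap_hadamard:
  "polymap n G M \<Longrightarrow> x \<in> cspace n \<Longrightarrow> y \<in> cspace n \<Longrightarrow> i < n \<Longrightarrow>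
    G x i - G y i = (\<Sum>k<n. M x y i k * (x k - y k))"
  unfolding polymap_def by blast

lemma polymap_poly: "polymap n G M \<Longrightarrow> i < n \<Longrightarrow> polyfun n (\<lambda>x. G x i)"
  unfolding polymap_def by blast

lemma polymap_poly_matrix: "polymap n G M \<Longrightarrow> i < n \<Longrightarrow> k < n \<Longrightarrow> polyfun n (\<lambda>x. M x x i k)"
  unfolding polymap_def by blast

lemma polymap_cont_matrix:
  "polymap n G M \<Longrightarrow> i < n \<Longrightarrow> k < n \<Longrightarrow> continuous_on UNIV (\<lambda>(x, y). M x y i k)"
  unfolding polymap_def by blast

lemma polymap_add:
  assumes "polymap n A MA" "polymap n B MB"
  shows "polymap n (\<lambda>x i. a * A x i + b * B x i) (\<lambda>x y i k. a * MA x y i k + b * MB x y i k)"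
  unfolding polymap_def
proof (intro conjI ballI allI impI)
  fix x y i assume "x \<in> cspace n" "y \<in> cspace n" "i < n"
  then have "A x i - A y i = (\<Sum>k<n. MA x y i k * (x k - y k))"
    "B x i - B y i = (\<Sum>k<n. MB x y i k * (x k - y k))"
    using polymap_hadamard assms by blast+
  then have "a * (A x i - A y i) + b * (B x i - B y i)
      = a * (\<Sum>k<n. MA x y i k * (x k - y k)) + b * (\<Sum>k<n. MB x y i k * (x k - y k))"
    by (simp only:)
  also have "\<dots> = (\<Sum>k<n. (a * MA x y i k + b * MB x y i k) * (x k - y k))"
    by (simp only: sum_distrib_left sum.distrib[symmetric] distrib_right mult.assoc)
  finally show "a * A x i + b * B x i - (a * A y i + b * B y i)
      = (\<Sum>k<n. (a * MA x y i k + b * MB x y i k) * (x k - y k))"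
    by (simp add: algebra_simps)
next
  fix i k assume ik: "i < n" "k < n"
  have "continuous_on UNIV (\<lambda>p. a * (\<lambda>(x, y). MA x y i k) p + b * (\<lambda>(x, y). MB x y i k) p)"
    by (intro continuous_intros polymap_cont_matrix[OF assms(1) ik] polymap_cont_matrix[OF assms(2) ik])
  then show "continuous_on UNIV (\<lambda>(x, y). a * MA x y i k + b * MB x y i k)"
    by (simp add: case_prod_beta')
qed (intro polyfun_intros polymap_poly[OF assms(1)] polymap_poly[OF assms(2)]
    polymap_poly_matrix[OF assms(1)] polymap_poly_matrix[OF assms(2)]; assumption)+

lemma polymap_pencil:
  "polymap n A MA \<Longrightarrow> polymap n B MB \<Longrightarrow> polymap n (pencil A B s) (pencilM MA MB s)"
  using polymap_add[of n A MA B MB "1 - s" s] by (simp add: pencil_def[abs_def] pencilM_def[abs_def])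

lemma polymap_shift:
  assumes "polymap n A MA" shows "polymap n (\<lambda>x i. A x i - y i) MA"
  using assms unfolding polymap_def by (auto intro: polyfun_intros)

lemma hadamard_family_pencil:
  assumes A: "polymap n A MA" and B: "polymap n B MB"
  shows "hadamard_family n (pencil A B) (pencilM MA MB)"
proof
  fix x y i s assume "x \<in> cspace n" "y \<in> cspace n" "i < n"
  then show "pencil A B s x i - pencil A B s y i = (\<Sum>k<n. pencilM MA MB s x y i k * (x k - y k))"
    using polymap_hadamard[OF polymap_pencil[OF A B]] by blast
next
  fix i assume i: "i < n"
  have "continuous_on UNIV (\<lambda>x. A x i)" "continuous_on UNIV (\<lambda>x. B x i)"
    using polymap_poly[OF A i] polymap_poly[OF B i] by (auto intro: polyfun_continuous)
  note * = this[THEN continuous_on_compose2, of UNIV snd]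
  have "continuous_on UNIV (\<lambda>p::complex \<times> (nat \<Rightarrow> complex).
      (1 - fst p) * A (snd p) i + fst p * B (snd p) i)"
    by (intro continuous_intros *) auto
  then show "continuous_on UNIV (\<lambda>(s, x). pencil A B s x i)"
    by (simp add: pencil_def case_prod_beta')
next
  fix i k assume ik: "i < n" "k < n"
  note * = polymap_cont_matrix[OF A ik, THEN continuous_on_compose2, of UNIV snd]
    polymap_cont_matrix[OF B ik, THEN continuous_on_compose2, of UNIV snd]
  have "continuous_on UNIV (\<lambda>p::complex \<times> (nat \<Rightarrow> complex) \<times> (nat \<Rightarrow> complex).
      (1 - fst p) * (\<lambda>(x, y). MA x y i k) (snd p) + fst p * (\<lambda>(x, y). MB x y i k) (snd p))"
    by (intro continuous_intros *) auto
  then show "continuous_on UNIV (\<lambda>(s, x, y). pencilM MA MB s x y i k)"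
    by (simp add: pencilM_def case_prod_beta')
qed

text \<open>Elimination for the map sending \<open>(x, t)\<close> to
  \<open>(F x + t A x, t)\<close>. Its Jacobian determinant is that of \<open>MF + t MA\<close>,
  nonzero at \<open>(x0, 0)\<close>. Critical values lie on a hypersurface, and for generic
  \<open>y\<close> the line over \<open>y\<close> meets it in finitely many
  \<open>t\<close>.\<close>

lemma degenerate_fibres_finite:
  assumes F: "polymap n F MF" and A: "polymap n A MA"
    and x0: "x0 \<in> cspace n" "regular_at n MF x0"
  shows "\<exists>q. polyfun n q \<and> (\<exists>y. q y \<noteq> 0) \<and> (\<forall>y. q y \<noteq> 0 \<longrightarrow>
    finite {t. \<exists>x\<in>cspace n. (\<forall>i<n. F x i + t * A x i = y i) \<and>
      cdet n (\<lambda>i k. MF x x i k + t * MA x x i k) = 0})"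
proof -
  \<comment> \<open>The parameter \<open>t\<close> becomes the additional coordinate \<open>x n\<close>.\<close>
  define f where "f i = (\<lambda>x. if i < n then F x i + x n * A x i else x n)" for i
  define J where "J x = cdet n (\<lambda>i k. MF x x i k + x n * MA x x i k)" for x
  have f_poly: "polyfun (Suc n) (f i)" if "i < Suc n" for i
  proof (cases "i < n")
    case True
    have "polyfun (Suc n) (\<lambda>x. F x i)" "polyfun (Suc n) (\<lambda>x. A x i)"
      using polyfun_mono[OF polymap_poly[OF F True]] polyfun_mono[OF polymap_poly[OF A True]] by auto
    then have "polyfun (Suc n) (\<lambda>x. F x i + x n * A x i)" by (intro polyfun_intros) auto
    then show ?thesis using True by (simp add: f_def)
  qed (auto simp: f_def intro: polyfun_coord)
  have J_poly: "polyfun (Suc n) J"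
    unfolding J_def using polymap_poly_matrix[OF F] polymap_poly_matrix[OF A]
    by (intro polyfun_cdet polyfun_add polyfun_mult polyfun_coord polyfun_mono[of n _ "Suc n"]) auto
  have "x0 n = 0" using x0(1) by (simp add: cspace_def)
  then have "J x0 \<noteq> 0" using x0(2) by (simp add: J_def regular_at_def)
  then obtain q z where q: "polyfun (Suc n) q" "q z \<noteq> 0"
    and q_J: "\<And>x. J x = 0 \<Longrightarrow> q (\<lambda>i. f i x) = 0"
    using polyfun_elimination[of "Suc n" f J x0] f_poly J_poly by blast
  \<comment> \<open>Fixing the last coordinate at \<open>z n\<close> keeps \<open>q'\<close> nonzero
    at \<open>z\<close>; and \<open>q' y \<noteq> 0\<close> says that the line over \<open>y\<close>
    is not contained in the hypersurface.\<close>
  define q' where "q' y = q (\<lambda>i. if i < n then y i else z n)" for y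
  have "polyfun n q'"
    unfolding q'_def
  proof (rule polyfun_compose[OF q(1)])
    show "polyfun n (\<lambda>x. if i < n then x i else z n)" for i
      by (cases "i < n") (auto intro: polyfun_intros)
  qed
  moreover have "q' z = q z"
    unfolding q'_def using less_Suc_eq by (intro polyfun_agree[OF q(1)]) auto
  moreover have "finite {t. \<exists>x\<in>cspace n. (\<forall>i<n. F x i + t * A x i = y i) \<and>
      cdet n (\<lambda>i k. MF x x i k + t * MA x x i k) = 0}" if y: "q' y \<noteq> 0" for y
  proof (rule finite_subset)
    let ?a = "\<lambda>i. if i < n then y i else 0" and ?b = "\<lambda>i. if i < n then 0 else 1"
    have ab: "(\<lambda>i. ?a i + t * ?b i) = (\<lambda>i. if i < n then y i else t)" for t by auto
    show "finite {t. q (\<lambda>i. ?a i + t * ?b i) = 0}"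
      using y polyfun_line_finite_roots[OF q(1), of ?a "z n" ?b] unfolding q'_def ab by blast
    show "{t. \<exists>x\<in>cspace n. (\<forall>i<n. F x i + t * A x i = y i) \<and>
        cdet n (\<lambda>i k. MF x x i k + t * MA x x i k) = 0} \<subseteq> {t. q (\<lambda>i. ?a i + t * ?b i) = 0}"
    proof safe
      fix t x assume x: "x \<in> cspace n" "\<forall>i<n. F x i + t * A x i = y i"
        "cdet n (\<lambda>i k. MF x x i k + t * MA x x i k) = 0"
      let ?x = "x(n := t)"
      have same: "F ?x i = F x i" "A ?x i = A x i" if "i < n" for i
        using polyfun_agree[OF polymap_poly[OF F that], of ?x x]
          polyfun_agree[OF polymap_poly[OF A that], of ?x x] by auto
      have sameM: "MF ?x ?x i k = MF x x i k" "MA ?x ?x i k = MA x x i k" if "i < n" "k < n" for i k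
        using polyfun_agree[OF polymap_poly_matrix[OF F that], of ?x x]
          polyfun_agree[OF polymap_poly_matrix[OF A that], of ?x x] by auto
      have "J ?x = cdet n (\<lambda>i k. MF x x i k + t * MA x x i k)"
        unfolding J_def by (intro cdet_cong) (simp add: sameM)
      then have "q (\<lambda>i. f i ?x) = 0" using q_J x(3) by simp
      moreover have "q (\<lambda>i. f i ?x) = q (\<lambda>i. ?a i + t * ?b i)"
        by (intro polyfun_agree[OF q(1)]) (auto simp: f_def same x(2))
      ultimately show "q (\<lambda>i. ?a i + t * ?b i) = 0" by simp
    qed
  qed
  ultimately show ?thesis
    using q(2) by (intro exI[of _ q'] conjI allI impI exI[of _ z]) simp_all
qed

text \<open>Division of \<open>(1 - s) A + s (F - y)\<close> by \<open>s\<close> gives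
  \<open>F + t A - y\<close> with \<open>t = (1 - s) / s\<close>. The value \<open>s = 0\<close>
  corresponds to no \<open>t\<close> and is added by hand.\<close>

lemma pencil_degenerate_finite:
  assumes fin: "finite {t. \<exists>x\<in>cspace n. (\<forall>i<n. F x i + t * A x i = y i) \<and>
      cdet n (\<lambda>i k. MF x x i k + t * MA x x i k) = 0}"
  shows "finite {s. \<exists>x\<in>zero_set n (pencil A (\<lambda>x i. F x i - y i) s). \<not> regular_at n (pencilM MA MF s) x}"
    (is "finite ?B")
proof (rule finite_subset)
  let ?T = "{t. \<exists>x\<in>cspace n. (\<forall>i<n. F x i + t * A x i = y i) \<and>
      cdet n (\<lambda>i k. MF x x i k + t * MA x x i k) = 0}"
  show "finite (insert 0 ((\<lambda>t. 1 / (1 + t)) ` ?T))" using fin by simp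
  show "?B \<subseteq> insert 0 ((\<lambda>t. 1 / (1 + t)) ` ?T)"
  proof
    fix s assume "s \<in> ?B"
    then obtain x where x: "x \<in> cspace n" "\<And>i. i < n \<Longrightarrow> (1 - s) * A x i + s * (F x i - y i) = 0"
      "cdet n (\<lambda>i k. (1 - s) * MA x x i k + s * MF x x i k) = 0"
      by (auto simp: zero_set_def pencil_def pencilM_def[abs_def] regular_at_def)
    show "s \<in> insert 0 ((\<lambda>t. 1 / (1 + t)) ` ?T)"
    proof (cases "s = 0")
      case False
      define t where "t = (1 - s) / s"
      have st: "s * t = 1 - s" unfolding t_def using False by simp
      have "F x i + t * A x i = y i" if "i < n" for i
      proof -
        have "s * (F x i + t * A x i - y i) = (1 - s) * A x i + s * (F x i - y i)"
          unfolding st[symmetric] by (simp add: algebra_simps)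
        then have "s * (F x i + t * A x i - y i) = 0" using x(2)[OF that] by simp
        then show ?thesis using False by simp
      qed
      moreover have "(\<lambda>i k. s * (MF x x i k + t * MA x x i k)) = (\<lambda>i k. (1 - s) * MA x x i k + s * MF x x i k)"
        unfolding st[symmetric] by (simp add: algebra_simps)
      then have "cdet n (\<lambda>i k. MF x x i k + t * MA x x i k) = 0"
        using cdet_scale[OF False, of n "\<lambda>i k. MF x x i k + t * MA x x i k"] x(3) by simp
      ultimately have "t \<in> ?T" using x(1) by blast
      moreover have "s = 1 / (1 + t)" unfolding t_def using False by (simp add: field_simps)
      ultimately show ?thesis by blast
    qed simp
  qed
qed

lemma polymap_zero: "polymap n (\<lambda>x i. 0) (\<lambda>x y i k. 0)"
  unfolding polymap_def by (auto intro: polyfun_intros)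

text \<open>Sard's theorem for polynomial maps: for \<open>A = 0\<close> a single degenerate zero
  makes every complex \<open>t\<close> degenerate, so finiteness means that there is none.\<close>

lemma regular_fibres:
  assumes F: "polymap n F MF" and x0: "x0 \<in> cspace n" "regular_at n MF x0"
  shows "\<exists>q. polyfun n q \<and> (\<exists>y. q y \<noteq> 0) \<and>
    (\<forall>y. q y \<noteq> 0 \<longrightarrow> (\<forall>x\<in>zero_set n (\<lambda>x i. F x i - y i). regular_at n MF x))"
proof -
  obtain q where q: "polyfun n q" "\<exists>y. q y \<noteq> 0"
    and fin: "\<And>y. q y \<noteq> 0 \<Longrightarrow> finite {t::complex. \<exists>x\<in>cspace n. (\<forall>i<n. F x i + t * 0 = y i) \<and>
      cdet n (\<lambda>i k. MF x x i k + t * 0) = 0}"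
    using degenerate_fibres_finite[OF F polymap_zero x0] by blast
  have "regular_at n MF x" if "q y \<noteq> 0" "x \<in> zero_set n (\<lambda>x i. F x i - y i)" for x y
  proof (rule ccontr)
    assume "\<not> regular_at n MF x"
    then have "{t::complex. \<exists>x\<in>cspace n. (\<forall>i<n. F x i + t * 0 = y i) \<and>
      cdet n (\<lambda>i k. MF x x i k + t * 0) = 0} = UNIV"
      using that(2) unfolding zero_set_def regular_at_def by auto
    then show False using fin[OF that(1)] infinite_UNIV_char_0 by metis
  qed
  then show ?thesis using q by blast
qed

text \<open>The zeros in \<open>S\<close> persist for small parameters, and from a good small one
  the count in \<open>D\<close> is constant up to \<open>s = 1\<close>. The start
  \<open>s = 0\<close> may itself be bad, as \<open>A\<close> can have further, degenerate
  zeros.\<close>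

lemma perturbed_zero_count:
  assumes A: "polymap n A MA" and B: "polymap n B MB"
    and D: "open D" "compact K" "D \<inter> cspace n \<subseteq> K"
    and bdry: "\<And>s. s \<in> ball 0 2 \<Longrightarrow> zero_set n (pencil A B s) \<inter> K \<subseteq> D"
    and fin: "finite {s. \<exists>x\<in>zero_set n (pencil A B s). \<not> regular_at n (pencilM MA MB s) x}"
    and B_reg: "\<And>x. x \<in> zero_set n B \<Longrightarrow> regular_at n MB x"
    and S: "finite S" "S \<subseteq> zero_set n A \<inter> D" "\<And>c. c \<in> S \<Longrightarrow> regular_at n MA c"
  shows "finite (zero_set n B \<inter> D) \<and> card S \<le> card (zero_set n B \<inter> D)"
proof -
  interpret hadamard_family n "pencil A B" "pencilM MA MB" by (rule hadamard_family_pencil[OF A B])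
  let ?bad = "{s. \<exists>x\<in>zeros s. \<not> nondeg s x}"
  \<comment> \<open>Radius 2 puts both ends 0 and 1 into an open disc, which stays connected without
    finitely many points.\<close>
  define T where "T = ball 0 2 - ?bad"
  have T: "connected T"
    unfolding T_def using fin by (intro connected_open_delete_finite) auto
  have tr: "trapped n (pencil A B) D s" if s: "s \<in> ball 0 2" for s
  proof -
    obtain d where "d > 0" "ball s d \<subseteq> ball 0 2" using s open_contains_ball open_ball by metis
    moreover have "zeros s' \<inter> D \<subseteq> K \<inter> D \<and> zeros s' \<inter> K \<subseteq> D" if "s' \<in> ball 0 2" for s'
      using bdry[OF that] D(3) by (auto simp: zero_set_def)
    ultimately show ?thesis unfolding trapped_def using D(2) by blast
  qed
  have one: "1 \<in> T" unfolding T_def using B_reg by auto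
  obtain d where d: "d > 0" "\<forall>s\<in>ball 0 d. \<exists>S'. finite S' \<and> S' \<subseteq> zeros s \<inter> D \<and> card S' = card S"
    using nondeg_zeros_lower_bound[of S 0 D] S D(1) by auto
  obtain s where s: "s \<in> ball 0 (min d 2)" "s \<notin> ?bad"
    by (rule ball_avoid_finite[OF fin, of "min d 2" 0]) (use d(1) in simp)
  then have sT: "s \<in> T" unfolding T_def by auto
  have "s \<in> ball 0 d" using s(1) by simp
  from bspec[OF d(2) this] obtain S' where S': "S' \<subseteq> zeros s \<inter> D" "card S' = card S" by blast
  have loc: "finite (zeros s \<inter> D)" if "s \<in> T" for s
    using card_zeros_locally_constant[OF D(1) _ tr] that unfolding T_def by blast
  have "card S \<le> card (zeros s \<inter> D)" using card_mono[OF loc[OF sT] S'(1)] S'(2) by simp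
  also have "card (zeros s \<inter> D) = card (zeros 1 \<inter> D)"
    using card_zeros_constant[OF T sT one D(1)] tr unfolding T_def by blast
  finally show ?thesis using loc[OF one] by simp
qed

section \<open>Quadratic maps\<close>

definition quad :: "nat \<Rightarrow> (nat \<Rightarrow> nat \<Rightarrow> nat \<Rightarrow> complex) \<Rightarrow> cmap" where
  "quad n a x i = (\<Sum>k<n. \<Sum>l<n. a i k l * x k * x l)"

definition idemp :: "nat \<Rightarrow> (nat \<Rightarrow> nat \<Rightarrow> nat \<Rightarrow> complex) \<Rightarrow> cmap" where
  "idemp n a x i = quad n a x i - x i"

text \<open>For symmetric \<open>a\<close> the diagonal \<open>idempM n a x x\<close> is the matrix
  of \<open>2 L_x - I\<close>, singular exactly if \<open>1/2\<close> is an eigenvalue of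
  \<open>L_x\<close>.\<close>

definition idempM :: "nat \<Rightarrow> (nat \<Rightarrow> nat \<Rightarrow> nat \<Rightarrow> complex) \<Rightarrow> hmap" where
  "idempM n a x y i k = (\<Sum>l<n. a i k l * x l + a i l k * y l) - (if i = k then 1 else 0)"

definition no_nilpotents :: "nat \<Rightarrow> (nat \<Rightarrow> nat \<Rightarrow> nat \<Rightarrow> complex) \<Rightarrow> bool" where
  "no_nilpotents n a \<longleftrightarrow> (\<forall>x\<in>cspace n. (\<forall>i<n. quad n a x i = 0) \<longrightarrow> (\<forall>i<n. x i = 0))"

text \<open>Structure constants of the product of \<open>n\<close> copies of the complex numbers,
  the model algebra whose idempotents are known.\<close>

definition diag_coeff :: "nat \<Rightarrow> nat \<Rightarrow> nat \<Rightarrow> complex" where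
  "diag_coeff i k l = (if k = i \<and> l = i then 1 else 0)"

lemma quad_diag: "i < n \<Longrightarrow> quad n diag_coeff x i = x i ^ 2"
proof -
  assume i: "i < n"
  have "quad n diag_coeff x i = (\<Sum>k<n. \<Sum>l<n. if l = i then (if k = i then x k * x l else 0) else 0)"
    unfolding quad_def diag_coeff_def by (intro sum.cong refl) auto
  also have "\<dots> = x i ^ 2" using i by (simp add: sum.delta power2_eq_square)
  finally show ?thesis .
qed

lemma quad_scale: "quad n a (\<lambda>k. c * x k) i = c ^ 2 * quad n a x i"
  unfolding quad_def by (simp add: sum_distrib_left power2_eq_square mult_ac)

lemma quad_lincomb:
  "quad n (\<lambda>i k l. s * a i k l + t * b i k l) x i = s * quad n a x i + t * quad n b x i"
  unfolding quad_def by (simp add: sum_distrib_left sum.distrib[symmetric] algebra_simps)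

lemma quad_hadamard:
  "quad n a x i - quad n a y i = (\<Sum>k<n. (\<Sum>l<n. a i k l * x l + a i l k * y l) * (x k - y k))"
proof -
  have "quad n a x i - quad n a y i
      = (\<Sum>k<n. \<Sum>l<n. a i k l * x l * (x k - y k)) + (\<Sum>k<n. \<Sum>l<n. a i k l * y k * (x l - y l))"
    unfolding quad_def by (simp add: sum_subtractf[symmetric] sum.distrib[symmetric] algebra_simps)
  also have "(\<Sum>k<n. \<Sum>l<n. a i k l * y k * (x l - y l)) = (\<Sum>l<n. \<Sum>k<n. a i k l * y k * (x l - y l))"
    by (rule sum.swap)
  finally show ?thesis
    by (simp only: sum.distrib[symmetric] distrib_right sum_distrib_right)
qed

lemma polymap_idemp: "polymap n (idemp n a) (idempM n a)"
  unfolding polymap_def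
proof (intro conjI ballI allI impI)
  fix x y :: "nat \<Rightarrow> complex" and i assume i: "i < n"
  have "(\<Sum>k<n. (if i = k then 1 else 0) * (x k - y k)) = (\<Sum>k<n. if k = i then x k - y k else 0)"
    by (intro sum.cong) auto
  also have "\<dots> = x i - y i" using i by simp
  finally show "idemp n a x i - idemp n a y i = (\<Sum>k<n. idempM n a x y i k * (x k - y k))"
    unfolding idempM_def left_diff_distrib sum_subtractf
    using quad_hadamard[of n a x i y] by (simp add: idemp_def)
next
  fix i k assume "i < n" "k < n"
  have coord: "continuous_on UNIV (\<lambda>p::(nat \<Rightarrow> complex) \<times> (nat \<Rightarrow> complex). fst p l)"
    "continuous_on UNIV (\<lambda>p::(nat \<Rightarrow> complex) \<times> (nat \<Rightarrow> complex). snd p l)" for l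
    by (intro continuous_on_product_then_coordinatewise[of _ fst]
        continuous_on_product_then_coordinatewise[of _ snd] continuous_intros)+
  show "continuous_on UNIV (\<lambda>(x, y). idempM n a x y i k)"
    unfolding idempM_def case_prod_beta' by (intro continuous_intros coord)
qed (auto simp: idemp_def quad_def idempM_def intro!: polyfun_intros)

text \<open>The matrix at 0 is \<open>- I\<close>. This is the point that shows the Jacobian
  determinant not to vanish identically, as elimination requires.\<close>

lemma regular_idemp_0: "regular_at n (idempM n a) (\<lambda>_. 0)"
  unfolding regular_at_def cdet_0_iff
proof (clarify)
  fix u k assume u: "\<forall>i<n. (\<Sum>k<n. idempM n a (\<lambda>_. 0) (\<lambda>_. 0) i k * u k) = 0" "k < n" "u k \<noteq> 0"
  have "(\<Sum>l<n. idempM n a (\<lambda>_. 0) (\<lambda>_. 0) k l * u l) = (\<Sum>l<n. if l = k then - u l else 0)"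
    by (intro sum.cong) (auto simp: idempM_def)
  then show False using u by simp
qed

section \<open>Zeros at infinity\<close>

text \<open>Unbounded zeros, rescaled to norm 1, would accumulate at a nilpotent of norm 1 for
  \<open>b s0\<close>, because the terms of lower degree disappear in the limit.\<close>

lemma trapped_quadratic:
  assumes b: "\<And>i k l. continuous_on UNIV (\<lambda>s. b s i k l)" and c: "\<And>i. continuous_on UNIV (\<lambda>s. c s i)"
    and G: "\<And>s x i. i < n \<Longrightarrow> G s x i = quad n (b s) x i - x i - c s i"
    and nn: "no_nilpotents n (b s0)"
  shows "trapped n G UNIV s0"
proof -
  define K where "K = pball n (\<lambda>_. 0) 1 - {x. cnorm n x < 1}"
  have K: "x \<in> K \<longleftrightarrow> x \<in> cspace n \<and> cnorm n x = 1" for x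
    unfolding K_def pball_def by auto
  have "compact K" unfolding K_def
    by (intro compact_diff compact_pball open_Collect_less continuous_intros continuous_on_product_coordinates)
  \<comment> \<open>Homogenization: zeros of \<open>G s\<close> of norm \<open>1 / t\<close> correspond to zeros in \<open>K\<close> of the form below.\<close>
  define h where "h p = cnorm n (\<lambda>i. quad n (b (fst (fst p))) (snd p) i
      - snd (fst p) * snd p i - snd (fst p) ^ 2 * c (fst (fst p)) i)"
    for p :: "(complex \<times> complex) \<times> (nat \<Rightarrow> complex)"
  have coord: "continuous_on UNIV (\<lambda>p::(complex \<times> complex) \<times> (nat \<Rightarrow> complex). snd p l)" for l
    by (intro continuous_on_product_then_coordinatewise[of _ snd] continuous_intros)
  have bc: "continuous_on UNIV (\<lambda>p::(complex \<times> complex) \<times> (nat \<Rightarrow> complex). b (fst (fst p)) i k l)"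
    "continuous_on UNIV (\<lambda>p::(complex \<times> complex) \<times> (nat \<Rightarrow> complex). c (fst (fst p)) i)" for i k l
    by (rule continuous_on_compose2[OF b] continuous_on_compose2[OF c], intro continuous_intros, simp)+
  have "continuous_on UNIV h"
    unfolding h_def quad_def by (intro continuous_intros coord bc)
  then have "closed {p. h p = 0}" by (intro closed_Collect_eq) (auto intro: continuous_intros)
  moreover have "((s0, 0), x) \<notin> {p. h p = 0}" if "x \<in> K" for x
  proof
    assume "((s0, 0), x) \<in> {p. h p = 0}"
    then have "\<forall>i<n. quad n (b s0) x i = 0" by (simp add: h_def cnorm_eq_0_iff)
    then have "\<forall>i<n. x i = 0" using nn that K unfolding no_nilpotents_def by blast
    then have "cnorm n x = 0" by (simp add: cnorm_eq_0_iff)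
    then show False using that K by simp
  qed
  ultimately obtain d where d: "d > 0" and avoid: "\<forall>p\<in>ball (s0, 0) d. \<forall>x\<in>K. (p, x) \<notin> {p. h p = 0}"
    using compact_avoid_closed[OF \<open>compact K\<close>, of "{p. h p = 0}" "(s0, 0)"] by blast
  \<comment> \<open>A norm above \<open>2 / d\<close> has a reciprocal below \<open>d / 2\<close>;
    together with the distance of \<open>s\<close> from \<open>s0\<close> this stays below
    \<open>d\<close>.\<close>
  have bound: "cnorm n x \<le> 2 / d" if s: "s \<in> ball s0 (d / 2)" and x: "x \<in> zero_set n (G s)" for s x
  proof (rule ccontr)
    assume big: "\<not> cnorm n x \<le> 2 / d"
    define R where "R = cnorm n x"
    have R: "R > 2 / d" using big R_def by simp
    then have R0: "R > 0" using d by (meson divide_pos_pos less_trans zero_less_numeral)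
    have x_space: "x \<in> cspace n" using x by (simp add: zero_set_def)
    let ?t = "complex_of_real (1 / R)"
    let ?X = "\<lambda>k. ?t * x k"
    have "cnorm n ?X = 1" using R0 unfolding cnorm_scale R_def[symmetric] norm_of_real by simp
    then have "?X \<in> K" using x_space K by (simp add: cspace_def)
    moreover have "(s, ?t) \<in> ball (s0, 0) d"
    proof -
      have "dist (s0, 0) (s, ?t) \<le> dist s0 s + dist 0 ?t"
        unfolding dist_Pair_Pair by (rule sqrt_sum_squares_le_sum) auto
      moreover have "dist 0 ?t < d / 2" using R R0 d by (simp add: norm_divide field_simps)
      ultimately show ?thesis using s by simp
    qed
    ultimately have "h ((s, ?t), ?X) \<noteq> 0" using avoid by blast
    moreover have "h ((s, ?t), ?X) = 0"
    proof -
      have "quad n (b s) ?X i - ?t * ?X i - ?t ^ 2 * c s i = 0" if "i < n" for i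
      proof -
        have "quad n (b s) (\<lambda>k. t * x k) i - t * (t * x i) - t ^ 2 * c s i
            = t ^ 2 * (quad n (b s) x i - x i - c s i)" for t
          unfolding quad_scale by (simp add: power2_eq_square algebra_simps)
        then have "quad n (b s) ?X i - ?t * ?X i - ?t ^ 2 * c s i = ?t ^ 2 * (quad n (b s) x i - x i - c s i)" .
        also have "\<dots> = 0" using x that G[OF that, of s x] by (simp add: zero_set_def)
        finally show ?thesis .
      qed
      then show ?thesis unfolding h_def cnorm_eq_0_iff by simp
    qed
    ultimately show False by simp
  qed
  show ?thesis unfolding trapped_def
    using d bound compact_pball[of n "\<lambda>_. 0" "2 / d"]
    by (intro exI[of _ "d / 2"] conjI exI[of _ "pball n (\<lambda>_. 0) (2 / d)"])
      (auto simp: pball_def zero_set_def)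
qed

text \<open>A nilpotent \<open>x\<close> at parameter \<open>s\<close> satisfies
  \<open>quad n a x i = (1 - 1 / s) * x i ^ 2\<close>. A word of \<open>n + 1\<close> letters out of
  \<open>n\<close> repeats one, so every monomial of that degree contains a square. Rewriting it
  makes the vector of monomials of \<open>x\<close> an eigenvector, with eigenvalue
  \<open>1 - 1 / s\<close>, of a matrix that does not depend on \<open>s\<close>. This stands in for
  a resultant.\<close>

lemma nilpotent_pencil_finite:
  "finite {s. \<not> no_nilpotents n (\<lambda>i k l. (1 - s) * diag_coeff i k l + s * a i k l)}"
proof -
  define W where "W = PiE {..n} (\<lambda>_. {..<n})"
  have finW: "finite W" unfolding W_def by (intro finite_PiE) auto
  have "\<exists>r r'. r \<le> n \<and> r' \<le> n \<and> r \<noteq> r' \<and> w r = w r'" if "w \<in> W" for w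
  proof -
    have "w ` {..n} \<subseteq> {..<n}" using that unfolding W_def by auto
    then have "card (w ` {..n}) < card {..n}"
      using card_mono[of "{..<n}" "w ` {..n}"] by simp
    from pigeonhole[OF this] show ?thesis unfolding inj_on_def by auto
  qed
  then have "\<forall>w\<in>W. \<exists>r r'. r \<le> n \<and> r' \<le> n \<and> r \<noteq> r' \<and> w r = w r'" by blast
  from bchoice[OF this] obtain r where "\<forall>w\<in>W. \<exists>r'. r w \<le> n \<and> r' \<le> n \<and> r w \<noteq> r' \<and> w (r w) = w r'"
    by (elim exE)
  from bchoice[OF this] obtain r' where
    "\<forall>w\<in>W. r w \<le> n \<and> r' w \<le> n \<and> r w \<noteq> r' w \<and> w (r w) = w (r' w)"
    by (elim exE)
  note r = bspec[OF this]
  \<comment> \<open>Replacing the square of a repeated letter in the monomial of degree \<open>n + 1\<close> spelled by the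
    word \<open>w\<close> is a linear operation on the vector of all such monomials.\<close>
  define B where "B w w' = (if \<forall>t\<in>{..n} - {r w, r' w}. w' t = w t
      then a (w (r w)) (w' (r w)) (w' (r' w)) else 0)" for w w'
  define X where "X x w = (\<Prod>t\<le>n. x (w t))" for x :: "nat \<Rightarrow> complex" and w
  define R where "R x w = (\<Prod>t\<in>{..n} - {r w, r' w}. x (w t))" for x :: "nat \<Rightarrow> complex" and w
  have X_split: "X x w' = x (w' (r w)) * x (w' (r' w)) * (\<Prod>t\<in>{..n} - {r w, r' w}. x (w' t))"
    if "w \<in> W" for x w w'
  proof -
    have "{..n} = insert (r w) (insert (r' w) ({..n} - {r w, r' w}))" using r[OF that] by auto
    then have "X x w' = (\<Prod>t\<in>insert (r w) (insert (r' w) ({..n} - {r w, r' w})). x (w' t))"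
      unfolding X_def by simp
    then show ?thesis using r[OF that] by (simp add: mult.assoc)
  qed
  have BX: "(\<Sum>w'\<in>W. B w w' * X x w') = quad n a x (w (r w)) * R x w" if w: "w \<in> W" for x w
  proof -
    let ?A = "{w' \<in> W. \<forall>t\<in>{..n} - {r w, r' w}. w' t = w t}"
    have "(\<Sum>w'\<in>W. B w w' * X x w')
        = (\<Sum>w'\<in>W. if \<forall>t\<in>{..n} - {r w, r' w}. w' t = w t
            then a (w (r w)) (w' (r w)) (w' (r' w)) * X x w' else 0)"
      by (intro sum.cong) (auto simp: B_def)
    also have "\<dots> = (\<Sum>w'\<in>?A. a (w (r w)) (w' (r w)) (w' (r' w)) * X x w')"
      using finW by (simp add: sum.inter_filter)
    also have "\<dots> = (\<Sum>w'\<in>?A. a (w (r w)) (w' (r w)) (w' (r' w)) * x (w' (r w)) * x (w' (r' w)) * R x w)"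
    proof (rule sum.cong[OF refl])
      fix w' assume w': "w' \<in> ?A"
      have "(\<Prod>t\<in>{..n} - {r w, r' w}. x (w' t)) = R x w"
        unfolding R_def using w' by (intro prod.cong) auto
      then show "a (w (r w)) (w' (r w)) (w' (r' w)) * X x w'
          = a (w (r w)) (w' (r w)) (w' (r' w)) * x (w' (r w)) * x (w' (r' w)) * R x w"
        using X_split[OF w, of x w'] by (simp add: mult.assoc)
    qed
    \<comment> \<open>A word that agrees with \<open>w\<close> off the two chosen positions is
      determined by its letters \<open>k\<close>, \<open>l\<close> there.\<close>
    also have "\<dots> = (\<Sum>(k, l)\<in>{..<n} \<times> {..<n}. a (w (r w)) k l * x k * x l * R x w)"
    proof (rule sum.reindex_bij_witness[where i = "\<lambda>(k, l). w(r w := k, r' w := l)"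
          and j = "\<lambda>w'. (w' (r w), w' (r' w))"])
      fix w' assume w': "w' \<in> ?A"
      show "(\<lambda>(k, l). w(r w := k, r' w := l)) (w' (r w), w' (r' w)) = w'"
      proof
        fix t
        have "w t = w' t" if "t \<noteq> r w" "t \<noteq> r' w"
        proof (cases "t \<le> n")
          case False
          then show ?thesis using w w' unfolding W_def by (simp add: PiE_def extensional_def)
        qed (use w' that in auto)
        then show "(\<lambda>(k, l). w(r w := k, r' w := l)) (w' (r w), w' (r' w)) t = w' t" by simp
      qed
      have "w' \<in> PiE {..n} (\<lambda>_. {..<n})" using w' by (simp add: W_def)
      then have "w' (r w) \<in> {..<n}" "w' (r' w) \<in> {..<n}" using r[OF w] by (auto dest: PiE_mem)
      then show "(w' (r w), w' (r' w)) \<in> {..<n} \<times> {..<n}" by simp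
    next
      fix p :: "nat \<times> nat" assume p: "p \<in> {..<n} \<times> {..<n}"
      then show "((\<lambda>(k, l). w(r w := k, r' w := l)) p (r w), (\<lambda>(k, l). w(r w := k, r' w := l)) p (r' w)) = p"
        using r[OF w] by (auto split: prod.splits)
      show "(\<lambda>(k, l). w(r w := k, r' w := l)) p \<in> ?A"
        using p w r[OF w] unfolding W_def by (auto simp: PiE_def extensional_def Pi_def split: prod.splits)
    qed auto
    also have "\<dots> = quad n a x (w (r w)) * R x w"
      unfolding quad_def by (simp add: sum.cartesian_product[symmetric] sum_distrib_right)
    finally show ?thesis .
  qed
  let ?E = "{t. \<exists>X. (\<exists>w\<in>W. X w \<noteq> 0) \<and> (\<forall>w\<in>W. (\<Sum>w'\<in>W. B w w' * X w') = t * X w)}"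
  have "finite (insert 1 ((\<lambda>t. 1 / (1 - t)) ` ?E))" using finite_eigenvalues[OF finW] by simp
  moreover have "{s. \<not> no_nilpotents n (\<lambda>i k l. (1 - s) * diag_coeff i k l + s * a i k l)}
      \<subseteq> insert 1 ((\<lambda>t. 1 / (1 - t)) ` ?E)"
  proof
    fix s assume "s \<in> {s. \<not> no_nilpotents n (\<lambda>i k l. (1 - s) * diag_coeff i k l + s * a i k l)}"
    then obtain x i0 where x: "i0 < n" "x i0 \<noteq> 0"
      and zero: "\<And>i. i < n \<Longrightarrow> (1 - s) * x i ^ 2 + s * quad n a x i = 0"
      unfolding no_nilpotents_def quad_lincomb using quad_diag[of _ n x]
      by (auto simp: quad_diag)
    show "s \<in> insert 1 ((\<lambda>t. 1 / (1 - t)) ` ?E)"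
    proof (cases "s = 1")
      case False
      have s0: "s \<noteq> 0" using zero[OF x(1)] x(2) by auto
      have eig: "(\<Sum>w'\<in>W. B w w' * X x w') = (1 - 1 / s) * X x w" if w: "w \<in> W" for w
      proof -
        have i: "w (r w) < n" using w r[OF w] unfolding W_def by auto
        have "s * quad n a x (w (r w)) = s * ((1 - 1 / s) * x (w (r w)) ^ 2)"
          using zero[OF i] s0 by (simp add: algebra_simps eq_neg_iff_add_eq_0)
        then have "quad n a x (w (r w)) = (1 - 1 / s) * x (w (r w)) ^ 2" using s0 by simp
        then show ?thesis
          unfolding BX[OF w] X_split[OF w, of x w] R_def using r[OF w]
          by (simp add: power2_eq_square)
      qed
      \<comment> \<open>The constant word spells \<open>x i0 ^ (n + 1)\<close>, so the eigenvector
        is not zero.\<close>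
      have w0: "restrict (\<lambda>_. i0) {..n} \<in> W" "X x (restrict (\<lambda>_. i0) {..n}) \<noteq> 0"
        using x by (auto simp: W_def X_def)
      have "1 - 1 / s \<in> ?E"
        unfolding mem_Collect_eq
        by (intro exI[of _ "X x"] conjI ballI bexI[where P = "\<lambda>w. X x w \<noteq> 0", OF w0(2,1)] eig)
      moreover have "s = 1 / (1 - (1 - 1 / s))" by simp
      ultimately show ?thesis by blast
    qed simp
  qed
  ultimately show ?thesis by (rule finite_subset[rotated])
qed

section \<open>Comparison with the product algebra\<close>

lemma card_zero_set_diag: "card (zero_set n (idemp n diag_coeff)) = 2 ^ n"
proof -
  have "zero_set n (idemp n diag_coeff) = (\<lambda>S i. if i \<in> S then 1 else 0) ` Pow {..<n}" (is "_ = ?f ` _")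
  proof
    show "zero_set n (idemp n diag_coeff) \<subseteq> ?f ` Pow {..<n}"
    proof
      fix x assume "x \<in> zero_set n (idemp n diag_coeff)"
      then have x: "\<And>i. i \<ge> n \<Longrightarrow> x i = 0" "\<And>i. i < n \<Longrightarrow> x i * (x i - 1) = 0"
        by (auto simp: zero_set_def cspace_def idemp_def quad_diag power2_eq_square algebra_simps)
      have "x = ?f {i. i < n \<and> x i = 1}"
      proof
        fix i show "x i = ?f {i. i < n \<and> x i = 1} i"
          using x(1)[of i] x(2)[of i] by (cases "i < n") auto
      qed
      then show "x \<in> ?f ` Pow {..<n}" by blast
    qed
    show "?f ` Pow {..<n} \<subseteq> zero_set n (idemp n diag_coeff)"
      by (auto simp: zero_set_def cspace_def idemp_def quad_diag)
  qed
  moreover have "inj_on ?f (Pow {..<n})"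
    by (intro inj_onI) (auto simp: fun_eq_iff split: if_splits)
  ultimately show ?thesis by (simp add: card_image card_Pow)
qed

text \<open>The Jacobian matrix is diagonal with entries \<open>2 * x k - 1\<close>, which are 1 or
  -1 at a zero.\<close>

lemma regular_diag:
  assumes "x \<in> zero_set n (idemp n diag_coeff)"
  shows "regular_at n (idempM n diag_coeff) x"
  unfolding regular_at_def cdet_0_iff
proof (clarify)
  fix u k assume u: "\<forall>i<n. (\<Sum>k<n. idempM n diag_coeff x x i k * u k) = 0" "k < n" "u k \<noteq> 0"
  have "idempM n diag_coeff x x k l = (if l = k then 2 * x k - 1 else 0)" if "l < n" for l
  proof -
    have "(\<Sum>j<n. diag_coeff k l j * x j + diag_coeff k j l * x j)
        = (\<Sum>j<n. if j = k then (if l = k then 2 * x k else 0) else 0)"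
      by (intro sum.cong) (auto simp: diag_coeff_def)
    also have "\<dots> = (if l = k then 2 * x k else 0)" using u(2) by simp
    finally show ?thesis unfolding idempM_def by auto
  qed
  then have "(\<Sum>l<n. idempM n diag_coeff x x k l * u l) = (\<Sum>l<n. if l = k then (2 * x k - 1) * u l else 0)"
    by (intro sum.cong) auto
  then have "(2 * x k - 1) * u k = 0" using u(1,2) by simp
  then have half: "2 * x k = 1" using u(3) by simp
  have "x k ^ 2 - x k = 0" using assms u(2) by (simp add: zero_set_def idemp_def quad_diag)
  then have "(2 * x k) ^ 2 = 2 * (2 * x k)" by (simp add: power_mult_distrib)
  then show False unfolding half by simp
qed

text \<open>Both ends have the same linear part \<open>- x\<close>, so every member of the pencil
  again has the form that \<open>trapped_quadratic\<close> covers.\<close>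

lemma trapped_pencil:
  assumes "no_nilpotents n (\<lambda>i k l. (1 - s) * b i k l + s * a i k l)"
  shows "trapped n (pencil (idemp n b) (\<lambda>x i. idemp n a x i - y i)) UNIV s"
proof (rule trapped_quadratic[where b = "\<lambda>s i k l. (1 - s) * b i k l + s * a i k l" and c = "\<lambda>s i. s * y i"])
  fix s x i
  show "pencil (idemp n b) (\<lambda>x i. idemp n a x i - y i) s x i
      = quad n (\<lambda>i k l. (1 - s) * b i k l + s * a i k l) x i - x i - s * y i"
    unfolding quad_lincomb by (simp add: pencil_def idemp_def algebra_simps)
qed (use assms in \<open>auto intro!: continuous_intros\<close>)

text \<open>At every good parameter there are as many zeros as for \<open>diag_coeff\<close>.
  Without nilpotents \<open>s = 1\<close> is good. With nilpotents it is not, but nondegenerate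
  zeros there persist at good parameters nearby, which gives the inequality.\<close>

lemma generic_fibre_count:
  assumes reg: "\<And>x. x \<in> zero_set n (\<lambda>x i. idemp n a x i - y i) \<Longrightarrow> regular_at n (idempM n a) x"
    and fin: "finite {t. \<exists>x\<in>cspace n. (\<forall>i<n. idemp n a x i + t * idemp n diag_coeff x i = y i) \<and>
      cdet n (\<lambda>i k. idempM n a x x i k + t * idempM n diag_coeff x x i k) = 0}"
  shows "finite S \<Longrightarrow> S \<subseteq> zero_set n (\<lambda>x i. idemp n a x i - y i) \<Longrightarrow> card S \<le> 2 ^ n"
    and "no_nilpotents n a \<Longrightarrow> card (zero_set n (\<lambda>x i. idemp n a x i - y i)) = 2 ^ n"
proof -
  let ?E = "idemp n diag_coeff" and ?F = "\<lambda>x i. idemp n a x i - y i"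
  interpret hadamard_family n "pencil ?E ?F" "pencilM (idempM n diag_coeff) (idempM n a)"
    by (intro hadamard_family_pencil polymap_shift polymap_idemp)
  define Bad where "Bad = {s. \<exists>x\<in>zeros s. \<not> nondeg s x} \<union>
    {s. \<not> no_nilpotents n (\<lambda>i k l. (1 - s) * diag_coeff i k l + s * a i k l)}"
  have Bad: "finite Bad"
    unfolding Bad_def using pencil_degenerate_finite[of n "idemp n a" "idemp n diag_coeff" y "idempM n a" "idempM n diag_coeff"]
      fin nilpotent_pencil_finite by blast
  have T: "connected (- Bad)"
    using Bad convex_connected[OF convex_UNIV] connected_open_delete_finite[of "UNIV :: complex set" Bad] by (simp add: Compl_eq_Diff_UNIV)
  have tr: "trapped n (pencil ?E ?F) UNIV s" if "s \<in> - Bad" for s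
    using that by (intro trapped_pencil) (auto simp: Bad_def)
  have "no_nilpotents n (\<lambda>i k l. (1 - 0) * diag_coeff i k l + 0 * a i k l)"
    unfolding no_nilpotents_def quad_lincomb by (auto simp: quad_diag)
  then have zero: "0 \<in> - Bad" using regular_diag by (auto simp: Bad_def)
  have count: "card (zeros s) = 2 ^ n" if "s \<in> - Bad" for s
  proof -
    have "card (zeros s \<inter> UNIV) = card (zeros 0 \<inter> UNIV)"
      by (rule card_zeros_constant[OF T that zero open_UNIV _ tr]) (auto simp: Bad_def)
    then show ?thesis by (simp add: card_zero_set_diag)
  qed
  show "card S \<le> 2 ^ n" if S: "finite S" "S \<subseteq> zero_set n ?F"
  proof -
    obtain d where d: "d > 0" "\<forall>s\<in>ball 1 d. \<exists>S'. finite S' \<and> S' \<subseteq> zeros s \<inter> UNIV \<and> card S' = card S"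
      using nondeg_zeros_lower_bound[of S 1 UNIV] S reg by auto
    obtain s where s: "s \<in> ball 1 d" "s \<notin> Bad" by (rule ball_avoid_finite[OF Bad d(1)])
    from bspec[OF d(2) s(1)] obtain S' where S': "S' \<subseteq> zeros s" "card S' = card S" by blast
    have card_s: "card (zeros s) = 2 ^ n" using count s(2) by blast
    then have "finite (zeros s)" using card.infinite by fastforce
    then show ?thesis using card_mono[OF _ S'(1)] S'(2) card_s by simp
  qed
  show "card (zero_set n ?F) = 2 ^ n" if "no_nilpotents n a"
  proof -
    have "1 \<in> - Bad" using that reg by (auto simp: Bad_def)
    then show ?thesis using count[of 1] by simp
  qed
qed

lemma generic_values:
  "\<exists>q. polyfun n q \<and> (\<exists>y. q y \<noteq> 0) \<and> (\<forall>y. q y \<noteq> 0 \<longrightarrow>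
    (\<forall>x\<in>zero_set n (\<lambda>x i. idemp n a x i - y i). regular_at n (idempM n a) x) \<and>
    finite {t. \<exists>x\<in>cspace n. (\<forall>i<n. idemp n a x i + t * idemp n diag_coeff x i = y i) \<and>
      cdet n (\<lambda>i k. idempM n a x x i k + t * idempM n diag_coeff x x i k) = 0})"
proof -
  have x0: "(\<lambda>_. 0) \<in> cspace n" "regular_at n (idempM n a) (\<lambda>_. 0)"
    using regular_idemp_0 by (auto simp: cspace_def)
  obtain q1 where q1: "polyfun n q1" "\<exists>y. q1 y \<noteq> 0" "\<And>y. q1 y \<noteq> 0 \<Longrightarrow>
      (\<forall>x\<in>zero_set n (\<lambda>x i. idemp n a x i - y i). regular_at n (idempM n a) x)"
    using regular_fibres[OF polymap_idemp x0] by blast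
  obtain q2 where q2: "polyfun n q2" "\<exists>y. q2 y \<noteq> 0" "\<And>y. q2 y \<noteq> 0 \<Longrightarrow>
      finite {t. \<exists>x\<in>cspace n. (\<forall>i<n. idemp n a x i + t * idemp n diag_coeff x i = y i) \<and>
        cdet n (\<lambda>i k. idempM n a x x i k + t * idempM n diag_coeff x x i k) = 0}"
    using degenerate_fibres_finite[OF polymap_idemp polymap_idemp x0] by blast
  have "\<exists>y. q1 y * q2 y \<noteq> 0" using polyfun_no_zero_divisors[OF q1(1) q2(1)] q1(2) q2(2) by blast
  then show ?thesis
    using polyfun_mult[OF q1(1) q2(1)] q1(3) q2(3) by (intro exI[of _ "\<lambda>y. q1 y * q2 y"]) auto
qed

text \<open>The value 0 need not be generic. As all zeros are regular and stay bounded, their number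
  does not change under the shift by a small generic multiple of \<open>y\<close>.\<close>

theorem card_zeros_regular:
  assumes reg: "\<And>x. x \<in> zero_set n (idemp n a) \<Longrightarrow> regular_at n (idempM n a) x"
    and nn: "no_nilpotents n a"
  shows "card (zero_set n (idemp n a)) = 2 ^ n"
proof -
  obtain q y where q: "polyfun n q" "q y \<noteq> 0"
    and generic: "\<And>y. q y \<noteq> 0 \<Longrightarrow> card (zero_set n (\<lambda>x i. idemp n a x i - y i)) = 2 ^ n"
    using generic_values[of n a] generic_fibre_count(2)[OF _ _ nn] by blast
  let ?F = "\<lambda>x i. idemp n a x i - y i"
  interpret hadamard_family n "pencil (idemp n a) ?F" "pencilM (idempM n a) (idempM n a)"
    by (intro hadamard_family_pencil polymap_shift polymap_idemp)
  have "trapped n (pencil (idemp n a) ?F) UNIV 0" using nn by (intro trapped_pencil) simp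
  then obtain d where d: "d > 0" "\<forall>s\<in>ball 0 d. card (zeros s) = card (zeros 0)"
    using card_zeros_locally_constant[of UNIV 0] reg by auto
  have "finite {s. q (\<lambda>i. 0 + s * y i) = 0}"
    using polyfun_line_finite_roots[OF q(1), of "\<lambda>_. 0" 1 y] q(2) by simp
  then obtain s where s: "s \<in> ball 0 d" "s \<notin> {s. q (\<lambda>i. 0 + s * y i) = 0}"
    by (rule ball_avoid_finite[OF _ d(1)])
  have "pencil (idemp n a) ?F s = (\<lambda>x i. idemp n a x i - s * y i)"
    by (intro ext) (simp add: pencil_def algebra_simps)
  then have "card (zeros s) = 2 ^ n" using generic[of "\<lambda>i. s * y i"] s(2) by simp
  then show ?thesis using bspec[OF d(2) s(1)] by simp
qed

section \<open>Splitting a degenerate zero\<close>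

lemma polymap_continuous_cnorm:
  assumes "\<And>i. i < n \<Longrightarrow> polyfun n (\<lambda>x. G x i)"
  shows "continuous_on S (\<lambda>x. cnorm n (G x))"
  using assms by (intro continuous_on_cnorm polyfun_continuous)

lemma compact_bound_cnorm:
  assumes "compact K" "\<And>i. i < n \<Longrightarrow> polyfun n (\<lambda>x. G x i)"
  shows "\<exists>C>0. \<forall>x\<in>K. cnorm n (G x) \<le> C"
proof -
  have "compact ((\<lambda>x. cnorm n (G x)) ` K)"
    by (intro compact_continuous_image polymap_continuous_cnorm assms)
  then have "bounded ((\<lambda>x. cnorm n (G x)) ` K)" by (rule compact_imp_bounded)
  then obtain C where "\<forall>x\<in>K. cnorm n (G x) \<le> C" unfolding bounded_iff by (auto simp: abs_le_iff)
  then show ?thesis by (intro exI[of _ "max 1 C"]) (auto intro: max.coboundedI2)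
qed

text \<open>Mixing in a small multiple of \<open>B\<close>, which has regular zeros at the points of
  \<open>S\<close>, keeps these zeros and makes them regular for all but finitely many
  \<open>s\<close>: each determinant is a polynomial in \<open>s\<close>, nonzero at
  \<open>s = 1\<close>.\<close>

lemma pencil_approximation:
  assumes A: "polymap n A MA" and B: "polymap n B MB" and K: "compact K" and m: "m > 0"
    and S: "finite S" "S \<subseteq> zero_set n A" "S \<subseteq> zero_set n B" "\<And>c. c \<in> S \<Longrightarrow> regular_at n MB c"
  shows "\<exists>A' MA'. polymap n A' MA' \<and> (\<forall>x\<in>K. cnorm n (\<lambda>i. A' x i - A x i) \<le> m) \<and>
    S \<subseteq> zero_set n A' \<and> (\<forall>c\<in>S. regular_at n MA' c)"
proof -
  have "polyfun n (\<lambda>x. B x i - A x i)" if "i < n" for i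
    using polymap_poly[OF A that] polymap_poly[OF B that] by (rule polyfun_diff[rotated])
  then obtain C where C: "C > 0" "\<forall>x\<in>K. cnorm n (\<lambda>i. B x i - A x i) \<le> C"
    using compact_bound_cnorm[OF K, of n "\<lambda>x i. B x i - A x i"] by blast
  have "finite {s. \<not> regular_at n (pencilM MA MB s) c}" if "c \<in> S" for c
  proof -
    \<comment> \<open>Coordinate 0 plays the part of \<open>s\<close>, so that
      \<open>polyfun_line_finite_roots\<close> applies.\<close>
    define f where "f z = cdet n (\<lambda>i k. (1 - z 0) * MA c c i k + z 0 * MB c c i k)" for z :: "nat \<Rightarrow> complex"
    have "polyfun 1 f"
      unfolding f_def by (intro polyfun_cdet polyfun_intros) auto
    moreover have "f (\<lambda>i. 0 + 1 * 1) \<noteq> 0"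
      using S(4)[OF that] by (simp add: f_def regular_at_def)
    ultimately have "finite {s. f (\<lambda>i. 0 + s * 1) = 0}"
      by (rule polyfun_line_finite_roots)
    then show ?thesis by (simp add: f_def regular_at_def pencilM_def[abs_def])
  qed
  then have fin: "finite (\<Union>c\<in>S. {s. \<not> regular_at n (pencilM MA MB s) c})" using S(1) by blast
  obtain s where s: "s \<in> ball 0 (m / C)" "s \<notin> (\<Union>c\<in>S. {s. \<not> regular_at n (pencilM MA MB s) c})"
    by (rule ball_avoid_finite[OF fin, of "m / C" 0]) (use m C(1) in simp)
  show ?thesis
  proof (intro exI[of _ "pencil A B s"] exI[of _ "pencilM MA MB s"] conjI ballI)
    show "polymap n (pencil A B s) (pencilM MA MB s)" by (rule polymap_pencil[OF A B])
    show "S \<subseteq> zero_set n (pencil A B s)" 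
    proof
      fix x assume "x \<in> S"
      then have "x \<in> zero_set n A" "x \<in> zero_set n B" using S(2,3) by auto
      then show "x \<in> zero_set n (pencil A B s)" by (simp add: zero_set_def pencil_def)
    qed
    show "regular_at n (pencilM MA MB s) c" if "c \<in> S" for c using s(2) that by blast
    fix x assume x: "x \<in> K"
    have "cnorm n (\<lambda>i. pencil A B s x i - A x i) = cnorm n (\<lambda>i. s * (B x i - A x i))"
      by (rule arg_cong[where f = "cnorm n"]) (auto simp: pencil_def algebra_simps)
    also have "\<dots> \<le> cmod s * C" unfolding cnorm_scale using C x by (intro mult_left_mono) auto
    also have "\<dots> \<le> m" using s(1) C(1) by (simp add: field_simps)
    finally show "cnorm n (\<lambda>i. pencil A B s x i - A x i) \<le> m" .
  qed
qed

lemma polymap_coordinate_shift: "polymap n (\<lambda>x i. x i - c i) (\<lambda>x y i k. if k = i then 1 else 0)"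
  unfolding polymap_def
proof (intro conjI ballI allI impI)
  fix x y :: "nat \<Rightarrow> complex" and i assume i: "i < n"
  have "(\<Sum>k<n. (if k = i then 1 else 0) * (x k - y k)) = (\<Sum>k<n. if k = i then x k - y k else 0)"
    by (intro sum.cong) auto
  then show "x i - c i - (y i - c i) = (\<Sum>k<n. (if k = i then 1 else 0) * (x k - y k))"
    using i by simp
qed (auto intro: polyfun_intros)

lemma regular_coordinate_shift: "regular_at n (\<lambda>x y i k. if k = i then 1 else 0) c"
  unfolding regular_at_def cdet_0_iff
proof (clarify)
  fix u :: "nat \<Rightarrow> complex" and k
  assume u: "\<forall>i<n. (\<Sum>k<n. (if k = i then 1 else 0) * u k) = 0" "k < n" "u k \<noteq> 0"
  have "(\<Sum>l<n. (if l = k then 1 else 0) * u l) = (\<Sum>l<n. if l = k then u l else 0)"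
    by (intro sum.cong) auto
  then show False using u by simp
qed

text \<open>The map mixed in is \<open>x - c\<close>, whose only zero is regular.\<close>

lemma approximation_regular_zero:
  assumes A: "polymap n A MA" and c: "c \<in> zero_set n A" and K: "compact K" and m: "m > 0"
  shows "\<exists>A' MA'. polymap n A' MA' \<and> (\<forall>x\<in>K. cnorm n (\<lambda>i. A' x i - A x i) \<le> m) \<and>
    c \<in> zero_set n A' \<and> regular_at n MA' c"
proof -
  have "\<exists>A' MA'. polymap n A' MA' \<and> (\<forall>x\<in>K. cnorm n (\<lambda>i. A' x i - A x i) \<le> m) \<and>
    {c} \<subseteq> zero_set n A' \<and> (\<forall>c\<in>{c}. regular_at n MA' c)"
    using c by (intro pencil_approximation[OF A polymap_coordinate_shift K m] regular_coordinate_shift)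
      (auto simp: zero_set_def)
  then show ?thesis by auto
qed

text \<open>A degenerate zero \<open>c\<close> with kernel vector \<open>v\<close> is split: \<open>c\<close> and \<open>c + t v\<close> are both zeros of
  \<open>F(x) - t \<phi>(x - c) Q(v)\<close>, where \<open>\<phi>\<close> is a coordinate with \<open>\<phi>(v) = 1\<close>.\<close>

lemma approximation_split_zero:
  assumes c: "c \<in> zero_set n (idemp n a)" "\<not> regular_at n (idempM n a) c"
    and D: "open D" "c \<in> D" and K: "compact K" and m: "m > 0"
  shows "\<exists>A' MA' S. polymap n A' MA' \<and> (\<forall>x\<in>K. cnorm n (\<lambda>i. A' x i - idemp n a x i) \<le> m) \<and>
    finite S \<and> card S = 2 \<and> S \<subseteq> zero_set n A' \<inter> D \<and> (\<forall>c\<in>S. regular_at n MA' c)"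
proof -
  let ?F = "idemp n a" and ?MF = "idempM n a"
  have c_space: "c \<in> cspace n" using c(1) by (simp add: zero_set_def)
  obtain w k where w: "k < n" "w k \<noteq> 0" "\<And>i. i < n \<Longrightarrow> (\<Sum>l<n. ?MF c c i l * w l) = 0"
    using c(2) unfolding regular_at_def cdet_0_iff by blast
  define v where "v l = (if l < n then w l / w k else 0)" for l
  have vk: "v k = 1" using w by (simp add: v_def)
  have v_space: "v \<in> cspace n" by (simp add: v_def cspace_def)
  have Mv: "(\<Sum>l<n. ?MF c c i l * v l) = 0" if "i < n" for i
  proof -
    have "(\<Sum>l<n. ?MF c c i l * v l) = (\<Sum>l<n. ?MF c c i l * w l) / w k"
      unfolding v_def sum_divide_distrib by (intro sum.cong) auto
    then show ?thesis using w(3)[OF that] by simp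
  qed
  define p where "p t = (\<lambda>l. c l + t * v l)" for t
  have p_space: "p t \<in> cspace n" for t using c_space v_space by (simp add: p_def cspace_def)
  \<comment> \<open>Taylor expansion at a zero in a kernel direction: the constant and linear terms
    vanish, and a quadratic map has nothing beyond the square term.\<close>
  have Fp: "?F (p t) i = t ^ 2 * quad n a v i" if i: "i < n" for t i
  proof -
    have "?F (p t) i = ?F (p t) i - ?F c i" using c(1) i by (simp add: zero_set_def)
    also have "\<dots> = (\<Sum>l<n. ?MF (p t) c i l * (p t l - c l))"
      by (rule polymap_hadamard[OF polymap_idemp p_space c_space i])
    also have "\<dots> = (\<Sum>l<n. t * (?MF c c i l * v l) + t ^ 2 * (\<Sum>j<n. a i l j * v j * v l))"
    proof (intro sum.cong refl)
      fix l
      have "?MF (p t) c i l = ?MF c c i l + t * (\<Sum>j<n. a i l j * v j)"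
        by (simp add: idempM_def p_def algebra_simps sum.distrib sum_distrib_left)
      then show "?MF (p t) c i l * (p t l - c l) = t * (?MF c c i l * v l) + t ^ 2 * (\<Sum>j<n. a i l j * v j * v l)"
        by (simp add: p_def power2_eq_square algebra_simps sum_distrib_left)
    qed
    also have "\<dots> = t * (\<Sum>l<n. ?MF c c i l * v l) + t ^ 2 * quad n a v i"
      unfolding quad_def by (simp add: sum.distrib sum_distrib_left mult_ac)
    finally show ?thesis using Mv[OF i] by simp
  qed
  \<comment> \<open>As \<open>v k = 1\<close>, the coordinate factor is \<open>t\<close> at
    \<open>p t\<close>; so subtracting \<open>t * P\<close> cancels
    \<open>t ^ 2 * quad n a v\<close> there and changes nothing at \<open>c\<close>.\<close>
  define P where "P x i = (x k - c k) * quad n a v i" for x i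
  define MP where "MP x y i l = (if l = k then quad n a v i else 0)" for x y :: "nat \<Rightarrow> complex" and i l
  have P: "polymap n P MP"
    unfolding polymap_def
  proof (intro conjI ballI allI impI)
    fix x y :: "nat \<Rightarrow> complex" and i
    have "(\<Sum>l<n. MP x y i l * (x l - y l)) = (\<Sum>l<n. if l = k then quad n a v i * (x k - y k) else 0)"
      unfolding MP_def by (intro sum.cong) auto
    then show "P x i - P y i = (\<Sum>l<n. MP x y i l * (x l - y l))"
      using w(1) by (simp add: P_def algebra_simps)
  qed (use w(1) in \<open>auto simp: P_def MP_def intro!: polyfun_intros\<close>)
  obtain C where C: "C > 0" "\<forall>x\<in>K. cnorm n (P x) \<le> C"
    using compact_bound_cnorm[OF K, of n P] polymap_poly[OF P] by blast
  have "continuous_on UNIV p"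
    unfolding p_def by (intro continuous_on_coordinatewise_then_product continuous_intros)
  then have "open (p -` D)" using D(1) by (rule open_vimage[rotated])
  moreover have "0 \<in> p -` D" using D(2) by (simp add: p_def)
  ultimately obtain e0 where e0: "e0 > 0" "ball 0 e0 \<subseteq> p -` D" using open_contains_ball by blast
  \<comment> \<open>\<open>e0\<close> keeps \<open>p t\<close> in \<open>D\<close>. The other bound
    spends half of \<open>m\<close> on splitting the zero and leaves half for making both zeros
    regular.\<close>
  define e where "e = min (e0 / 2) (m / 2 / C)"
  have e: "e > 0" "e < e0" "e \<le> m / 2 / C" using e0(1) m C(1) by (auto simp: e_def min_def)
  define t where "t = complex_of_real e"
  have t: "t \<noteq> 0" "p t \<in> D" "cmod t * C \<le> m / 2"
  proof -
    have "t \<in> ball 0 e0" using e by (simp add: t_def)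
    then show "p t \<in> D" using e0(2) by blast
    show "cmod t * C \<le> m / 2" using e C(1) by (simp add: t_def field_simps)
  qed (use e in \<open>simp add: t_def\<close>)
  define A where "A x i = 1 * ?F x i + (- t) * P x i" for x i
  define MA where "MA x y i l = 1 * ?MF x y i l + (- t) * MP x y i l" for x y i l
  have A: "polymap n A MA"
    unfolding A_def[abs_def] MA_def[abs_def] by (rule polymap_add[OF polymap_idemp P])
  define S where "S = {c, p t}"
  have "c \<noteq> p t"
  proof
    assume "c = p t"
    then have "c k = c k + t * v k" unfolding p_def by (rule fun_cong)
    then show False using t(1) vk by simp
  qed
  then have S: "finite S" "card S = 2" "S \<subseteq> D" by (auto simp: S_def D(2) t(2))
  have SA: "S \<subseteq> zero_set n A"
  proof -
    have "A c i = 0" "A (p t) i = 0" if "i < n" for i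
      using c(1) that vk Fp[OF that] by (auto simp: A_def P_def zero_set_def p_def power2_eq_square)
    then show ?thesis using c_space p_space by (auto simp: S_def zero_set_def)
  qed
  \<comment> \<open>\<open>c\<close> and \<open>p t\<close> may still be degenerate for
    \<open>A\<close>, so a map with regular zeros at both is mixed in. With \<phi> for
    \<open>x k - c k\<close>, it replaces the part \<open>\<phi> v\<close> of \<open>x - c\<close>
    by \<open>\<phi> (\<phi> - t) v\<close>.\<close>
  define B where "B x i = (x i - c i) - (x k - c k) * v i + (x k - c k) * (x k - c k - t) * v i" for x i
  define MB where "MB x y i l = (if l = i then 1 else 0) +
    (if l = k then (x k - c k + (y k - c k) - t - 1) * v i else 0)" for x y :: "nat \<Rightarrow> complex" and i l
  have sumB: "(\<Sum>l<n. MB x y i l * u l) = u i + (x k - c k + (y k - c k) - t - 1) * v i * u k"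
    if "i < n" for x y i and u :: "nat \<Rightarrow> complex"
  proof -
    have "(\<Sum>l<n. MB x y i l * u l) = (\<Sum>l<n. (if l = i then u i else 0)
        + (if l = k then (x k - c k + (y k - c k) - t - 1) * v i * u k else 0))"
      unfolding MB_def by (intro sum.cong) (auto simp: algebra_simps)
    then show ?thesis using that w(1) by (simp add: sum.distrib)
  qed
  have B: "polymap n B MB"
    unfolding polymap_def
  proof (intro conjI ballI allI impI)
    fix x y :: "nat \<Rightarrow> complex" and i assume "i < n"
    then show "B x i - B y i = (\<Sum>l<n. MB x y i l * (x l - y l))"
      unfolding sumB[OF \<open>i < n\<close>] by (simp add: B_def algebra_simps)
  next
    fix i l
    have coord: "continuous_on UNIV (\<lambda>p::(nat \<Rightarrow> complex) \<times> (nat \<Rightarrow> complex). fst p k)"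
      "continuous_on UNIV (\<lambda>p::(nat \<Rightarrow> complex) \<times> (nat \<Rightarrow> complex). snd p k)" for k
      by (intro continuous_on_product_then_coordinatewise[of _ fst]
          continuous_on_product_then_coordinatewise[of _ snd] continuous_intros)+
    show "continuous_on UNIV (\<lambda>(x, y). MB x y i l)"
      unfolding MB_def case_prod_beta' by (cases "l = k") (auto intro!: continuous_intros coord)
    assume "l < n" "i < n"
    then show "polyfun n (\<lambda>x. MB x x i l)"
      unfolding MB_def using w(1) by (cases "l = k") (auto intro!: polyfun_intros)
  qed (use w(1) in \<open>auto simp: B_def intro!: polyfun_intros\<close>)
  have SB: "S \<subseteq> zero_set n B"
    using c_space p_space vk by (auto simp: S_def zero_set_def B_def p_def)
  have B_reg: "regular_at n MB z" if z: "z \<in> S" for z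
    unfolding regular_at_def cdet_0_iff
  proof (clarify)
    fix u :: "nat \<Rightarrow> complex" and j
    assume u: "\<forall>i<n. (\<Sum>l<n. MB z z i l * u l) = 0" "j < n" "u j \<noteq> 0"
    \<comment> \<open>The matrix at \<open>z\<close> is the identity plus a matrix of rank one, with
      determinant \<open>1 + g\<close>, which is \<open>- t\<close> at \<open>c\<close> and
      \<open>t\<close> at \<open>p t\<close>.\<close>
    define g where "g = z k - c k + (z k - c k) - t - 1"
    have g: "1 + g \<noteq> 0" using z t(1) vk by (auto simp: S_def g_def p_def)
    have eq: "u i + g * v i * u k = 0" if "i < n" for i
      using u(1) that sumB[OF that, of z z u] unfolding g_def by simp
    have "(1 + g) * u k = 0" using eq[OF w(1)] vk by (simp add: algebra_simps)
    then have "u k = 0" using g by simp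
    then show False using eq[OF u(2)] u(3) by simp
  qed
  obtain A' MA' where A': "polymap n A' MA'" "\<forall>x\<in>K. cnorm n (\<lambda>i. A' x i - A x i) \<le> m / 2"
    "S \<subseteq> zero_set n A'" "\<forall>c\<in>S. regular_at n MA' c"
    using pencil_approximation[OF A B K, of "m / 2" S] m S(1) SA SB B_reg by auto
  have "cnorm n (\<lambda>i. A' x i - ?F x i) \<le> m" if x: "x \<in> K" for x
  proof -
    have "cnorm n (\<lambda>i. A' x i - ?F x i) = cnorm n (\<lambda>i. (A' x i - A x i) + (- t) * P x i)"
      by (rule arg_cong[where f = "cnorm n"]) (auto simp: A_def)
    also have "\<dots> \<le> cnorm n (\<lambda>i. A' x i - A x i) + cnorm n (\<lambda>i. (- t) * P x i)"
      by (rule cnorm_triangle)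
    also have "\<dots> \<le> m / 2 + cmod t * C"
      unfolding cnorm_scale norm_minus_cancel using A'(2) C(2) x by (intro add_mono mult_left_mono) auto
    finally show ?thesis using t(3) by simp
  qed
  then show ?thesis using A' S by (intro exI[of _ A'] exI[of _ MA'] exI[of _ S]) auto
qed

text \<open>Each zero \<open>c\<close> has its own auxiliary map \<open>A c\<close>, and all of
  these are continued to one common \<open>F - y\<close>. The local counts add up to at least
  \<open>2 ^ n + 1\<close>, against the bound \<open>2 ^ n\<close> of
  \<open>generic_fibre_count\<close>.\<close>

theorem zeros_regular_if_card:
  assumes card: "card (zero_set n (idemp n a)) = 2 ^ n" and c1: "c1 \<in> zero_set n (idemp n a)"
  shows "regular_at n (idempM n a) c1"
proof (rule ccontr)
  assume deg: "\<not> regular_at n (idempM n a) c1"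
  let ?F = "idemp n a" and ?MF = "idempM n a"
  define Z where "Z = zero_set n ?F"
  have finZ: "finite Z" using card card.infinite unfolding Z_def by fastforce
  have c1Z: "c1 \<in> Z" using c1 by (simp add: Z_def)
  obtain e where e: "e > 0" "\<forall>x\<in>Z. \<forall>y\<in>Z. x \<noteq> y \<longrightarrow> ball x e \<inter> ball y e = {}"
    using finite_separated[OF finZ] by blast
  have "\<exists>r>0. pball n c r \<subseteq> ball c e" if "c \<in> Z" for c
    using that e(1) by (intro pball_subset_open) (auto simp: Z_def zero_set_def)
  then obtain r where r: "\<And>c. c \<in> Z \<Longrightarrow> r c > 0 \<and> pball n c (r c) \<subseteq> ball c e" by metis
  define D where "D c = {x. cnorm n (\<lambda>i. x i - c i) < r c}" for c
  define K where "K c = pball n c (r c)" for c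
  have D_open: "open (D c)" for c
    unfolding D_def by (intro open_Collect_less continuous_intros continuous_on_product_coordinates)
  have K: "compact (K c)" for c unfolding K_def by (rule compact_pball)
  have DK: "D c \<inter> cspace n \<subseteq> K c" for c by (auto simp: D_def K_def pball_def)
  have cD: "c \<in> D c" if "c \<in> Z" for c
    using r[OF that] cnorm_eq_0_iff[of n "\<lambda>i. 0"] by (simp add: D_def)
  \<comment> \<open>\<open>c\<close> is the only zero in its ball, so the norm of \<open>F\<close>
    has a positive lower bound on the sphere \<open>K c - D c\<close>.\<close>
  have bdry: "\<exists>m>0. \<forall>x\<in>K c - D c. m \<le> cnorm n (?F x)" if c: "c \<in> Z" for c
  proof (cases "K c - D c = {}")
    case False
    have "compact (K c - D c)" using K D_open by (rule compact_diff)
    moreover have "continuous_on (K c - D c) (\<lambda>x. cnorm n (?F x))"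
      by (intro polymap_continuous_cnorm polymap_poly[OF polymap_idemp])
    ultimately obtain x where x: "x \<in> K c - D c"
      "\<And>y. y \<in> K c - D c \<Longrightarrow> cnorm n (?F x) \<le> cnorm n (?F y)"
      using continuous_attains_inf[OF _ False] by blast
    have "cnorm n (?F x) \<noteq> 0"
    proof
      assume "cnorm n (?F x) = 0"
      then have "x \<in> Z" using x(1) by (simp add: Z_def zero_set_def cnorm_eq_0_iff K_def pball_def)
      moreover have "x \<in> ball c e" using x(1) r[OF c] unfolding K_def by blast
      ultimately have "x = c" using e c by (metis IntI centre_in_ball empty_iff)
      then show False using x(1) cD[OF c] by blast
    qed
    then have "cnorm n (?F x) > 0" using cnorm_nonneg less_eq_real_def by metis
    then show ?thesis using x(2) by blast
  qed (auto intro: exI[of _ 1])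
  then obtain m where m: "\<And>c. c \<in> Z \<Longrightarrow> m c > 0 \<and> (\<forall>x\<in>K c - D c. m c \<le> cnorm n (?F x))" by metis
  define mult where "mult c = (if c = c1 then 2 else 1 :: nat)" for c
  define approx where "approx c A MA S \<longleftrightarrow> polymap n A MA \<and>
      (\<forall>x\<in>K c. cnorm n (\<lambda>i. A x i - ?F x i) \<le> m c / 8) \<and>
      finite S \<and> card S = mult c \<and> S \<subseteq> zero_set n A \<inter> D c \<and> (\<forall>c\<in>S. regular_at n MA c)" for c A MA S
  have "\<exists>A MA S. approx c A MA S" if c: "c \<in> Z" for c
  proof (cases "c = c1")
    case True
    then show ?thesis
      using approximation_split_zero[OF c1 deg D_open[of c1] cD[OF c1Z] K[of c1], of "m c1 / 8"] m[OF c1Z]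
      by (simp add: mult_def approx_def)
  next
    case False
    have "c \<in> zero_set n ?F" using c by (simp add: Z_def)
    then obtain A MA where "polymap n A MA" "\<forall>x\<in>K c. cnorm n (\<lambda>i. A x i - ?F x i) \<le> m c / 8"
      "c \<in> zero_set n A" "regular_at n MA c"
      using approximation_regular_zero[OF polymap_idemp[of n a] _ K[of c], of c "m c / 8"] m[OF c] by auto
    then show ?thesis
      using cD[OF c] False by (intro exI[of _ A] exI[of _ MA] exI[of _ "{c}"]) (simp add: mult_def approx_def)
  qed
  then obtain A MA S where "\<And>c. c \<in> Z \<Longrightarrow> approx c (A c) (MA c) (S c)"
    by metis
  note A = this[unfolded approx_def]
  have x0: "(\<lambda>_. 0) \<in> cspace n" "regular_at n ?MF (\<lambda>_. 0)"
    using regular_idemp_0 by (auto simp: cspace_def)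
  obtain q0 where q0: "polyfun n q0" "\<exists>y. q0 y \<noteq> 0" and q0_generic: "\<And>y. q0 y \<noteq> 0 \<Longrightarrow>
      (\<forall>x\<in>zero_set n (\<lambda>x i. ?F x i - y i). regular_at n ?MF x) \<and>
      finite {t. \<exists>x\<in>cspace n. (\<forall>i<n. ?F x i + t * idemp n diag_coeff x i = y i) \<and>
        cdet n (\<lambda>i k. ?MF x x i k + t * idempM n diag_coeff x x i k) = 0}"
    using generic_values[of n a] by blast
  define good where "good c q \<longleftrightarrow> polyfun n q \<and> (\<exists>y. q y \<noteq> 0) \<and> (\<forall>y. q y \<noteq> 0 \<longrightarrow>
      finite {t. \<exists>x\<in>cspace n. (\<forall>i<n. ?F x i + t * A c x i = y i) \<and>
        cdet n (\<lambda>i k. ?MF x x i k + t * MA c x x i k) = 0})" for c q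
  have "\<exists>q. good c q" if "c \<in> Z" for c
    unfolding good_def using degenerate_fibres_finite[OF polymap_idemp _ x0, of "A c" "MA c"] A[OF that] by blast
  then obtain q where "\<And>c. c \<in> Z \<Longrightarrow> good c (q c)" by metis
  note q = this[unfolded good_def]
  \<comment> \<open>A single \<open>y\<close> has to be generic for all auxiliary maps and for the
    comparison with \<open>diag_coeff\<close>; smallness is achieved afterwards by scaling.\<close>
  have "\<exists>y. \<forall>c\<in>Z. q c y \<noteq> 0"
    by (rule polyfun_finite_family_nonzero[OF finZ, of n q]) (use q in blast)+
  then obtain y0 where "\<forall>c\<in>Z. q c y0 \<noteq> 0" ..
  then have y0: "(\<Prod>c\<in>Z. q c y0) \<noteq> 0" using finZ by (simp add: prod_zero_iff)
  have q_prod: "polyfun n (\<lambda>y. \<Prod>c\<in>Z. q c y)" using q by (intro polyfun_prod) blast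
  obtain y1 where y1: "q0 y1 * (\<Prod>c\<in>Z. q c y1) \<noteq> 0"
    using polyfun_no_zero_divisors[OF q0(1) q_prod _ y0] q0(2) by blast
  define \<delta> where "\<delta> = Min (insert 1 (m ` Z))"
  have \<delta>: "\<delta> > 0" "\<And>c. c \<in> Z \<Longrightarrow> \<delta> \<le> m c"
    unfolding \<delta>_def using finZ m by auto
  have "finite {s. q0 (\<lambda>i. 0 + s * y1 i) * (\<Prod>c\<in>Z. q c (\<lambda>i. 0 + s * y1 i)) = 0}"
    using polyfun_line_finite_roots[OF polyfun_mult[OF q0(1) q_prod], of "\<lambda>_. 0" 1 y1] y1 by simp
  \<comment> \<open>Adding 1 covers the case \<open>cnorm n y1 = 0\<close>.\<close>
  moreover have "\<delta> / 8 / (cnorm n y1 + 1) > 0" using \<delta>(1) by (simp add: add_nonneg_pos)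
  ultimately obtain s where s: "s \<in> ball 0 (\<delta> / 8 / (cnorm n y1 + 1))"
    "s \<notin> {s. q0 (\<lambda>i. 0 + s * y1 i) * (\<Prod>c\<in>Z. q c (\<lambda>i. 0 + s * y1 i)) = 0}"
    by (rule ball_avoid_finite)
  define y where "y i = s * y1 i" for i
  have y_q: "q0 y \<noteq> 0" "\<And>c. c \<in> Z \<Longrightarrow> q c y \<noteq> 0"
    using s(2) finZ by (auto simp: y_def[abs_def])
  have y_small: "cnorm n y \<le> \<delta> / 8"
  proof -
    have "cnorm n y = cmod s * cnorm n y1" unfolding y_def by (rule cnorm_scale)
    also have "\<dots> \<le> cmod s * (cnorm n y1 + 1)" by (intro mult_left_mono) auto
    also have "\<dots> < \<delta> / 8"
    proof (subst pos_less_divide_eq[symmetric])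
      show "cmod s < \<delta> / 8 / (cnorm n y1 + 1)" using s(1) by simp
    qed (simp add: add_nonneg_pos)
    finally show ?thesis by simp
  qed
  let ?Fy = "\<lambda>x i. ?F x i - y i"
  have count: "finite (zero_set n ?Fy \<inter> D c) \<and> mult c \<le> card (zero_set n ?Fy \<inter> D c)" if c: "c \<in> Z" for c
  proof -
    have Ac: "polymap n (A c) (MA c)" "\<And>x. x \<in> K c \<Longrightarrow> cnorm n (\<lambda>i. A c x i - ?F x i) \<le> m c / 8"
      using A[OF c] by auto
    have Sc: "finite (S c)" "S c \<subseteq> zero_set n (A c) \<inter> D c" "\<And>z. z \<in> S c \<Longrightarrow> regular_at n (MA c) z"
      and card_Sc: "card (S c) = mult c"
      using A[OF c] by auto
    have "zero_set n (pencil (A c) ?Fy t) \<inter> K c \<subseteq> D c" if t: "t \<in> ball 0 2" for t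
    proof (rule ccontr)
      assume "\<not> ?thesis"
      then obtain x where x: "x \<in> zero_set n (pencil (A c) ?Fy t)" "x \<in> K c - D c" by blast
      have zero: "?F x i = (t - 1) * (A c x i - ?F x i) + t * y i" if "i < n" for i
      proof -
        have "(1 - t) * A c x i + t * (?F x i - y i) = 0"
          using x(1) that by (simp add: zero_set_def pencil_def)
        then show ?thesis by (simp add: algebra_simps)
      qed
      have "cnorm n (?F x) = cnorm n (\<lambda>i. (t - 1) * (A c x i - ?F x i) + t * y i)"
        unfolding cnorm_def using zero by (intro sum.cong) auto
      also have "\<dots> \<le> cnorm n (\<lambda>i. (t - 1) * (A c x i - ?F x i)) + cnorm n (\<lambda>i. t * y i)"
        by (rule cnorm_triangle)
      also have "\<dots> = cmod (t - 1) * cnorm n (\<lambda>i. A c x i - ?F x i) + cmod t * cnorm n y"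
        by (simp only: cnorm_scale)
      \<comment> \<open>For \<open>t\<close> of modulus below 2 the factors are at most 3 and 2, so
        errors of at most \<open>m c / 8\<close> add up to less than \<open>m c\<close> and no zero
        reaches the sphere.\<close>
      also have "\<dots> \<le> 3 * (m c / 8) + 2 * (m c / 8)"
      proof (intro add_mono mult_mono)
        show "cmod (t - 1) \<le> 3" using norm_triangle_ineq4[of t 1] t by simp
        show "cnorm n (\<lambda>i. A c x i - ?F x i) \<le> m c / 8" using Ac(2) x(2) by blast
        show "cnorm n y \<le> m c / 8" using y_small \<delta>(2)[OF c] by simp
      qed (use t in auto)
      also have "\<dots> < m c" using m[OF c] by simp
      finally have "cnorm n (?F x) < m c" .
      moreover have "m c \<le> cnorm n (?F x)" using m[OF c] x(2) by blast
      ultimately show False by simp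
    qed
    moreover have "finite {s. \<exists>x\<in>zero_set n (pencil (A c) ?Fy s). \<not> regular_at n (pencilM (MA c) ?MF s) x}"
      using q[OF c] y_q(2)[OF c] by (intro pencil_degenerate_finite) blast
    ultimately show ?thesis
      using perturbed_zero_count[OF Ac(1) polymap_shift[OF polymap_idemp] D_open K DK _ _ _ Sc]
        q0_generic[OF y_q(1)] unfolding card_Sc by blast
  qed
  define N where "N = (\<Union>c\<in>Z. zero_set n ?Fy \<inter> D c)"
  have "finite N" unfolding N_def using finZ count by blast
  have "card N = (\<Sum>c\<in>Z. card (zero_set n ?Fy \<inter> D c))"
    unfolding N_def
  proof (rule card_UN_disjoint[OF finZ])
    show "\<forall>c\<in>Z. finite (zero_set n ?Fy \<inter> D c)" using count by blast
    have "zero_set n ?Fy \<inter> D c \<subseteq> ball c e" if "c \<in> Z" for c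
      using DK[of c] r[OF that] unfolding K_def zero_set_def by blast
    then show "\<forall>c\<in>Z. \<forall>c'\<in>Z. c \<noteq> c' \<longrightarrow> (zero_set n ?Fy \<inter> D c) \<inter> (zero_set n ?Fy \<inter> D c') = {}"
      using e(2) by blast
  qed
  moreover have "(\<Sum>c\<in>Z. mult c) = card Z + 1"
  proof -
    have "(\<Sum>c\<in>Z. mult c) = (\<Sum>c\<in>Z. 1 + (if c = c1 then 1 else 0))"
      unfolding mult_def by (intro sum.cong) auto
    also have "\<dots> = (\<Sum>c\<in>Z. 1) + (\<Sum>c\<in>Z. if c = c1 then 1 else 0)" by (rule sum.distrib)
    finally show ?thesis using c1Z finZ by simp
  qed
  moreover have "(\<Sum>c\<in>Z. mult c) \<le> (\<Sum>c\<in>Z. card (zero_set n ?Fy \<inter> D c))"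
    using count by (intro sum_mono) blast
  moreover have "card N \<le> 2 ^ n"
    using generic_fibre_count(1)[of n a y N] q0_generic[OF y_q(1)] \<open>finite N\<close>
    unfolding N_def by blast
  ultimately show False using card unfolding Z_def by simp
qed

section \<open>Coordinates and spectra\<close>

lemma (in vector_space) basis_list_expand:
  assumes "is_basis_list scale bs"
  shows "(\<Sum>i<length bs. scale (representation (set bs) x (bs ! i)) (bs ! i)) = x"
proof -
  have bs: "distinct bs" "independent (set bs)" "span (set bs) = UNIV"
    using assms by (simp_all add: is_basis_list_def)
  have "(\<Sum>i<length bs. scale (representation (set bs) x (bs ! i)) (bs ! i))
      = (\<Sum>b\<in>set bs. scale (representation (set bs) x b) b)"
    using bij_betw_nth[OF bs(1) refl refl] by (rule sum.reindex_bij_betw)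
  also have "\<dots> = x"
    by (rule sum_representation_eq[OF bs(2)]) (use bs in auto)
  finally show ?thesis .
qed

lemma (in vector_space) basis_list_independent:
  assumes "is_basis_list scale bs" "(\<Sum>i<length bs. scale (u i) (bs ! i)) = 0" "i < length bs"
  shows "u i = 0"
proof -
  have bs: "distinct bs" "independent (set bs)"
    using assms(1) by (simp_all add: is_basis_list_def)
  have bij: "bij_betw ((!) bs) {..<length bs} (set bs)" by (rule bij_betw_nth[OF bs(1) refl refl])
  define g where "g = inv_into {..<length bs} ((!) bs)"
  have g: "g (bs ! i) = i" if "i < length bs" for i
    unfolding g_def using bij_betw_inv_into_left[OF bij] that by simp
  have "(\<Sum>b\<in>set bs. scale (u (g b)) b) = (\<Sum>i<length bs. scale (u (g (bs ! i))) (bs ! i))"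
    by (rule sum.reindex_bij_betw[OF bij, symmetric])
  also have "\<dots> = 0" using assms(2) by (simp add: g)
  finally have "u (g (bs ! i)) = 0"
    using independentD[OF bs(2) finite_set subset_refl, where u = "\<lambda>b. u (g b)"] assms(3) by simp
  then show ?thesis using g[OF assms(3)] by simp
qed

lemma (in vector_space) basis_list_eq_iff:
  assumes "is_basis_list scale bs"
  shows "(\<Sum>i<length bs. scale (u i) (bs ! i)) = (\<Sum>i<length bs. scale (w i) (bs ! i))
    \<longleftrightarrow> (\<forall>i<length bs. u i = w i)"
proof
  assume "(\<Sum>i<length bs. scale (u i) (bs ! i)) = (\<Sum>i<length bs. scale (w i) (bs ! i))"
  then have "(\<Sum>i<length bs. scale (u i - w i) (bs ! i)) = 0"
    by (simp add: scale_left_diff_distrib sum_subtractf)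
  then show "\<forall>i<length bs. u i = w i" using basis_list_independent[OF assms] by fastforce
qed simp

lemma (in vector_space) ex_basis_list:
  assumes "finite B" "span B = UNIV"
  shows "\<exists>bs. is_basis_list scale bs"
proof -
  obtain C where C: "C \<subseteq> B" "independent C" "span C = UNIV"
    using maximal_independent_subset[of B] assms(2) by (metis span_mono span_span top.extremum_unique)
  then obtain bs where "set bs = C" "distinct bs"
    using finite_distinct_list finite_subset assms(1) by metis
  then show ?thesis using C unfolding is_basis_list_def by blast
qed

context complexification
begin

lemma j_0: "j 0 = 0" using j_add[of 0 0] by simp

lemma j_sum: "j (\<Sum>i\<in>I. f i) = (\<Sum>i\<in>I. j (f i))"
  by (induction I rule: infinite_finite_induct) (simp_all add: j_0 j_add)

lemma mulC_sum_right: "mulC x (\<Sum>i\<in>I. scaleC (u i) (f i)) = (\<Sum>i\<in>I. scaleC (u i) (mulC x (f i)))"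
proof -
  interpret l: Vector_Spaces.linear scaleC scaleC "\<lambda>y. mulC x y" by (rule AC.linear_right)
  show ?thesis by (simp add: l.sum l.scale)
qed

lemma mulC_sum_left: "mulC (\<Sum>i\<in>I. scaleC (u i) (f i)) y = (\<Sum>i\<in>I. scaleC (u i) (mulC (f i) y))"
proof -
  interpret l: Vector_Spaces.linear scaleC scaleC "\<lambda>x. mulC x y" by (rule AC.linear_left)
  show ?thesis by (simp add: l.sum l.scale)
qed

lemma basis_list_map:
  assumes "is_basis_list scale bs" shows "is_basis_list scaleC (map j bs)"
proof -
  have bs: "distinct bs" "\<not> A.dependent (set bs)"
    using assms by (simp_all add: is_basis_list_def)
  have "j x \<in> AC.span (j ` set bs)" for x
  proof -
    have "j x = j (\<Sum>i<length bs. scale (A.representation (set bs) x (bs ! i)) (bs ! i))"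
      unfolding A.basis_list_expand[OF assms] ..
    also have "\<dots> = (\<Sum>i<length bs. scaleC (\<iota> (A.representation (set bs) x (bs ! i))) (j (bs ! i)))"
      by (simp only: j_sum j_scale)
    also have "\<dots> \<in> AC.span (j ` set bs)"
      by (intro AC.span_sum AC.span_scale AC.span_base) auto
    finally show ?thesis .
  qed
  then have "AC.span (range j) \<subseteq> AC.span (j ` set bs)"
    by (intro AC.span_minimal AC.subspace_span) auto
  then show ?thesis
    using bs j_independent[OF bs(2)] j_inj j_spans
    by (auto simp: is_basis_list_def distinct_map inj_on_def)
qed

text \<open>Evaluation \<open>p \<mapsto> poly (map_poly \<iota> p) z\<close> is a ring homomorphism and so commutes with the
  determinant.\<close>

lemma poly_endo_char_poly:
  assumes hom: "field_hom \<iota>" and ex: "\<exists>bs. is_basis_list scale bs"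
  shows "\<exists>bs. is_basis_list scale bs \<and> (\<forall>z. poly (map_poly \<iota> (endo_char_poly scale f)) z
    = cdet (length bs) (\<lambda>i k. \<iota> (A.representation (set bs) (f (bs ! k)) (bs ! i)) - (if i = k then z else 0)))"
proof -
  interpret \<iota>: field_hom \<iota> by fact
  define bs where "bs = (SOME bs. is_basis_list scale bs)"
  define n where "n = length bs"
  define M where "M = map_mat (\<lambda>a. [:a:]) (matrix_of scale bs f) - [:0, 1:] \<cdot>\<^sub>m 1\<^sub>m n"
  have bs: "is_basis_list scale bs" unfolding bs_def using ex by (rule someI_ex)
  have char_poly: "endo_char_poly scale f = Determinant.det M"
    unfolding endo_char_poly_def M_def bs_def n_def Let_def ..
  have "poly (map_poly \<iota> (endo_char_poly scale f)) z
    = cdet n (\<lambda>i k. \<iota> (A.representation (set bs) (f (bs ! k)) (bs ! i)) - (if i = k then z else 0))" for z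
  proof -
    interpret map_poly_hom: map_poly_comm_ring_hom \<iota> ..
    interpret h: comm_ring_hom "\<lambda>p. poly (map_poly \<iota> p) z"
      by unfold_locales (simp_all add: hom_distribs map_poly_hom.hom_mult)
    have "poly (map_poly \<iota> (endo_char_poly scale f)) z = Determinant.det (map_mat (\<lambda>p. poly (map_poly \<iota> p) z) M)"
      unfolding char_poly by (rule h.hom_det[symmetric])
    also have "map_mat (\<lambda>p. poly (map_poly \<iota> p) z) M = Matrix.mat n n
        (\<lambda>(i, k). \<iota> (A.representation (set bs) (f (bs ! k)) (bs ! i)) - (if i = k then z else 0))"
      by (intro eq_matI) (auto simp: M_def matrix_of_def n_def hom_distribs)
    finally show ?thesis unfolding cdet_def .
  qed
  then show ?thesis using bs unfolding n_def by blast
qed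

text \<open>Roots of the characteristic polynomial need not come from the base field, so their
  eigenvectors are sought in the complexification.\<close>

lemma peirce_spectrum_iff:
  assumes hom: "field_hom \<iota>" and ex: "\<exists>bs. is_basis_list scale bs"
  shows "z \<in># peirce_spectrum \<iota> scale mul c \<longleftrightarrow> (\<exists>v. v \<noteq> 0 \<and> mulC (j c) v = scaleC z v)"
proof -
  obtain bs where bs: "is_basis_list scale bs" and poly: "\<And>z. poly (map_poly \<iota> (endo_char_poly scale (mul c))) z
    = cdet (length bs) (\<lambda>i k. \<iota> (A.representation (set bs) (mul c (bs ! k)) (bs ! i)) - (if i = k then z else 0))"
    using poly_endo_char_poly[OF hom ex] by blast
  let ?p = "map_poly \<iota> (endo_char_poly scale (mul c))"
  define n where "n = length bs"
  define m where "m i k = \<iota> (A.representation (set bs) (mul c (bs ! k)) (bs ! i))" for i k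
  have jbs: "is_basis_list scaleC (map j bs)" by (rule basis_list_map[OF bs])
  have mulb: "mulC (j c) (j (bs ! k)) = (\<Sum>i<n. scaleC (m i k) (j (bs ! i)))" if "k < n" for k
  proof -
    have "mulC (j c) (j (bs ! k)) = j (mul c (bs ! k))" by (simp add: j_mult)
    also have "\<dots> = j (\<Sum>i<n. scale (A.representation (set bs) (mul c (bs ! k)) (bs ! i)) (bs ! i))"
      unfolding n_def A.basis_list_expand[OF bs] ..
    finally show ?thesis by (simp add: j_sum j_scale m_def)
  qed
  define \<phi> where "\<phi> u = (\<Sum>k<n. scaleC (u k) (j (bs ! k)))" for u
  have \<phi>_eq: "\<phi> u = \<phi> w \<longleftrightarrow> (\<forall>i<n. u i = w i)" for u w
    using AC.basis_list_eq_iff[OF jbs, of u w] by (simp add: \<phi>_def n_def cong: sum.cong_simp)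
  have \<phi>_0: "\<phi> (\<lambda>_. 0) = 0" by (simp add: \<phi>_def)
  have \<phi>_scale: "scaleC t (\<phi> u) = \<phi> (\<lambda>i. t * u i)" for t u
    by (simp add: \<phi>_def AC.scale_sum_right)
  have \<phi>_mul: "mulC (j c) (\<phi> u) = \<phi> (\<lambda>i. \<Sum>k<n. m i k * u k)" for u
  proof -
    have "mulC (j c) (\<phi> u) = (\<Sum>k<n. scaleC (u k) (\<Sum>i<n. scaleC (m i k) (j (bs ! i))))"
      unfolding \<phi>_def mulC_sum_right by (intro sum.cong refl) (simp add: mulb)
    also have "\<dots> = (\<Sum>k<n. \<Sum>i<n. scaleC (m i k * u k) (j (bs ! i)))"
      by (simp add: AC.scale_sum_right mult.commute)
    also have "\<dots> = (\<Sum>i<n. \<Sum>k<n. scaleC (m i k * u k) (j (bs ! i)))" by (rule sum.swap)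
    finally show ?thesis by (simp add: \<phi>_def AC.scale_sum_left)
  qed
  have \<phi>_surj: "\<exists>u. \<phi> u = v" for v
    using AC.basis_list_expand[OF jbs, of v] unfolding \<phi>_def n_def
    by (intro exI[of _ "\<lambda>k. AC.representation (set (map j bs)) v (map j bs ! k)"]) (simp cong: sum.cong_simp)
  have root: "poly ?p z = 0 \<longleftrightarrow> (\<exists>u. (\<exists>k<n. u k \<noteq> 0) \<and> (\<forall>i<n. (\<Sum>k<n. m i k * u k) = z * u i))" for z
  proof -
    have "(\<Sum>k<n. (m i k - (if i = k then z else 0)) * u k) = (\<Sum>k<n. m i k * u k) - z * u i"
      if "i < n" for i u
    proof -
      have "(\<Sum>k<n. (if i = k then z else 0) * u k) = (\<Sum>k<n. if k = i then z * u k else 0)"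
        by (intro sum.cong) auto
      then show ?thesis using that by (simp add: left_diff_distrib sum_subtractf)
    qed
    then show ?thesis
      unfolding poly cdet_0_iff m_def[symmetric] n_def[symmetric] by auto
  qed
  \<comment> \<open>\<open>proots\<close> is empty for the zero polynomial, so this case has to be
    excluded: a finite matrix does not have every complex number as an eigenvalue.\<close>
  have "?p \<noteq> 0"
  proof
    assume "?p = 0"
    then have "\<forall>z. \<exists>u. (\<exists>k<n. u k \<noteq> 0) \<and> (\<forall>i<n. (\<Sum>k<n. m i k * u k) = z * u i)"
      using root by simp
    then have "{z. \<exists>u. (\<exists>k<n. u k \<noteq> 0) \<and> (\<forall>i<n. (\<Sum>k<n. m i k * u k) = z * u i)} = UNIV"
      by (simp only: UNIV_def)
    moreover have "finite {z. \<exists>u. (\<exists>k<n. u k \<noteq> 0) \<and> (\<forall>i<n. (\<Sum>k<n. m i k * u k) = z * u i)}"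
      using finite_eigenvalues[of "{..<n}" m] by (simp only: Bex_def Ball_def lessThan_iff finite_lessThan)
    ultimately show False using infinite_UNIV_char_0 by metis
  qed
  then have "z \<in># peirce_spectrum \<iota> scale mul c \<longleftrightarrow> poly ?p z = 0"
    unfolding peirce_spectrum_def by simp
  also have "\<dots> \<longleftrightarrow> (\<exists>u. \<phi> u \<noteq> 0 \<and> mulC (j c) (\<phi> u) = scaleC z (\<phi> u))"
    unfolding root \<phi>_mul \<phi>_scale \<phi>_eq unfolding \<phi>_0[symmetric] \<phi>_eq by auto
  also have "\<dots> \<longleftrightarrow> (\<exists>v. v \<noteq> 0 \<and> mulC (j c) v = scaleC z v)"
    using \<phi>_surj by metis
  finally show ?thesis .
qed

end

text \<open>In (b) spectrum and nilpotents are those of the complexification. This matters: the real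
  algebra with \<open>(x, y)^2 = (x^2 + y^2, 0)\<close> has no nonzero real 2-nilpotent and spectrum
  \<open>{0, 1}\<close>, but its complexification has only two idempotents instead of four.\<close>

theorem theorem3p2:
  fixes \<iota> :: "'k::field \<Rightarrow> complex"
    and scale :: "'k \<Rightarrow> 'a::ab_group_add \<Rightarrow> 'a" and mul :: "'a \<Rightarrow> 'a \<Rightarrow> 'a"
    and scaleC :: "complex \<Rightarrow> 'v::ab_group_add \<Rightarrow> 'v" and mulC :: "'v \<Rightarrow> 'v \<Rightarrow> 'v"
    and j :: "'a \<Rightarrow> 'v"
  assumes "field_hom \<iota>"
    and "fd_comm_nonassoc_algebra scale mul"
    and "complexification \<iota> scale mul scaleC mulC j"
  shows "(generic_algebra scale mulC \<longrightarrow>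
            1/2 \<notin> algebra_spectrum \<iota> scale mul \<and>
            1/2 \<notin> algebra_spectrum (\<lambda>z. z) scaleC mulC) \<and>
         (1/2 \<notin> algebra_spectrum (\<lambda>z. z) scaleC mulC \<and> two_nilpotents mulC \<subseteq> {0} \<longrightarrow>
            generic_algebra scale mulC)"
proof -
  interpret F: fd_comm_nonassoc_algebra scale mul by fact
  interpret complexification \<iota> scale mul scaleC mulC j by fact
  \<comment> \<open>Seen as its own complexification, the complex algebra falls under the same lemma
    on spectra.\<close>
  interpret self: complexification "\<lambda>z. z" scaleC mulC scaleC mulC "\<lambda>x. x"
    by (rule complexification_self) (rule AC.nonassoc_algebra_axioms)
  obtain bs where bs: "is_basis_list scale bs" using F.finite_dim F.ex_basis_list by blast
  define n where "n = length bs"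
  define b where "b k = j (bs ! k)" for k
  have jbs: "is_basis_list scaleC (map j bs)" by (rule basis_list_map[OF bs])
  have dim: "vector_space.dim scale (UNIV :: 'a set) = n"
  proof -
    have "F.dim UNIV = card (set bs)"
      using bs by (intro F.dim_eq_card) (auto simp: is_basis_list_def F.span_UNIV)
    then show ?thesis using bs by (simp add: n_def is_basis_list_def distinct_card)
  qed
  define \<phi> where "\<phi> u = (\<Sum>k<n. scaleC (u k) (b k))" for u
  have \<phi>_eq: "\<phi> u = \<phi> w \<longleftrightarrow> (\<forall>i<n. u i = w i)" for u w
    using AC.basis_list_eq_iff[OF jbs, of u w] by (simp add: \<phi>_def b_def n_def cong: sum.cong_simp)
  have \<phi>_0: "\<phi> (\<lambda>_. 0) = 0" by (simp add: \<phi>_def)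
  have \<phi>_scale: "scaleC t (\<phi> u) = \<phi> (\<lambda>i. t * u i)" for t u
    by (simp add: \<phi>_def AC.scale_sum_right)
  define coord where "coord v k = (if k < n then AC.representation (set (map j bs)) v (map j bs ! k) else 0)" for v k
  have \<phi>_coord: "\<phi> (coord v) = v" for v
    using AC.basis_list_expand[OF jbs, of v] by (simp add: \<phi>_def coord_def b_def n_def cong: sum.cong_simp)
  have coord_space: "coord v \<in> cspace n" for v by (simp add: coord_def cspace_def)
  define a where "a i k l = coord (mulC (b k) (b l)) i" for i k l
  \<comment> \<open>Commutativity is given for \<open>mul\<close> only; it reaches the structure
    constants because the basis lies in the image of \<open>j\<close>.\<close>
  have a_sym: "a i k l = a i l k" for i k l
    unfolding a_def b_def using F.commute by (metis j_mult)
  have \<phi>_mul: "mulC (\<phi> x) (\<phi> y) = \<phi> (\<lambda>i. \<Sum>k<n. \<Sum>l<n. a i k l * x k * y l)" for x y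
  proof -
    have "mulC (\<phi> x) (\<phi> y) = (\<Sum>k<n. scaleC (x k) (mulC (b k) (\<phi> y)))"
      unfolding \<phi>_def[of x] by (rule mulC_sum_left)
    also have "\<dots> = (\<Sum>k<n. scaleC (x k) (\<Sum>l<n. scaleC (y l) (mulC (b k) (b l))))"
      unfolding \<phi>_def by (simp only: mulC_sum_right)
    also have "\<dots> = (\<Sum>k<n. scaleC (x k) (\<Sum>l<n. scaleC (y l) (\<phi> (\<lambda>i. a i k l))))"
      unfolding a_def[abs_def] by (simp add: \<phi>_coord)
    also have "\<dots> = (\<Sum>k<n. \<Sum>l<n. \<Sum>i<n. scaleC (a i k l * x k * y l) (b i))"
      by (simp add: \<phi>_def AC.scale_sum_right mult_ac)
    also have "\<dots> = (\<Sum>k<n. \<Sum>i<n. \<Sum>l<n. scaleC (a i k l * x k * y l) (b i))"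
      by (rule sum.cong[OF refl]) (rule sum.swap)
    also have "\<dots> = (\<Sum>i<n. \<Sum>k<n. \<Sum>l<n. scaleC (a i k l * x k * y l) (b i))"
      by (rule sum.swap)
    finally show ?thesis by (simp add: \<phi>_def AC.scale_sum_left)
  qed
  have sq: "mulC (\<phi> x) (\<phi> x) = \<phi> (quad n a x)" for x
    unfolding \<phi>_mul quad_def[abs_def] ..
  have idem: "\<phi> x \<in> idempotents mulC \<longleftrightarrow> (\<forall>i<n. idemp n a x i = 0)" for x
    unfolding idempotents_def mem_Collect_eq sq \<phi>_eq by (simp add: idemp_def)
  have "bij_betw \<phi> (zero_set n (idemp n a)) (idempotents mulC)"
  proof (rule bij_betw_imageI)
    show "inj_on \<phi> (zero_set n (idemp n a))"
      by (rule inj_onI) (auto simp: \<phi>_eq zero_set_def intro: cspace_eqI)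
    show "\<phi> ` zero_set n (idemp n a) = idempotents mulC"
    proof
      show "idempotents mulC \<subseteq> \<phi> ` zero_set n (idemp n a)"
      proof
        fix v assume "v \<in> idempotents mulC"
        then have "coord v \<in> zero_set n (idemp n a)"
          using idem[of "coord v"] coord_space by (simp add: \<phi>_coord zero_set_def)
        then show "v \<in> \<phi> ` zero_set n (idemp n a)" by (metis \<phi>_coord imageI)
      qed
    qed (use idem in \<open>auto simp: zero_set_def\<close>)
  qed
  then have image: "\<phi> ` zero_set n (idemp n a) = idempotents mulC"
    and card: "card (idempotents mulC) = card (zero_set n (idemp n a))"
    by (simp_all add: bij_betw_imp_surj_on bij_betw_same_card)
  have irregular: "\<not> regular_at n (idempM n a) x \<longleftrightarrow>
      (\<exists>v. v \<noteq> 0 \<and> mulC (\<phi> x) v = scaleC (1 / 2) v)" for x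
  proof -
    have M: "(\<Sum>k<n. idempM n a x x i k * u k) = 2 * (\<Sum>k<n. \<Sum>l<n. a i k l * x k * u l) - u i"
      if "i < n" for i u
    proof -
      have "(\<Sum>k<n. (if i = k then 1 else 0) * u k) = (\<Sum>k<n. if k = i then u k else 0)"
        by (intro sum.cong) auto
      then have "(\<Sum>k<n. (if i = k then 1 else 0) * u k) = u i" using that by simp
      moreover have "(\<Sum>k<n. (\<Sum>l<n. a i k l * x l + a i l k * x l) * u k)
          = 2 * (\<Sum>k<n. \<Sum>l<n. a i l k * x l * u k)"
      proof -
        have "a i k l * x l + a i l k * x l = 2 * (a i l k * x l)" for k l
          using a_sym[of i k l] by simp
        then show ?thesis by (simp only: sum_distrib_left sum_distrib_right mult.assoc)
      qed
      moreover have "(\<Sum>k<n. \<Sum>l<n. a i l k * x l * u k) = (\<Sum>k<n. \<Sum>l<n. a i k l * x k * u l)"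
        by (rule sum.swap)
      ultimately show ?thesis unfolding idempM_def left_diff_distrib sum_subtractf by simp
    qed
    have eq: "(\<Sum>k<n. idempM n a x x i k * u k) = 0 \<longleftrightarrow>
        (\<Sum>k<n. \<Sum>l<n. a i k l * x k * u l) = 1 / 2 * u i" if "i < n" for i u
      unfolding M[OF that] by (simp add: eq_divide_eq mult.commute)
    have "\<not> regular_at n (idempM n a) x \<longleftrightarrow> (\<exists>u. \<phi> u \<noteq> 0 \<and> mulC (\<phi> x) (\<phi> u) = scaleC (1 / 2) (\<phi> u))"
      unfolding regular_at_def cdet_0_iff \<phi>_mul \<phi>_scale \<phi>_eq unfolding \<phi>_0[symmetric] \<phi>_eq
      using eq by blast
    then show ?thesis using \<phi>_coord by metis
  qed
  have "field_hom (\<lambda>z::complex. z)" by unfold_locales auto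
  then have specC: "z \<in># peirce_spectrum (\<lambda>z. z) scaleC mulC c \<longleftrightarrow>
      (\<exists>v. v \<noteq> 0 \<and> mulC c v = scaleC z v)" for c z
    by (rule self.peirce_spectrum_iff) (rule exI, rule jbs)
  have half: "1 / 2 \<in> algebra_spectrum (\<lambda>z. z) scaleC mulC \<longleftrightarrow>
      (\<exists>x\<in>zero_set n (idemp n a). \<not> regular_at n (idempM n a) x)"
  proof -
    have "1 / 2 \<in> algebra_spectrum (\<lambda>z. z) scaleC mulC \<longleftrightarrow>
        (\<exists>c\<in>idempotents mulC. \<exists>v. v \<noteq> 0 \<and> mulC c v = scaleC (1 / 2) v)"
      unfolding algebra_spectrum_def by (simp add: specC)
    also have "\<dots> \<longleftrightarrow> (\<exists>x\<in>zero_set n (idemp n a). \<not> regular_at n (idempM n a) x)"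
      unfolding irregular image[symmetric] by blast
    finally show ?thesis .
  qed
  \<comment> \<open>An idempotent of the original algebra stays one in the complexification and
    keeps its eigenvalues, so excluding \<open>1/2\<close> from the complex spectrum settles both
    halves of (a).\<close>
  have sub: "algebra_spectrum \<iota> scale mul \<subseteq> algebra_spectrum (\<lambda>z. z) scaleC mulC"
  proof
    fix z assume "z \<in> algebra_spectrum \<iota> scale mul"
    then obtain c where c: "mul c c = c" "z \<in># peirce_spectrum \<iota> scale mul c"
      by (auto simp: algebra_spectrum_def idempotents_def)
    have "\<exists>bs. is_basis_list scale bs" using bs by (rule exI)
    from c(2)[unfolded peirce_spectrum_iff[OF assms(1) this]]
    have "z \<in># peirce_spectrum (\<lambda>z. z) scaleC mulC (j c)" by (simp only: specC)
    moreover have "j c \<in> idempotents mulC" using c(1) by (simp add: idempotents_def flip: j_mult)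
    ultimately show "z \<in> algebra_spectrum (\<lambda>z. z) scaleC mulC" by (auto simp: algebra_spectrum_def)
  qed
  have generic: "generic_algebra scale mulC \<longleftrightarrow> card (zero_set n (idemp n a)) = 2 ^ n"
    by (simp add: generic_algebra_def card dim)
  have "no_nilpotents n a" if "two_nilpotents mulC \<subseteq> {0}"
    unfolding no_nilpotents_def
  proof (intro ballI impI)
    fix x assume "\<forall>i<n. quad n a x i = 0"
    then have "\<phi> x \<in> two_nilpotents mulC"
      unfolding two_nilpotents_def mem_Collect_eq sq \<phi>_0[symmetric] \<phi>_eq .
    then have "\<phi> x = \<phi> (\<lambda>_. 0)" using that \<phi>_0 by auto
    then show "\<forall>i<n. x i = 0" unfolding \<phi>_eq .
  qed
  then have b: "generic_algebra scale mulC"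
    if "1 / 2 \<notin> algebra_spectrum (\<lambda>z. z) scaleC mulC" "two_nilpotents mulC \<subseteq> {0}"
    unfolding generic using that half by (intro card_zeros_regular) blast+
  have a: "1 / 2 \<notin> algebra_spectrum (\<lambda>z. z) scaleC mulC" if "generic_algebra scale mulC"
    using zeros_regular_if_card[OF that[unfolded generic]] half by blast
  show ?thesis using a b sub by blast
qed

end
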